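(* For $\alpha>0$ consider the interpolating process, i.e. the determinantal point process on $\mathbb{R}$ with correlation kernel $$M_\alpha(x,y)=\int_{-\infty}^\infty\frac{e^{\alpha\lambda}}{e^{\alpha\lambda}+1}\,\mathrm{Ai}(x+\lambda)\,\mathrm{Ai}(y+\lambda)\,d\lambda ,$$ which almost surely has a last (rightmost) particle. Let $F_\alpha$ be the distribution function of the position of the last particle. Then for every real $t$ $$F_\alpha(t)=\sum_{n=0}^\infty\frac{(-1)^n}{n!}\int_{(t,\infty)^n}\det(M_\alpha(x_i,x_j))_{1\le i,j\le n}\,d^nx=\det(I-M_\alpha)_{L^2(t,\infty)} .$$ Furthermore, for every real $\xi$, $$\lim_{\alpha\to0+}F_\alpha\Big(\frac\xi\alpha-\frac1{2\alpha}\log(4\pi\alpha^3)\Big)=F_G(\xi),\qquad \lim_{\alpha\to\infty}F_\alpha(\xi)=F_{TW}(\xi).$$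
   Context: $\mathrm{Ai}$ is the Airy function. A point process on $\mathbb{R}$ is determinantal with correlation kernel $K$ if its correlation functions with respect to Lebesgue measure are $\rho_k(x_1,\dots,x_k)=\det(K(x_i,x_j))_{1\le i,j\le k}$, $k\ge1$; here correlation functions are characterized by $\mathbb{E}[\prod_j(1+\phi(x_j))]=\sum_{k\ge0}\frac1{k!}\int_{\mathbb{R}^k}\prod_{j=1}^k\phi(x_j)\rho_k(x)\,d^kx$ for bounded measurable compactly supported $\phi$ (product over all particles). The process with kernel $M_\alpha$ exists, $M_\alpha$ is trace class on $L^2(t,\infty)$ for every real $t$, and $\det(I-M_\alpha)_{L^2(t,\infty)}$ is the Fredholm determinant. $F_G(\xi)=e^{-e^{-\xi}}$ is the Gumbel distribution. $F_{TW}(\xi)=\det(I-K_{\mathrm{Airy}})_{L^2(\xi,\infty)}$ is the Tracy-Widom distribution, where $K_{\mathrm{Airy}}(x,y)=\int_0^\infty\mathrm{Ai}(x+\lambda)\mathrm{Ai}(y+\lambda)\,d\lambda$. *)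

theory Defs
  imports "HOL-Probability.Probability" "Jordan_Normal_Form.Determinant"
begin

hide_const (open) Determinants.det

text \<open>Finite determinants are those of Jordan_Normal_Form. Points of \<open>\<real>\<^sup>k\<close> are elements of the
  product space \<open>\<Pi>\<^sub>M i\<in>{..<k}. lborel\<close>; for \<open>k = 0\<close> this is a one-point space of mass 1, and the
  empty determinant is 1.\<close>

definition kernel_minor :: "(real \<Rightarrow> real \<Rightarrow> real) \<Rightarrow> nat \<Rightarrow> (nat \<Rightarrow> real) \<Rightarrow> real" where
  "kernel_minor K k x = det (mat k k (\<lambda>(i, j). K (x i) (x j)))"

section \<open>Point processes\<close>

text \<open>A configuration is given by its multiplicity function: \<open>c x\<close> is the number of particles
  at \<open>x\<close>.\<close>

definition locally_finite_config :: "(real \<Rightarrow> nat) \<Rightarrow> bool" where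
  "locally_finite_config c \<longleftrightarrow> (\<forall>B. bounded B \<longrightarrow> finite {x \<in> B. 0 < c x})"

definition particle_count :: "(real \<Rightarrow> nat) \<Rightarrow> real set \<Rightarrow> nat" where
  "particle_count c B = (\<Sum>x | x \<in> B \<and> 0 < c x. c x)"

definition point_process :: "'w measure \<Rightarrow> ('w \<Rightarrow> real \<Rightarrow> nat) \<Rightarrow> bool" where
  "point_process P X \<longleftrightarrow>
     prob_space P \<and>
     (\<forall>w\<in>space P. locally_finite_config (X w)) \<and>
     (\<forall>B\<in>sets borel. bounded B \<longrightarrow> (\<lambda>w. particle_count (X w) B) \<in> measurable P (count_space UNIV))"

text \<open>The product of \<open>1 + \<phi>(x\<^sub>j)\<close> over all particles \<open>x\<^sub>j\<close>. Factors equal to 1 are left out, so that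
  for boundedly supported \<open>\<phi>\<close> the product has finitely many factors.\<close>

definition particle_product :: "(real \<Rightarrow> real) \<Rightarrow> (real \<Rightarrow> nat) \<Rightarrow> real" where
  "particle_product \<phi> c = (\<Prod>x | 0 < c x \<and> \<phi> x \<noteq> 0. (1 + \<phi> x) ^ c x)"

definition test_function :: "(real \<Rightarrow> real) \<Rightarrow> bool" where
  "test_function \<phi> \<longleftrightarrow>
     \<phi> \<in> borel_measurable borel \<and> bounded (range \<phi>) \<and> compact (closure {x. \<phi> x \<noteq> 0})"

definition correlation_functions ::
    "'w measure \<Rightarrow> ('w \<Rightarrow> real \<Rightarrow> nat) \<Rightarrow> (nat \<Rightarrow> (nat \<Rightarrow> real) \<Rightarrow> real) \<Rightarrow> bool" where
  "correlation_functions P X \<rho> \<longleftrightarrow>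
     (\<forall>\<phi>. test_function \<phi> \<longrightarrow>
        integrable P (\<lambda>w. particle_product \<phi> (X w)) \<and>
        (\<forall>k. integrable (\<Pi>\<^sub>M i\<in>{..<k}. lborel) (\<lambda>x. (\<Prod>j<k. \<phi> (x j)) * \<rho> k x)) \<and>
        (\<lambda>k. 1 / fact k * (\<integral>x. (\<Prod>j<k. \<phi> (x j)) * \<rho> k x \<partial>(\<Pi>\<^sub>M i\<in>{..<k}. lborel)))
          sums (\<integral>w. particle_product \<phi> (X w) \<partial>P))"

definition determinantal_process ::
    "'w measure \<Rightarrow> ('w \<Rightarrow> real \<Rightarrow> nat) \<Rightarrow> (real \<Rightarrow> real \<Rightarrow> real) \<Rightarrow> bool" where
  "determinantal_process P X K \<longleftrightarrow>
     point_process P X \<and> correlation_functions P X (kernel_minor K)"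

definition is_last_particle :: "(real \<Rightarrow> nat) \<Rightarrow> real \<Rightarrow> bool" where
  "is_last_particle c x \<longleftrightarrow> 0 < c x \<and> (\<forall>y. 0 < c y \<longrightarrow> y \<le> x)"

text \<open>On configurations without a last particle \<open>last_particle\<close> is a fixed unspecified real.\<close>

definition last_particle :: "(real \<Rightarrow> nat) \<Rightarrow> real" where
  "last_particle c = (THE x. is_last_particle c x)"

definition last_particle_cdf :: "'w measure \<Rightarrow> ('w \<Rightarrow> real \<Rightarrow> nat) \<Rightarrow> real \<Rightarrow> real" where
  "last_particle_cdf P X = cdf (distr P borel (\<lambda>w. last_particle (X w)))"

section \<open>Fredholm determinants on \<open>L\<^sup>2(S)\<close>\<close>

definition L2_fun :: "real set \<Rightarrow> (real \<Rightarrow> real) \<Rightarrow> bool" where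
  "L2_fun S f \<longleftrightarrow>
     set_borel_measurable lborel S f \<and> set_integrable lborel S (\<lambda>x. (f x)\<^sup>2)"

definition L2_inner :: "real set \<Rightarrow> (real \<Rightarrow> real) \<Rightarrow> (real \<Rightarrow> real) \<Rightarrow> real" where
  "L2_inner S f g = (LINT x:S|lborel. f x * g x)"

text \<open>Countably infinite orthonormal bases, as appropriate for the separable, infinite-dimensional
  space \<open>L\<^sup>2(S)\<close> over a Borel set \<open>S\<close> of positive measure.\<close>

definition L2_orthonormal_basis :: "real set \<Rightarrow> (nat \<Rightarrow> real \<Rightarrow> real) \<Rightarrow> bool" where
  "L2_orthonormal_basis S e \<longleftrightarrow>
     (\<forall>i. L2_fun S (e i)) \<and>
     (\<forall>i j. L2_inner S (e i) (e j) = (if i = j then 1 else 0)) \<and>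
     (\<forall>f. L2_fun S f \<longrightarrow> (\<forall>i. L2_inner S (e i) f = 0) \<longrightarrow> (AE x in lborel. x \<in> S \<longrightarrow> f x = 0))"

definition integral_operator ::
    "real set \<Rightarrow> (real \<Rightarrow> real \<Rightarrow> real) \<Rightarrow> (real \<Rightarrow> real) \<Rightarrow> real \<Rightarrow> real" where
  "integral_operator S K f x = (LINT y:S|lborel. K x y * f y)"

text \<open>The trace of the \<open>k\<close>-th exterior power of a trace class operator \<open>A\<close> on \<open>L\<^sup>2(S)\<close>. It is the sum of
  the diagonal matrix elements of \<open>\<Lambda>\<^sup>k A\<close> in the orthonormal basis
  \<open>e\<^bsub>i(0)\<^esub> \<and> \<dots> \<and> e\<^bsub>i(k-1)\<^esub>\<close>, \<open>i(0) < \<dots> < i(k-1)\<close>, of the \<open>k\<close>-th exterior power of \<open>L\<^sup>2(S)\<close>, and does not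
  depend on the orthonormal basis \<open>e\<close> of \<open>L\<^sup>2(S)\<close>.\<close>

definition trace_exterior_power ::
    "real set \<Rightarrow> ((real \<Rightarrow> real) \<Rightarrow> real \<Rightarrow> real) \<Rightarrow> nat \<Rightarrow> real" where
  "trace_exterior_power S A k =
     (THE \<tau>. \<forall>e. L2_orthonormal_basis S e \<longrightarrow>
        ((\<lambda>i. det (mat k k (\<lambda>(a, b). L2_inner S (e (i a)) (A (e (i b)))))) has_sum \<tau>)
          {i \<in> {..<k} \<rightarrow>\<^sub>E UNIV. strict_mono_on {..<k} i})"

text \<open>The determinant of \<open>I - A\<close> for a trace class operator \<open>A\<close>, as
  \<open>\<Sum>\<^sub>k Tr (\<Lambda>\<^sup>k (-A))\<close> (see Simon, Trace Ideals and Their Applications, Chapter 3).\<close>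

definition fredholm_det :: "real set \<Rightarrow> ((real \<Rightarrow> real) \<Rightarrow> real \<Rightarrow> real) \<Rightarrow> real" where
  "fredholm_det S A = (\<Sum>k. (-1) ^ k * trace_exterior_power S A k)"

section \<open>Airy function, kernels and limit distributions\<close>

text \<open>The integral is only conditionally convergent; the Henstock-Kurzweil integral over \<open>{0..}\<close>
  is the improper integral, the limit of the integrals over \<open>{0..T}\<close> for \<open>T \<rightarrow> \<infinity>\<close>.\<close>

definition Ai :: "real \<Rightarrow> real" where
  "Ai x = 1 / pi * integral {0..} (\<lambda>t. cos (t ^ 3 / 3 + x * t))"

definition interpolating_kernel :: "real \<Rightarrow> real \<Rightarrow> real \<Rightarrow> real" where
  "interpolating_kernel \<alpha> x y =
     (LINT u|lborel. exp (\<alpha> * u) / (exp (\<alpha> * u) + 1) * Ai (x + u) * Ai (y + u))"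

definition Airy_kernel :: "real \<Rightarrow> real \<Rightarrow> real" where
  "Airy_kernel x y = (LINT u:{0..}|lborel. Ai (x + u) * Ai (y + u))"

definition Gumbel_cdf :: "real \<Rightarrow> real" where
  "Gumbel_cdf \<xi> = exp (- exp (- \<xi>))"

definition Tracy_Widom_cdf :: "real \<Rightarrow> real" where
  "Tracy_Widom_cdf \<xi> = fredholm_det {\<xi><..} (integral_operator {\<xi><..} Airy_kernel)"

end

theory Submission
  imports "HOL-Complex_Analysis.Complex_Analysis" Defs
begin

text \<open>Shifting the contour represents \<open>e\<^sup>a\<^sup>x Ai x\<close> as the Fourier transform of a Gaussian-bounded function,
  and Plancherel's identity then evaluates \<open>\<integral> e\<^sup>\<alpha>\<^sup>u Ai (x + u) Ai (y + u) du\<close> as an explicit Gaussian, the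
  heat kernel. Every weight between \<open>0\<close> and \<open>e\<^sup>\<alpha>\<^sup>u\<close> thus gives a positive semidefinite kernel whose diagonal
  is integrable on half-lines. Hadamard's inequality bounds its minors by products of diagonal entries,
  so the Fredholm series converges, and Andreief's identity with Parseval's theorem turns its terms
  into traces of exterior powers.

  With \<open>\<phi> = z 1\<^sub>B\<close> the correlation functions yield the generating function of the number of particles in
  \<open>B\<close>; \<open>z = -1\<close> gives the gap probability. For \<open>B = {t<..t + n}\<close> and \<open>n \<rightarrow> \<infinity>\<close> it becomes the distribution
  function of the last particle. A last particle exists because the expected number of particles is
  finite on half-lines to the right, and because it is infinite on the whole line, where the
  variance of a count never exceeds its mean.

  For \<open>\<alpha> \<rightarrow> \<infinity>\<close> the weight converges to the indicator of \<open>{0..}\<close> and dominated convergence applies. For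
  \<open>\<alpha> \<rightarrow> 0\<close>, comparison with the heat kernels for \<open>\<alpha>\<close> and \<open>2 \<alpha>\<close> shows that the trace tends to \<open>e\<^sup>-\<^sup>\<xi>\<close> while the
  Hilbert-Schmidt norm tends to \<open>0\<close>; hence the off-diagonal entries of the minors do not contribute and
  the series converges to \<open>exp (- e\<^sup>-\<^sup>\<xi>)\<close>.\<close>

text \<open>Two definitions dictate the shape. \<open>fredholm_det\<close> sees only matrix elements
  in orthonormal bases, the process only integrals of minors against boundedly supported functions.
  They meet by factoring the kernel as K = B B^T with B(x, u) = sqrt(w u) Ai(x + u) and using
  Andreief's identity in both variables, also with a basis index in place of a point. The heat
  kernel belongs to exp(-\<alpha> H) for the Airy operator H = -d^2/dx^2 + x. Its trace over (t,
  infinity) is exp(\<alpha>^3/12) exp(-\<alpha> t) / (\<alpha> sqrt(4 pi \<alpha>)), and the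
  centring in the Gumbel limit is exactly the t at which this becomes exp(\<alpha>^3/12)
  exp(-\<xi>). An inequality between weights compares kernels pointwise only on the diagonal, since
  Ai(x + u) Ai(y + u) changes sign elsewhere. The Hilbert-Schmidt norm of K is therefore compared
  with that of the heat kernel E through the nonnegativity of the integral of (E - K)(E + K), a
  product of two positive semidefinite kernels.\<close>

section \<open>Determinants of positive semidefinite matrices\<close>

text \<open>Entries are given by a function, so no carrier conditions arise, and the Leibniz
  expansion serves measurability, limits, Andreief's identity and the off-diagonal estimate
  alike.\<close>

definition fdet :: "nat \<Rightarrow> (nat \<Rightarrow> nat \<Rightarrow> real) \<Rightarrow> real" where
  "fdet k a = Determinant.det (mat k k (\<lambda>(i, j). a i j))"

lemma kernel_minor_eq_fdet: "kernel_minor K k x = fdet k (\<lambda>i j. K (x i) (x j))"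
  by (simp add: kernel_minor_def fdet_def)

lemma fdet_leibniz:
  "fdet k a = (\<Sum>p | p permutes {..<k}. of_int (sign p) * (\<Prod>i<k. a i (p i)))"
proof -
  let ?A = "mat k k (\<lambda>(i, j). a i j)"
  have entry: "?A $$ (i, p i) = a i (p i)" if "p permutes {..<k}" "i < k" for p i
    using that permutes_in_image[OF that(1), of i] by simp
  have "fdet k a = (\<Sum>p | p permutes {..<k}. of_int (sign p) * (\<Prod>i<k. ?A $$ (i, p i)))"
    unfolding fdet_def atLeast0LessThan[symmetric] by (rule det_def') simp
  also have "\<dots> = (\<Sum>p | p permutes {..<k}. of_int (sign p) * (\<Prod>i<k. a i (p i)))"
    by (intro sum.cong refl arg_cong2[of _ _ _ _ "(*)"] prod.cong) (simp add: entry)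
  finally show ?thesis .
qed

lemma fdet_cong: "(\<And>i j. i < k \<Longrightarrow> j < k \<Longrightarrow> a i j = b i j) \<Longrightarrow> fdet k a = fdet k b"
  unfolding fdet_leibniz
  by (intro sum.cong prod.cong arg_cong2[of _ _ _ _ "(*)"] refl) (auto dest: permutes_in_image)

lemma fdet_0 [simp]: "fdet 0 a = 1"
  by (simp add: fdet_leibniz)

lemma fdet_transpose: "fdet k (\<lambda>i j. a j i) = fdet k a"
proof -
  have "fdet k (\<lambda>i j. a j i) = det (transpose_mat (mat k k (\<lambda>(i, j). a i j)))"
    unfolding fdet_def by (intro arg_cong[of _ _ Determinant.det]) auto
  also have "\<dots> = fdet k a"
    unfolding fdet_def by (rule det_transpose) auto
  finally show ?thesis .
qed

lemma fdet_zero_row: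
  assumes "i < k" "\<And>j. j < k \<Longrightarrow> a i j = 0"
  shows "fdet k a = 0"
  unfolding fdet_leibniz
proof (rule sum.neutral, safe)
  fix p assume "p permutes {..<k}"
  then have "p i < k" using assms(1) permutes_in_image by fastforce
  then have "(\<Prod>i<k. a i (p i)) = 0"
    using assms by (intro prod_zero) auto
  then show "of_int (sign p) * (\<Prod>i<k. a i (p i)) = 0" by simp
qed

text \<open>Conjugation by \<open>p\<close> is a bijection of the permutations that preserves signs,
  and it carries the Leibniz sum of one matrix into that of the other.\<close>

lemma fdet_permute:
  assumes "p permutes {..<k}"
  shows "fdet k (\<lambda>i j. a (p i) (p j)) = fdet k a"
proof -
  have inv: "bij_betw (\<lambda>q. p \<circ> q \<circ> inv_into UNIV p) {q. q permutes {..<k}} {q. q permutes {..<k}}"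
    by (rule bij_betwI[where g = "\<lambda>q. inv_into UNIV p \<circ> q \<circ> p"])
       (auto intro!: permutes_compose permutes_inv assms simp: fun_eq_iff permutes_inverses[OF assms])
  have "fdet k a = (\<Sum>q | q permutes {..<k}. of_int (sign (p \<circ> q \<circ> inv_into UNIV p)) * (\<Prod>i<k. a i ((p \<circ> q \<circ> inv_into UNIV p) i)))"
    unfolding fdet_leibniz by (rule sum.reindex_bij_betw[OF inv, symmetric])
  also have "\<dots> = (\<Sum>q | q permutes {..<k}. of_int (sign q) * (\<Prod>i<k. a (p i) (p (q i))))"
  proof (intro sum.cong refl arg_cong2[of _ _ _ _ "(*)"] arg_cong[of _ _ of_int])
    fix q assume "q \<in> {q. q permutes {..<k}}"
    then have q: "permutation p" "permutation q"
      using assms by (auto simp: permutation_permutes intro: exI[of _ "{..<k}"])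
    show "sign (p \<circ> q \<circ> inv_into UNIV p) = sign q"
      using q by (simp add: sign_compose permutation_compose permutation_inverse sign_inverse)
    show "(\<Prod>i<k. a i ((p \<circ> q \<circ> inv_into UNIV p) i)) = (\<Prod>i<k. a (p i) (p (q i)))"
      by (subst prod.reindex_bij_betw[OF permutes_imp_bij[OF assms], symmetric])
         (simp add: permutes_inverses[OF assms])
  qed
  finally show ?thesis by (simp add: fdet_leibniz)
qed

lemma fdet_identical_rows:
  assumes "i < k" "j < k" "i \<noteq> j" "\<And>l. l < k \<Longrightarrow> a i l = a j l"
  shows "fdet k a = 0"
  unfolding fdet_def using assms
  by (intro det_identical_rows[of _ k i j]) auto

text \<open>Block elimination: the matrix is a unit lower triangular factor times a block upper
  triangular one whose lower right block is the Schur complement of the entry at (0, 0).\<close>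

lemma fdet_schur:
  assumes "a 0 0 \<noteq> 0"
  shows "fdet (Suc k) a =
    a 0 0 * fdet k (\<lambda>i j. a (Suc i) (Suc j) - a (Suc i) 0 * a 0 (Suc j) / a 0 0)"
proof -
  define S where "S = mat k k (\<lambda>(i, j). a (Suc i) (Suc j) - a (Suc i) 0 * a 0 (Suc j) / a 0 0)"
  define C where "C = mat k 1 (\<lambda>(i, j). a (Suc i) 0 / a 0 0)"
  define R where "R = mat 1 k (\<lambda>(i, j). a 0 (Suc j))"
  define T where "T = mat 1 1 (\<lambda>(i, j::nat). a 0 0)"
  have dims: "S \<in> carrier_mat k k" "C \<in> carrier_mat k 1" "R \<in> carrier_mat 1 k" "T \<in> carrier_mat 1 1"
    by (auto simp: S_def C_def R_def T_def)
  have "mat (Suc k) (Suc k) (\<lambda>(i, j). a i j) =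
    four_block_mat (1\<^sub>m 1) (0\<^sub>m 1 k) C (1\<^sub>m k) * four_block_mat T R (0\<^sub>m k 1) S"
  proof -
    have "four_block_mat (1\<^sub>m 1) (0\<^sub>m 1 k) C (1\<^sub>m k) * four_block_mat T R (0\<^sub>m k 1) S
      = four_block_mat T R (C * T) (C * R + S)"
      using dims by (subst mult_four_block_mat[where ?n1.0 = 1 and ?nr1.0 = 1 and ?n2.0 = k and ?nr2.0 = k and ?nc1.0 = 1 and ?nc2.0 = k]) auto
    also have "\<dots> = mat (Suc k) (Suc k) (\<lambda>(i, j). a i j)"
      using assms
      by (intro eq_matI) (auto simp: S_def C_def R_def T_def scalar_prod_def less_Suc_eq_0_disj)
    finally show ?thesis by simp
  qed
  then have "fdet (Suc k) a = det (four_block_mat (1\<^sub>m 1) (0\<^sub>m 1 k) C (1\<^sub>m k)) * det (four_block_mat T R (0\<^sub>m k 1) S)"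
    unfolding fdet_def using dims
    by (simp add: det_mult[of _ "Suc k"] four_block_carrier_mat[of _ 1 1 _ k k, simplified])
  also have "det (four_block_mat (1\<^sub>m 1) (0\<^sub>m 1 k) C (1\<^sub>m k)) = 1"
    using dims by (subst det_four_block_mat_upper_right_zero[of _ 1 _ k]) auto
  also have "det (four_block_mat T R (0\<^sub>m k 1) S) = det T * det S"
    using dims by (subst det_four_block_mat_lower_left_zero[of _ 1 _ k]) auto
  also have "det T = a 0 0"
    using dims by (subst det_single) (auto simp: T_def)
  finally show ?thesis by (simp add: S_def fdet_def)
qed

text \<open>Over the reals a nonnegative quadratic form does not force symmetry, hence the separate
  clause.\<close>

definition psd :: "nat \<Rightarrow> (nat \<Rightarrow> nat \<Rightarrow> real) \<Rightarrow> bool" where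
  "psd k a \<longleftrightarrow> (\<forall>i<k. \<forall>j<k. a i j = a j i) \<and> (\<forall>v. 0 \<le> (\<Sum>i<k. \<Sum>j<k. v i * v j * a i j))"

lemma psd_symD: "psd k a \<Longrightarrow> i < k \<Longrightarrow> j < k \<Longrightarrow> a i j = a j i"
  by (auto simp: psd_def)

lemma psd_quadratic_form_nonneg: "psd k a \<Longrightarrow> 0 \<le> (\<Sum>i<k. \<Sum>j<k. v i * v j * a i j)"
  by (auto simp: psd_def)

lemma psd_two_by_two:
  assumes "psd k a" "i < k" "j < k" "i \<noteq> j"
  shows "0 \<le> s\<^sup>2 * a i i + 2 * s * t * a i j + t\<^sup>2 * a j j"
proof -
  define v where "v = (\<lambda>l. if l = i then s else if l = j then t else 0)"
  have inner: "(\<Sum>m<k. v l * v m * a l m) = v l * (s * a l i + t * a l j)" for l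
  proof -
    have "(\<Sum>m<k. v l * v m * a l m) = (\<Sum>m\<in>{i, j}. v l * v m * a l m)"
      using assms by (intro sum.mono_neutral_right) (auto simp: v_def)
    then show ?thesis using assms by (simp add: v_def algebra_simps)
  qed
  have "(\<Sum>l<k. \<Sum>m<k. v l * v m * a l m) = (\<Sum>l\<in>{i, j}. v l * (s * a l i + t * a l j))"
    unfolding inner using assms by (intro sum.mono_neutral_right) (auto simp: v_def)
  also have "\<dots> = s\<^sup>2 * a i i + 2 * s * t * a i j + t\<^sup>2 * a j j"
    using assms psd_symD[OF assms(1-3)] by (simp add: v_def algebra_simps power2_eq_square)
  finally show ?thesis using psd_quadratic_form_nonneg[OF assms(1), of v] by linarith
qed

lemma psd_diag_nonneg:
  assumes "psd k a" "i < k" shows "0 \<le> a i i"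
proof -
  define v where "v = (\<lambda>l. if l = i then 1 else (0::real))"
  have "(\<Sum>l<k. \<Sum>m<k. v l * v m * a l m) = (\<Sum>l\<in>{i}. \<Sum>m\<in>{i}. v l * v m * a l m)"
    using assms by (intro sum.mono_neutral_cong_right) (auto simp: v_def intro!: sum.mono_neutral_right)
  also have "\<dots> = a i i" by (simp add: v_def)
  finally show ?thesis using psd_quadratic_form_nonneg[OF assms(1), of v] by linarith
qed

text \<open>With \<open>a i i = 0\<close> the 2 x 2 form is affine in \<open>s\<close>, and an
  affine function that stays nonnegative has slope zero.\<close>

lemma psd_zero_row:
  assumes "psd k a" "i < k" "j < k" "a i i = 0"
  shows "a i j = 0"
proof (cases "i = j")
  case False
  have "0 \<le> s\<^sup>2 * a i i + 2 * s * 1 * a i j + 1\<^sup>2 * a j j" for s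
    using psd_two_by_two[OF assms(1-3) False] .
  \<comment> \<open>If \<open>a i j\<close> were nonzero, this value of \<open>s\<close> would make
    the form equal to -1.\<close>
  from this[of "- (a j j + 1) / (2 * a i j)"] show ?thesis
    using assms(4) by (cases "a i j = 0") (auto simp: field_simps)
qed (use assms in auto)

lemma psd_schur:
  assumes "psd (Suc k) a" "a 0 0 > 0"
  shows "psd k (\<lambda>i j. a (Suc i) (Suc j) - a (Suc i) 0 * a 0 (Suc j) / a 0 0)"
  unfolding psd_def
proof (intro conjI allI impI)
  fix i j assume "i < k" "j < k"
  then show "a (Suc i) (Suc j) - a (Suc i) 0 * a 0 (Suc j) / a 0 0 =
      a (Suc j) (Suc i) - a (Suc j) 0 * a 0 (Suc i) / a 0 0"
    using psd_symD[OF assms(1), of "Suc i" "Suc j"] psd_symD[OF assms(1), of "Suc i" 0]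
      psd_symD[OF assms(1), of "Suc j" 0] by simp
next
  fix v :: "nat \<Rightarrow> real"
  define m where "m = (\<Sum>i<k. v i * a (Suc i) 0)"
  have m: "m = (\<Sum>i<k. v i * a 0 (Suc i))"
    unfolding m_def using psd_symD[OF assms(1), of 0] by (intro sum.cong) auto
  \<comment> \<open>\<open>- m / a 0 0\<close> minimises the form over the first coordinate; the
    minimum is the form of the Schur complement at \<open>v\<close>.\<close>
  define u where "u = (\<lambda>i. case i of 0 \<Rightarrow> - m / a 0 0 | Suc i \<Rightarrow> v i)"
  have "0 \<le> (\<Sum>i<Suc k. \<Sum>j<Suc k. u i * u j * a i j)"
    using psd_quadratic_form_nonneg[OF assms(1)] .
  also have "\<dots> = u 0 * u 0 * a 0 0 + u 0 * (\<Sum>j<k. v j * a 0 (Suc j))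
      + u 0 * (\<Sum>i<k. v i * a (Suc i) 0) + (\<Sum>i<k. \<Sum>j<k. v i * v j * a (Suc i) (Suc j))"
  proof -
    have "(\<Sum>i<Suc k. \<Sum>j<Suc k. u i * u j * a i j) = u 0 * u 0 * a 0 0 + (\<Sum>j<k. u 0 * u (Suc j) * a 0 (Suc j))
        + ((\<Sum>i<k. u (Suc i) * u 0 * a (Suc i) 0) + (\<Sum>i<k. \<Sum>j<k. u (Suc i) * u (Suc j) * a (Suc i) (Suc j)))"
      unfolding sum.lessThan_Suc_shift by (simp only: sum.distrib)
    moreover have us: "u (Suc i) = v i" for i by (simp add: u_def)
    moreover have "(\<Sum>j<k. u 0 * v j * a 0 (Suc j)) = u 0 * (\<Sum>j<k. v j * a 0 (Suc j))"
      by (simp only: sum_distrib_left mult.assoc)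
    moreover have "(\<Sum>i<k. v i * u 0 * a (Suc i) 0) = u 0 * (\<Sum>i<k. v i * a (Suc i) 0)"
      unfolding sum_distrib_left by (intro sum.cong refl) (simp only: mult_ac)
    ultimately show ?thesis by (simp only: us add.assoc)
  qed
  also have "\<dots> = (\<Sum>i<k. \<Sum>j<k. v i * v j * a (Suc i) (Suc j)) - m * m / a 0 0"
  proof -
    have "u 0 = - m / a 0 0" by (simp add: u_def)
    then show ?thesis unfolding m[symmetric] m_def[symmetric] using assms(2) by simp
  qed
  also have "m * m / a 0 0 = (\<Sum>i<k. \<Sum>j<k. v i * v j * (a (Suc i) 0 * a 0 (Suc j) / a 0 0))"
  proof -
    have "m * m / a 0 0 = (\<Sum>i<k. v i * a (Suc i) 0) * (\<Sum>j<k. v j * a 0 (Suc j)) / a 0 0"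
      by (simp only: m_def[symmetric] m[symmetric])
    also have "\<dots> = (\<Sum>i<k. \<Sum>j<k. v i * v j * (a (Suc i) 0 * a 0 (Suc j) / a 0 0))"
      unfolding sum_product sum_divide_distrib by (simp add: mult_ac)
    finally show ?thesis .
  qed
  finally show "0 \<le> (\<Sum>i<k. \<Sum>j<k. v i * v j * (a (Suc i) (Suc j) - a (Suc i) 0 * a 0 (Suc j) / a 0 0))"
    by (simp add: right_diff_distrib sum_subtractf)
qed

text \<open>Induction by eliminating the first row: the Schur complement is again positive
  semidefinite, and its diagonal entries have only decreased. A vanishing pivot gives a zero
  row.\<close>

lemma hadamard_inequality:
  assumes "psd k a"
  shows "0 \<le> fdet k a \<and> fdet k a \<le> (\<Prod>i<k. a i i)"
  using assms
proof (induction k arbitrary: a)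
  case (Suc k)
  show ?case
  proof (cases "a 0 0 = 0")
    case True
    have "fdet (Suc k) a = 0"
      using psd_zero_row[OF Suc.prems _ _ True] by (intro fdet_zero_row[of 0]) auto
    then show ?thesis
      using psd_diag_nonneg[OF Suc.prems] prod_nonneg[of "{..<Suc k}" "\<lambda>i. a i i"] by auto
  next
    case False
    then have pos: "a 0 0 > 0" using psd_diag_nonneg[OF Suc.prems, of 0] by simp
    let ?s = "\<lambda>i j. a (Suc i) (Suc j) - a (Suc i) 0 * a 0 (Suc j) / a 0 0"
    have IH: "0 \<le> fdet k ?s" "fdet k ?s \<le> (\<Prod>i<k. ?s i i)"
      using Suc.IH[OF psd_schur[OF Suc.prems pos]] by auto
    have "(\<Prod>i<k. ?s i i) \<le> (\<Prod>i<k. a (Suc i) (Suc i))"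
    proof (rule prod_mono)
      fix i assume i: "i \<in> {..<k}"
      have "a (Suc i) 0 = a 0 (Suc i)" using psd_symD[OF Suc.prems, of "Suc i" 0] i by simp
      then show "0 \<le> ?s i i \<and> ?s i i \<le> a (Suc i) (Suc i)"
        using pos psd_diag_nonneg[OF psd_schur[OF Suc.prems pos], of i] i by simp
    qed
    with IH have "fdet k ?s \<le> (\<Prod>i<k. a (Suc i) (Suc i))" by linarith
    then have "a 0 0 * fdet k ?s \<le> a 0 0 * (\<Prod>i<k. a (Suc i) (Suc i))"
      using pos by (intro mult_left_mono) auto
    moreover have "0 \<le> a 0 0 * fdet k ?s" using IH(1) pos by simp
    moreover have "(\<Prod>i<Suc k. a i i) = a 0 0 * (\<Prod>i<k. a (Suc i) (Suc i))"
      by (rule prod.lessThan_Suc_shift)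
    moreover have "fdet (Suc k) a = a 0 0 * fdet k ?s" using False by (rule fdet_schur)
    ultimately show ?thesis by simp
  qed
qed simp

lemma psd_offdiag_le:
  assumes "psd k a" "i < k" "j < k"
  shows "\<bar>a i j\<bar> \<le> sqrt (a i i) * sqrt (a j j)"
proof (cases "i = j")
  case False
  have d: "0 \<le> a i i" "0 \<le> a j j" using psd_diag_nonneg assms by auto
  show ?thesis
  proof (cases "a i i = 0")
    case True
    then show ?thesis using psd_zero_row[OF assms(1-3)] by simp
  next
    case F: False
    with d have pos: "a i i > 0" by simp
    \<comment> \<open>The test vector \<open>s = - a i j\<close>, \<open>t = a i i\<close> turns the
      form into \<open>a i i\<close> times the 2 x 2 minor.\<close>
    have "0 \<le> (- a i j)\<^sup>2 * a i i + 2 * (- a i j) * a i i * a i j + (a i i)\<^sup>2 * a j j"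
      using psd_two_by_two[OF assms False] .
    also have "\<dots> = a i i * (a i i * a j j - (a i j)\<^sup>2)" by (simp add: power2_eq_square algebra_simps)
    finally have "(a i j)\<^sup>2 \<le> a i i * a j j" using pos by (simp add: zero_le_mult_iff)
    then have "sqrt ((a i j)\<^sup>2) \<le> sqrt (a i i * a j j)" by (rule real_sqrt_le_mono)
    then show ?thesis by (simp add: real_sqrt_mult)
  qed
qed (use psd_diag_nonneg assms in auto)

section \<open>Andreief's identity\<close>

lemma integrable_mult_of_squares:
  fixes f g :: "'a \<Rightarrow> real"
  assumes [measurable]: "f \<in> borel_measurable M" "g \<in> borel_measurable M"
    and "integrable M (\<lambda>x. (f x)\<^sup>2)" "integrable M (\<lambda>x. (g x)\<^sup>2)"
  shows "integrable M (\<lambda>x. f x * g x)"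
proof (rule Bochner_Integration.integrable_bound)
  show "integrable M (\<lambda>x. (f x)\<^sup>2 + (g x)\<^sup>2)" using assms by simp
  have "\<bar>a * b\<bar> \<le> a\<^sup>2 + b\<^sup>2" for a b :: real
  proof -
    have "2 * (\<bar>a\<bar> * \<bar>b\<bar>) \<le> a\<^sup>2 + b\<^sup>2" using sum_squares_bound[of "\<bar>a\<bar>" "\<bar>b\<bar>"] by simp
    moreover have "0 \<le> \<bar>a\<bar> * \<bar>b\<bar>" by simp
    ultimately show ?thesis unfolding abs_mult by linarith
  qed
  then show "AE x in M. norm (f x * g x) \<le> norm ((f x)\<^sup>2 + (g x)\<^sup>2)" by simp
qed measurable

lemma fdet_measurable [measurable (raw)]:
  assumes "\<And>i j. i < k \<Longrightarrow> j < k \<Longrightarrow> (\<lambda>x. a x i j) \<in> borel_measurable M"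
  shows "(\<lambda>x. fdet k (a x)) \<in> borel_measurable M"
  unfolding fdet_leibniz
proof (intro borel_measurable_sum borel_measurable_times borel_measurable_prod borel_measurable_const)
  fix p i assume "p \<in> {p. p permutes {..<k}}" "i \<in> {..<k}"
  then show "(\<lambda>x. a x i (p i)) \<in> borel_measurable M"
    using permutes_in_image[of p "{..<k}" i] by (intro assms) auto
qed

text \<open>The squared determinant is a double Leibniz sum over \<open>p\<close> and
  \<open>q\<close>, and Fubini factorises each term into Gram entries. Replacing \<open>q\<close> by
  \<open>q \<circ> p\<close> shows that the sum over \<open>q\<close> does not depend on
  \<open>p\<close>, which leaves \<open>fact k\<close> equal determinants.\<close>

lemma andreief:
  fixes f :: "nat \<Rightarrow> 'a \<Rightarrow> real"
  assumes N: "sigma_finite_measure N"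
    and f: "\<And>a b. a < k \<Longrightarrow> b < k \<Longrightarrow> integrable N (\<lambda>z. f a z * f b z)"
  shows "integrable (\<Pi>\<^sub>M i\<in>{..<k}. N) (\<lambda>z. (fdet k (\<lambda>a b. f a (z b)))\<^sup>2)" (is ?int)
    and "(\<integral>z. (fdet k (\<lambda>a b. f a (z b)))\<^sup>2 \<partial>(\<Pi>\<^sub>M i\<in>{..<k}. N)) =
      fact k * fdet k (\<lambda>a b. \<integral>z. f a z * f b z \<partial>N)" (is ?eq)
proof -
  interpret sigma_finite_measure N by fact
  interpret product_sigma_finite "\<lambda>_. N" by standard
  define G where "G = (\<lambda>a b. \<integral>z. f a z * f b z \<partial>N)"
  let ?P = "{p. p permutes {..<k}}"
  let ?s = "\<lambda>p. of_int (sign p) :: real"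
  have sq: "(fdet k (\<lambda>a b. f a (z b)))\<^sup>2 =
    (\<Sum>p\<in>?P. \<Sum>q\<in>?P. ?s p * ?s q * (\<Prod>b<k. f (p b) (z b) * f (q b) (z b)))" for z
  proof -
    have "fdet k (\<lambda>a b. f a (z b)) = (\<Sum>p\<in>?P. ?s p * (\<Prod>b<k. f (p b) (z b)))"
      by (subst fdet_transpose[symmetric]) (rule fdet_leibniz)
    then show ?thesis
      by (simp add: power2_eq_square sum_product prod.distrib mult_ac)
  qed
  have int: "integrable (\<Pi>\<^sub>M i\<in>{..<k}. N) (\<lambda>z. \<Prod>b<k. f (p b) (z b) * f (q b) (z b))"
    and eq: "(\<integral>z. (\<Prod>b<k. f (p b) (z b) * f (q b) (z b)) \<partial>(\<Pi>\<^sub>M i\<in>{..<k}. N)) = (\<Prod>b<k. G (p b) (q b))"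
    if "p \<in> ?P" "q \<in> ?P" for p q
  proof -
    have i: "integrable N (\<lambda>z. f (p b) z * f (q b) z)" if "b \<in> {..<k}" for b
      using that \<open>p \<in> ?P\<close> \<open>q \<in> ?P\<close> permutes_in_image[of p "{..<k}" b] permutes_in_image[of q "{..<k}" b]
      by (intro f) auto
    show "integrable (\<Pi>\<^sub>M i\<in>{..<k}. N) (\<lambda>z. \<Prod>b<k. f (p b) (z b) * f (q b) (z b))"
      using i by (intro product_integrable_prod) auto
    show "(\<integral>z. (\<Prod>b<k. f (p b) (z b) * f (q b) (z b)) \<partial>(\<Pi>\<^sub>M i\<in>{..<k}. N)) = (\<Prod>b<k. G (p b) (q b))"
      unfolding G_def using i by (intro product_integral_prod) auto
  qed
  have hb: "has_bochner_integral (\<Pi>\<^sub>M i\<in>{..<k}. N) (\<lambda>z. (fdet k (\<lambda>a b. f a (z b)))\<^sup>2)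
      (\<Sum>p\<in>?P. \<Sum>q\<in>?P. ?s p * ?s q * (\<Prod>b<k. G (p b) (q b)))"
    unfolding sq
    by (intro has_bochner_integral_sum has_bochner_integral_mult_right) (simp add: has_bochner_integral_iff int eq)
  then show ?int by (rule integrable.intros)
  from hb have "(\<integral>z. (fdet k (\<lambda>a b. f a (z b)))\<^sup>2 \<partial>(\<Pi>\<^sub>M i\<in>{..<k}. N)) =
    (\<Sum>p\<in>?P. \<Sum>q\<in>?P. ?s p * ?s q * (\<Prod>b<k. G (p b) (q b)))"
    by (rule has_bochner_integral_integral_eq)
  also have "\<dots> = (\<Sum>p\<in>?P. fdet k G)"
  proof (rule sum.cong[OF refl])
    fix p assume p: "p \<in> ?P"
    have "(\<Sum>q\<in>?P. ?s p * ?s q * (\<Prod>b<k. G (p b) (q b))) =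
        (\<Sum>q\<in>?P. ?s p * ?s (q \<circ> p) * (\<Prod>b<k. G (p b) ((q \<circ> p) b)))"
      using p by (intro sum_permutations_compose_right) auto
    also have "\<dots> = (\<Sum>q\<in>?P. ?s q * (\<Prod>a<k. G a (q a)))"
    proof (rule sum.cong[OF refl])
      fix q assume q: "q \<in> ?P"
      have "permutation p" "permutation q"
        using p q by (auto simp: permutation_permutes intro: exI[of _ "{..<k}"])
      then have "?s p * ?s (q \<circ> p) = ?s q"
        by (simp add: sign_compose) (simp add: sign_def)
      moreover have "(\<Prod>b<k. G (p b) ((q \<circ> p) b)) = (\<Prod>a<k. G a (q a))"
        using p by (subst prod.reindex_bij_betw[OF permutes_imp_bij, symmetric, of p]) auto
      ultimately show "?s p * ?s (q \<circ> p) * (\<Prod>b<k. G (p b) ((q \<circ> p) b)) = ?s q * (\<Prod>a<k. G a (q a))"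
        by simp
    qed
    finally show "(\<Sum>q\<in>?P. ?s p * ?s q * (\<Prod>b<k. G (p b) (q b))) = fdet k G"
      by (simp add: fdet_leibniz)
  qed
  also have "\<dots> = fact k * fdet k G"
    by (simp add: card_permutations)
  finally show ?eq by (simp add: G_def)
qed

text \<open>Andreief's identity in \<open>z\<close> for each fixed \<open>x\<close>, stated with
  nonnegative integrals so that the two integrations can afterwards be exchanged without
  integrability.\<close>

lemma nn_integral_gram_det:
  fixes b :: "'a \<Rightarrow> 'b \<Rightarrow> real"
  assumes M: "sigma_finite_measure M" and N: "sigma_finite_measure N"
    and b [measurable]: "case_prod b \<in> borel_measurable (M \<Otimes>\<^sub>M N)"
    and sq: "\<And>x. x \<in> space M \<Longrightarrow> integrable N (\<lambda>z. (b x z)\<^sup>2)"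
  shows "ennreal (fact k) * (\<integral>\<^sup>+x. ennreal (fdet k (\<lambda>i j. \<integral>z. b (x i) z * b (x j) z \<partial>N)) \<partial>(\<Pi>\<^sub>M i\<in>{..<k}. M)) =
    (\<integral>\<^sup>+x. \<integral>\<^sup>+z. ennreal ((fdet k (\<lambda>i j. b (x i) (z j)))\<^sup>2) \<partial>(\<Pi>\<^sub>M i\<in>{..<k}. N) \<partial>(\<Pi>\<^sub>M i\<in>{..<k}. M))"
proof -
  interpret N: sigma_finite_measure N by fact
  have [measurable]: "(\<lambda>x. \<integral>z. b (x i) z * b (x j) z \<partial>N) \<in> borel_measurable (\<Pi>\<^sub>M i\<in>{..<k}. M)"
    if [simp]: "i < k" "j < k" for i j
    by (intro N.borel_measurable_lebesgue_integral) measurable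
  have "ennreal (fact k) * (\<integral>\<^sup>+x. ennreal (fdet k (\<lambda>i j. \<integral>z. b (x i) z * b (x j) z \<partial>N)) \<partial>(\<Pi>\<^sub>M i\<in>{..<k}. M)) =
      (\<integral>\<^sup>+x. ennreal (fact k) * ennreal (fdet k (\<lambda>i j. \<integral>z. b (x i) z * b (x j) z \<partial>N)) \<partial>(\<Pi>\<^sub>M i\<in>{..<k}. M))"
    by (intro nn_integral_cmult[symmetric]) measurable
  also have "\<dots> = (\<integral>\<^sup>+x. \<integral>\<^sup>+z. ennreal ((fdet k (\<lambda>i j. b (x i) (z j)))\<^sup>2) \<partial>(\<Pi>\<^sub>M i\<in>{..<k}. N) \<partial>(\<Pi>\<^sub>M i\<in>{..<k}. M))"
  proof (rule nn_integral_cong)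
    fix x assume "x \<in> space (\<Pi>\<^sub>M i\<in>{..<k}. M)"
    then have x: "x i \<in> space M" if "i < k" for i using that by (auto simp: space_PiM)
    have "integrable N (\<lambda>z. b (x i) z * b (x j) z)" if "i < k" "j < k" for i j
      using x that by (intro integrable_mult_of_squares sq) auto
    note A = andreief[OF N this]
    have "ennreal (fact k) * ennreal (fdet k (\<lambda>i j. \<integral>z. b (x i) z * b (x j) z \<partial>N)) =
      ennreal (fact k * fdet k (\<lambda>i j. \<integral>z. b (x i) z * b (x j) z \<partial>N))"
      by (rule ennreal_mult'[symmetric]) simp
    also have "\<dots> = (\<integral>\<^sup>+z. ennreal ((fdet k (\<lambda>i j. b (x i) (z j)))\<^sup>2) \<partial>(\<Pi>\<^sub>M i\<in>{..<k}. N))"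
      using A by (subst nn_integral_eq_integral) auto
    finally show "ennreal (fact k) * ennreal (fdet k (\<lambda>i j. \<integral>z. b (x i) z * b (x j) z \<partial>N)) =
      (\<integral>\<^sup>+z. ennreal ((fdet k (\<lambda>i j. b (x i) (z j)))\<^sup>2) \<partial>(\<Pi>\<^sub>M i\<in>{..<k}. N))" .
  qed
  finally show ?thesis .
qed

text \<open>The analogue for exterior powers of Tr B B^T = Tr B^T B: multiplied by
  \<open>fact k\<close>, both sides are the double integral of the squared determinant of
  \<open>b (x i) (z j)\<close>, taken in the two orders.\<close>

lemma gram_det_duality:
  fixes b :: "'a \<Rightarrow> 'b \<Rightarrow> real"
  assumes M: "sigma_finite_measure M" and N: "sigma_finite_measure N"
    and b [measurable]: "case_prod b \<in> borel_measurable (M \<Otimes>\<^sub>M N)"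
    and "\<And>x. x \<in> space M \<Longrightarrow> integrable N (\<lambda>z. (b x z)\<^sup>2)"
    and "\<And>z. z \<in> space N \<Longrightarrow> integrable M (\<lambda>x. (b x z)\<^sup>2)"
  shows "(\<integral>\<^sup>+x. ennreal (fdet k (\<lambda>i j. \<integral>z. b (x i) z * b (x j) z \<partial>N)) \<partial>(\<Pi>\<^sub>M i\<in>{..<k}. M)) =
    (\<integral>\<^sup>+z. ennreal (fdet k (\<lambda>i j. \<integral>x. b x (z i) * b x (z j) \<partial>M)) \<partial>(\<Pi>\<^sub>M i\<in>{..<k}. N))"
proof -
  interpret M: sigma_finite_measure M by fact
  interpret N: sigma_finite_measure N by fact
  interpret PM: product_sigma_finite "\<lambda>_. M" by standard
  interpret PN: product_sigma_finite "\<lambda>_. N" by standard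
  interpret FM: finite_product_sigma_finite "\<lambda>_. M" "{..<k}" by standard auto
  interpret FN: finite_product_sigma_finite "\<lambda>_. N" "{..<k}" by standard auto
  interpret PP: pair_sigma_finite "\<Pi>\<^sub>M i\<in>{..<k}. M" "\<Pi>\<^sub>M i\<in>{..<k}. N" by standard
  have "ennreal (fact k) * (\<integral>\<^sup>+x. ennreal (fdet k (\<lambda>i j. \<integral>z. b (x i) z * b (x j) z \<partial>N)) \<partial>(\<Pi>\<^sub>M i\<in>{..<k}. M)) =
     (\<integral>\<^sup>+x. \<integral>\<^sup>+z. ennreal ((fdet k (\<lambda>i j. b (x i) (z j)))\<^sup>2) \<partial>(\<Pi>\<^sub>M i\<in>{..<k}. N) \<partial>(\<Pi>\<^sub>M i\<in>{..<k}. M))"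
    using assms by (intro nn_integral_gram_det)
  also have "\<dots> = (\<integral>\<^sup>+z. \<integral>\<^sup>+x. ennreal ((fdet k (\<lambda>i j. b (x i) (z j)))\<^sup>2) \<partial>(\<Pi>\<^sub>M i\<in>{..<k}. M) \<partial>(\<Pi>\<^sub>M i\<in>{..<k}. N))"
    by (intro PP.Fubini'[symmetric]) measurable
  also have "\<dots> = (\<integral>\<^sup>+z. \<integral>\<^sup>+x. ennreal ((fdet k (\<lambda>i j. b (x j) (z i)))\<^sup>2) \<partial>(\<Pi>\<^sub>M i\<in>{..<k}. M) \<partial>(\<Pi>\<^sub>M i\<in>{..<k}. N))"
    by (subst fdet_transpose) rule
  also have "\<dots> = ennreal (fact k) * (\<integral>\<^sup>+z. ennreal (fdet k (\<lambda>i j. \<integral>x. b x (z i) * b x (z j) \<partial>M)) \<partial>(\<Pi>\<^sub>M i\<in>{..<k}. N))"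
    using assms by (intro nn_integral_gram_det[symmetric]) (auto simp: measurable_pair_swap_iff[of _ M N] split_beta')
  finally show ?thesis by (subst (asm) ennreal_mult_cancel_left) auto
qed

section \<open>Orthonormal bases of square-integrable functions\<close>

definition square_integrable :: "'a measure \<Rightarrow> ('a \<Rightarrow> real) \<Rightarrow> bool" where
  "square_integrable M f \<longleftrightarrow> f \<in> borel_measurable M \<and> integrable M (\<lambda>x. (f x)\<^sup>2)"

lemma square_integrable_measurable [measurable_dest]: "square_integrable M f \<Longrightarrow> f \<in> borel_measurable M"
  and square_integrable_square: "square_integrable M f \<Longrightarrow> integrable M (\<lambda>x. (f x)\<^sup>2)"
  by (auto simp: square_integrable_def)

lemma square_integrable_mult:
  "square_integrable M f \<Longrightarrow> square_integrable M g \<Longrightarrow> integrable M (\<lambda>x. f x * g x)"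
  by (intro integrable_mult_of_squares) (auto simp: square_integrable_def)

lemma square_integrable_add:
  assumes "square_integrable M f" "square_integrable M g"
  shows "square_integrable M (\<lambda>x. f x + g x)"
  using assms square_integrable_mult[OF assms]
  unfolding square_integrable_def power2_sum by (auto simp: mult.assoc intro!: borel_measurable_add)

lemma square_integrable_cmult:
  assumes "square_integrable M f"
  shows "square_integrable M (\<lambda>x. c * f x)"
  using assms by (auto simp: square_integrable_def power_mult_distrib intro!: borel_measurable_times)

lemma square_integrable_diff:
  assumes "square_integrable M f" "square_integrable M g"
  shows "square_integrable M (\<lambda>x. f x - g x)"
  using square_integrable_add[OF assms(1) square_integrable_cmult[OF assms(2), of "-1"]] by simp

lemma square_integrable_sum:
  assumes "finite A" "\<And>i. i \<in> A \<Longrightarrow> square_integrable M (f i)"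
  shows "square_integrable M (\<lambda>x. \<Sum>i\<in>A. f i x)"
  using assms by (induction A rule: finite_induct)
    (auto intro!: square_integrable_add, simp add: square_integrable_def)

text \<open>The squared norm of \<open>f + t * g\<close> is a nonnegative quadratic in
  \<open>t\<close>. It is evaluated at its minimum \<open>- B / C\<close>; if \<open>C = 0\<close>,
  its slope must vanish.\<close>

lemma cauchy_schwarz_integral:
  assumes "square_integrable M f" "square_integrable M g"
  shows "(\<integral>x. f x * g x \<partial>M)\<^sup>2 \<le> (\<integral>x. (f x)\<^sup>2 \<partial>M) * (\<integral>x. (g x)\<^sup>2 \<partial>M)"
proof -
  define A B C where "A = (\<integral>x. (f x)\<^sup>2 \<partial>M)" and "B = (\<integral>x. f x * g x \<partial>M)" and "C = (\<integral>x. (g x)\<^sup>2 \<partial>M)"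
  have AC: "A \<ge> 0" "C \<ge> 0" by (auto simp: A_def C_def)
  have q: "0 \<le> A + 2 * t * B + t\<^sup>2 * C" for t
  proof -
    have "0 \<le> (\<integral>x. (f x + t * g x)\<^sup>2 \<partial>M)" by simp
    also have "\<dots> = (\<integral>x. (f x)\<^sup>2 + (2 * t) * (f x * g x) + t\<^sup>2 * (g x)\<^sup>2 \<partial>M)"
      by (intro Bochner_Integration.integral_cong) (auto simp: power2_eq_square algebra_simps)
    also have "\<dots> = A + 2 * t * B + t\<^sup>2 * C"
      using assms square_integrable_mult[OF assms] by (simp add: A_def B_def C_def square_integrable_def)
    finally show ?thesis .
  qed
  have "B\<^sup>2 \<le> A * C"
  proof (cases "C = 0")
    case True
    have "B = 0"
    proof (rule ccontr)
      assume "B \<noteq> 0"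
      then show False using q[of "- (A + 1) / (2 * B)"] True by (simp add: field_simps)
    qed
    then show ?thesis using AC by simp
  next
    case False
    with AC have "C > 0" by simp
    then show ?thesis using q[of "- B / C"] by (simp add: field_simps power2_eq_square)
  qed
  then show ?thesis by (simp add: A_def B_def C_def)
qed

text \<open>Completeness is assumed in the weak form of a trivial orthogonal complement; Parseval's
  identity is derived from it by way of the Riesz-Fischer theorem.\<close>

locale orthonormal_basis =
  fixes M :: "'a measure" and e :: "nat \<Rightarrow> 'a \<Rightarrow> real"
  assumes e: "square_integrable M (e i)"
    and ortho: "(\<integral>x. e i x * e j x \<partial>M) = (if i = j then 1 else 0)"
    and complete: "square_integrable M f \<Longrightarrow> (\<And>i. (\<integral>x. e i x * f x \<partial>M) = 0) \<Longrightarrow> AE x in M. f x = 0"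
begin

lemma square_integrable_span: "finite A \<Longrightarrow> square_integrable M (\<lambda>x. \<Sum>i\<in>A. c i * e i x)"
  by (intro square_integrable_sum square_integrable_cmult e) auto

lemma inner_span:
  assumes "square_integrable M f" "finite A"
  shows "(\<integral>x. f x * (\<Sum>i\<in>A. c i * e i x) \<partial>M) = (\<Sum>i\<in>A. c i * (\<integral>x. e i x * f x \<partial>M))"
proof -
  have "(\<integral>x. f x * (\<Sum>i\<in>A. c i * e i x) \<partial>M) = (\<integral>x. (\<Sum>i\<in>A. c i * (e i x * f x)) \<partial>M)"
    by (simp add: sum_distrib_left mult_ac)
  also have "\<dots> = (\<Sum>i\<in>A. c i * (\<integral>x. e i x * f x \<partial>M))"
    using square_integrable_mult[OF e assms(1)] by simp
  finally show ?thesis .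
qed

lemma inner_basis_span:
  assumes "finite A"
  shows "(\<integral>x. e j x * (\<Sum>i\<in>A. c i * e i x) \<partial>M) = (if j \<in> A then c j else 0)"
  using inner_span[OF e assms, of j c] assms by (simp add: ortho if_distrib cong: if_cong)

lemma norm_span:
  assumes "finite A"
  shows "(\<integral>x. (\<Sum>i\<in>A. c i * e i x)\<^sup>2 \<partial>M) = (\<Sum>i\<in>A. (c i)\<^sup>2)"
  unfolding power2_eq_square
  by (subst inner_span[OF square_integrable_span]) (auto simp: assms inner_basis_span)

lemma norm_diff_span:
  assumes f: "square_integrable M f" "\<And>i. i \<in> A \<Longrightarrow> (\<integral>x. e i x * f x \<partial>M) = c i" and A: "finite A"
  shows "(\<integral>x. (f x - (\<Sum>i\<in>A. c i * e i x))\<^sup>2 \<partial>M) = (\<integral>x. (f x)\<^sup>2 \<partial>M) - (\<Sum>i\<in>A. (c i)\<^sup>2)"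
proof -
  let ?s = "\<lambda>x. \<Sum>i\<in>A. c i * e i x"
  have s: "square_integrable M ?s" by (rule square_integrable_span[OF A])
  have "(\<integral>x. (f x - ?s x)\<^sup>2 \<partial>M) = (\<integral>x. (f x)\<^sup>2 - 2 * (f x * ?s x) + (?s x)\<^sup>2 \<partial>M)"
    by (intro Bochner_Integration.integral_cong) (auto simp: power2_eq_square algebra_simps)
  also have "\<dots> = (\<integral>x. (f x)\<^sup>2 \<partial>M) - 2 * (\<integral>x. f x * ?s x \<partial>M) + (\<integral>x. (?s x)\<^sup>2 \<partial>M)"
    using square_integrable_square[OF f(1)] square_integrable_square[OF s] square_integrable_mult[OF f(1) s]
    by simp
  also have "(\<integral>x. f x * ?s x \<partial>M) = (\<Sum>i\<in>A. (c i)\<^sup>2)"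
    unfolding inner_span[OF f(1) A] using f(2) by (intro sum.cong) (auto simp: power2_eq_square)
  finally show ?thesis by (simp add: norm_span[OF A])
qed

lemma bessel:
  assumes "square_integrable M f"
  shows "summable (\<lambda>i. (\<integral>x. e i x * f x \<partial>M)\<^sup>2)"
proof (rule bounded_imp_summable)
  fix n
  have "0 \<le> (\<integral>x. (f x - (\<Sum>i\<in>{..n}. (\<integral>x. e i x * f x \<partial>M) * e i x))\<^sup>2 \<partial>M)" by simp
  then show "(\<Sum>i\<le>n. (\<integral>x. e i x * f x \<partial>M)\<^sup>2) \<le> (\<integral>x. (f x)\<^sup>2 \<partial>M)"
    by (subst (asm) norm_diff_span[OF assms]) auto
qed simp

text \<open>The partial sums of the expansion are Cauchy in mean square. A rapidly converging
  subsequence converges almost everywhere, and Fatou's lemma upgrades this to mean square, which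
  carries the coefficients over to the limit.\<close>

lemma riesz_fischer:
  assumes c: "summable (\<lambda>i. (c i)\<^sup>2)"
  shows "\<exists>h. square_integrable M h \<and> (\<forall>i. (\<integral>x. e i x * h x \<partial>M) = c i) \<and>
    (\<integral>x. (h x)\<^sup>2 \<partial>M) = (\<Sum>i. (c i)\<^sup>2)"
proof -
  define s where "s = (\<lambda>n x. \<Sum>i<n. c i * e i x)"
  have s: "square_integrable M (s n)" for n
    unfolding s_def by (rule square_integrable_span) auto
  note [measurable] = square_integrable_measurable[OF s]
  have diff: "s n x - s m x = (\<Sum>i\<in>{m..<n}. c i * e i x)" if "m \<le> n" for m n x
  proof -
    have "s m x + (\<Sum>i\<in>{m..<n}. c i * e i x) = s n x"
      unfolding s_def lessThan_atLeast0 using that by (intro sum.atLeastLessThan_concat) auto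
    then show ?thesis by simp
  qed
  have norm_diff: "(\<integral>x. (s n x - s m x)\<^sup>2 \<partial>M) = (\<Sum>i\<in>{m..<n}. (c i)\<^sup>2)" if "m \<le> n" for m n
    unfolding diff[OF that] by (rule norm_span) simp
  have "\<exists>N. \<forall>m\<ge>N. \<forall>n. (\<Sum>i\<in>{m..<n}. (c i)\<^sup>2) < (1/4)^k" for k :: nat
  proof -
    obtain N where "\<And>m n. m \<ge> N \<Longrightarrow> norm (\<Sum>i\<in>{m..<n}. (c i)\<^sup>2) < (1/4)^k"
      using c[unfolded summable_Cauchy] by (meson zero_less_divide_1_iff zero_less_numeral zero_less_power)
    then show ?thesis by (metis abs_ge_self le_less_trans real_norm_def)
  qed
  then obtain N where N: "\<And>k m n. m \<ge> N k \<Longrightarrow> (\<Sum>i\<in>{m..<n}. (c i)\<^sup>2) < (1/4)^k" by metis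
  \<comment> \<open>Monotone in \<open>k\<close> and at least both \<open>k\<close> and
    \<open>N k\<close>: tails beyond \<open>r k\<close> are below 4^-k, and \<open>r k\<close> tends
    to infinity.\<close>
  define r where "r = (\<lambda>k. k + (\<Sum>j\<le>k. N j))"
  have r_Suc: "r k \<le> r (Suc k)" for k by (simp add: r_def)
  have r_mono: "r j \<le> r k" if "j \<le> k" for j k using r_Suc that by (rule lift_Suc_mono_le)
  have r_ge: "r k \<ge> k" "r k \<ge> N k" for k
    using member_le_sum[of k "{..k}" N] by (auto simp: r_def)
  have tail: "(\<integral>x. (s (r j) x - s (r k) x)\<^sup>2 \<partial>M) \<le> (1/4)^k" if "k \<le> j" for j k
    using N[of k "r k" "r j", OF r_ge(2)] norm_diff[OF r_mono[OF that]] by simp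
  define d where "d = (\<lambda>k x. s (r (Suc k)) x - s (r k) x)"
  have [measurable]: "d k \<in> borel_measurable M" for k unfolding d_def by measurable
  have int_d: "(\<integral>\<^sup>+x. ennreal (2^k * (d k x)\<^sup>2) \<partial>M) \<le> ennreal ((1/2)^k)" for k
  proof -
    have "(\<integral>\<^sup>+x. ennreal (2^k * (d k x)\<^sup>2) \<partial>M) = ennreal (\<integral>x. 2^k * (d k x)\<^sup>2 \<partial>M)"
      unfolding d_def using square_integrable_square[OF square_integrable_diff[OF s s]]
      by (intro nn_integral_eq_integral) auto
    also have "(\<integral>x. 2^k * (d k x)\<^sup>2 \<partial>M) \<le> 2^k * (1/4)^k"
      unfolding d_def using tail[of k "Suc k"] by simp
    also have "2^k * (1/4)^k = ((1/2)^k :: real)" by (simp flip: power_mult_distrib)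
    finally show ?thesis by (simp add: ennreal_leI)
  qed
  have "(\<integral>\<^sup>+x. (\<Sum>k. ennreal (2^k * (d k x)\<^sup>2)) \<partial>M) = (\<Sum>k. \<integral>\<^sup>+x. ennreal (2^k * (d k x)\<^sup>2) \<partial>M)"
    by (intro nn_integral_suminf) measurable
  also have "\<dots> \<le> (\<Sum>k. ennreal ((1/2)^k))" by (intro suminf_le int_d) auto
  also have "\<dots> < \<infinity>"
    unfolding infinity_ennreal_def less_top[symmetric] by (intro ennreal_suminf_neq_top) auto
  finally have "AE x in M. (\<Sum>k. ennreal (2^k * (d k x)\<^sup>2)) \<noteq> \<infinity>"
    by (intro nn_integral_PInf_AE) auto
  then have conv: "AE x in M. convergent (\<lambda>k. s (r k) x)"
  proof (rule AE_mp, intro AE_I2 impI)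
    fix x assume "(\<Sum>k. ennreal (2^k * (d k x)\<^sup>2)) \<noteq> \<infinity>"
    then have S: "summable (\<lambda>k. 2^k * (d k x)\<^sup>2)"
      by (intro summable_suminf_not_top) auto
    have "summable (\<lambda>k. d k x)"
    proof (rule summable_comparison_test', rule summable_add[OF S])
      show "summable (\<lambda>k. (1/2::real)^k)" by simp
      fix k :: nat
      \<comment> \<open>The measure may be infinite, so mean-square smallness does not bound
        integrals of the increments. The square below trades the increment for \<open>p\<close>
        times its square, summable by \<open>S\<close>, plus the geometric term
        \<open>1 / p\<close>.\<close>
      define p :: real where "p = 2 ^ k"
      have "p > 0" by (simp add: p_def)
      have "0 \<le> (p * \<bar>d k x\<bar> - 1)\<^sup>2 / p" using \<open>p > 0\<close> by simp
      also have "\<dots> = p * (d k x)\<^sup>2 - 2 * \<bar>d k x\<bar> + 1 / p"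
        using \<open>p > 0\<close> by (simp add: power2_eq_square field_simps)
      finally have "\<bar>d k x\<bar> \<le> p * (d k x)\<^sup>2 + 1 / p"
        by linarith
      then show "norm (d k x) \<le> 2^k * (d k x)\<^sup>2 + (1/2)^k" by (simp add: p_def power_divide)
    qed
    then have "convergent (\<lambda>n. \<Sum>k<n. d k x)" by (simp add: summable_iff_convergent)
    then have "convergent (\<lambda>n. (\<Sum>k<n. d k x) + s (r 0) x)" by (rule convergent_add[OF _ convergent_const])
    then show "convergent (\<lambda>k. s (r k) x)"
      unfolding d_def sum_lessThan_telescope[of "\<lambda>k. s (r k) x"] by simp
  qed
  define h where "h = (\<lambda>x. lim (\<lambda>k. s (r k) x))"
  have [measurable]: "h \<in> borel_measurable M" unfolding h_def by measurable
  have h_lim: "AE x in M. (\<lambda>k. s (r k) x) \<longlonglongrightarrow> h x"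
    using conv by eventually_elim (simp add: h_def convergent_LIMSEQ_iff)
  have fatou: "(\<integral>\<^sup>+x. ennreal ((h x - s (r k) x)\<^sup>2) \<partial>M) \<le> ennreal ((1/4)^k)" for k
  proof -
    have "(\<integral>\<^sup>+x. ennreal ((h x - s (r k) x)\<^sup>2) \<partial>M) =
        (\<integral>\<^sup>+x. liminf (\<lambda>j. ennreal ((s (r j) x - s (r k) x)\<^sup>2)) \<partial>M)"
    proof (rule nn_integral_cong_AE, use h_lim in eventually_elim)
      fix x assume "(\<lambda>k. s (r k) x) \<longlonglongrightarrow> h x"
      then have "(\<lambda>j. ennreal ((s (r j) x - s (r k) x)\<^sup>2)) \<longlonglongrightarrow> ennreal ((h x - s (r k) x)\<^sup>2)"
        by (intro tendsto_ennrealI tendsto_intros)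
      then show "ennreal ((h x - s (r k) x)\<^sup>2) = liminf (\<lambda>j. ennreal ((s (r j) x - s (r k) x)\<^sup>2))"
        by (intro lim_imp_Liminf[symmetric]) auto
    qed
    also have "\<dots> \<le> liminf (\<lambda>j. \<integral>\<^sup>+x. ennreal ((s (r j) x - s (r k) x)\<^sup>2) \<partial>M)"
      by (intro nn_integral_liminf) measurable
    also have "\<dots> \<le> ennreal ((1/4)^k)"
    proof (rule Liminf_le)
      show "\<forall>\<^sub>F j in sequentially. (\<integral>\<^sup>+x. ennreal ((s (r j) x - s (r k) x)\<^sup>2) \<partial>M) \<le> ennreal ((1/4)^k)"
        using eventually_ge_at_top[of k]
      proof eventually_elim
        case (elim j)
        have "(\<integral>\<^sup>+x. ennreal ((s (r j) x - s (r k) x)\<^sup>2) \<partial>M) = ennreal (\<integral>x. (s (r j) x - s (r k) x)\<^sup>2 \<partial>M)"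
          using square_integrable_square[OF square_integrable_diff[OF s s]]
          by (intro nn_integral_eq_integral) auto
        also have "\<dots> \<le> ennreal ((1/4)^k)" by (intro ennreal_leI tail elim)
        finally show ?case .
      qed
    qed simp
    finally show ?thesis .
  qed
  have hs: "square_integrable M (\<lambda>x. h x - s (r k) x)" for k
    unfolding square_integrable_def
  proof (intro conjI)
    show "integrable M (\<lambda>x. (h x - s (r k) x)\<^sup>2)"
      using fatou[of k] by (intro integrableI_bounded) (auto intro: le_less_trans)
  qed measurable
  have fatou': "(\<integral>x. (h x - s (r k) x)\<^sup>2 \<partial>M) \<le> (1/4)^k" for k
    using fatou[of k] by (subst (asm) nn_integral_eq_integral) (auto intro: square_integrable_square[OF hs])
  have h: "square_integrable M h"
    using square_integrable_add[OF hs s, of 0 "r 0"] by simp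
  have lim0: "(\<lambda>k. \<integral>x. (h x - s (r k) x)\<^sup>2 \<partial>M) \<longlonglongrightarrow> 0"
  proof (rule tendsto_sandwich[OF _ _ tendsto_const])
    show "(\<lambda>k. (1/4::real)^k) \<longlonglongrightarrow> 0" by (intro LIMSEQ_power_zero) simp
  qed (use fatou' in auto)
  have coeff: "(\<integral>x. e i x * h x \<partial>M) = c i" for i
  proof -
    \<comment> \<open>For \<open>k > i\<close> the sum of length \<open>r k\<close> already contains
      the i-th term, so only the mean-square error separates the two coefficients.\<close>
    have ineq: "((\<integral>x. e i x * h x \<partial>M) - c i)\<^sup>2 \<le> (1/4)^k" if "k > i" for k
    proof -
      have "i < r k" using r_ge(1)[of k] that by simp
      then have "(\<integral>x. e i x * s (r k) x \<partial>M) = c i"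
        unfolding s_def by (subst inner_basis_span) auto
      moreover have "(\<integral>x. e i x * (h x - s (r k) x) \<partial>M) = (\<integral>x. e i x * h x \<partial>M) - (\<integral>x. e i x * s (r k) x \<partial>M)"
        unfolding right_diff_distrib using square_integrable_mult[OF e h] square_integrable_mult[OF e s] by simp
      ultimately have "((\<integral>x. e i x * h x \<partial>M) - c i)\<^sup>2 = (\<integral>x. e i x * (h x - s (r k) x) \<partial>M)\<^sup>2" by simp
      also have "\<dots> \<le> (\<integral>x. (e i x)\<^sup>2 \<partial>M) * (\<integral>x. (h x - s (r k) x)\<^sup>2 \<partial>M)"
        by (rule cauchy_schwarz_integral[OF e hs])
      also have "(\<integral>x. (e i x)\<^sup>2 \<partial>M) = 1" using ortho[of i i] by (simp add: power2_eq_square)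
      finally show ?thesis using fatou'[of k] by simp
    qed
    have "((\<integral>x. e i x * h x \<partial>M) - c i)\<^sup>2 \<le> 0"
    proof (rule tendsto_lowerbound)
      show "(\<lambda>k. (1/4::real)^k) \<longlonglongrightarrow> 0" by (intro LIMSEQ_power_zero) simp
      show "\<forall>\<^sub>F k in sequentially. ((\<integral>x. e i x * h x \<partial>M) - c i)\<^sup>2 \<le> (1/4)^k"
        using eventually_gt_at_top[of i] by eventually_elim (rule ineq)
    qed simp
    then show ?thesis by simp
  qed
  have "(\<lambda>k. (\<integral>x. (h x)\<^sup>2 \<partial>M) - (\<Sum>i<r k. (c i)\<^sup>2)) \<longlonglongrightarrow> 0"
    using lim0 unfolding s_def norm_diff_span[OF h coeff finite_lessThan] .
  moreover have "(\<lambda>k. \<Sum>i<r k. (c i)\<^sup>2) \<longlonglongrightarrow> (\<Sum>i. (c i)\<^sup>2)"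
    by (rule filterlim_compose[OF summable_LIMSEQ[OF c]], rule filterlim_at_top_mono[OF filterlim_ident])
       (simp add: r_ge)
  ultimately have "(\<lambda>k. (\<integral>x. (h x)\<^sup>2 \<partial>M) - (\<Sum>i<r k. (c i)\<^sup>2) + (\<Sum>i<r k. (c i)\<^sup>2)) \<longlonglongrightarrow> 0 + (\<Sum>i. (c i)\<^sup>2)"
    by (rule tendsto_add)
  then have "(\<integral>x. (h x)\<^sup>2 \<partial>M) = (\<Sum>i. (c i)\<^sup>2)" by (simp add: LIMSEQ_const_iff)
  with h coeff show ?thesis by blast
qed

text \<open>Riesz-Fischer yields a function with the coefficients of \<open>f\<close> and squared
  norm equal to the sum of their squares; by completeness it equals \<open>f\<close> almost
  everywhere.\<close>

lemma parseval_norm: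
  assumes f: "square_integrable M f"
  shows "(\<lambda>i. (\<integral>x. e i x * f x \<partial>M)\<^sup>2) sums (\<integral>x. (f x)\<^sup>2 \<partial>M)"
proof -
  obtain h where h: "square_integrable M h" "\<And>i. (\<integral>x. e i x * h x \<partial>M) = (\<integral>x. e i x * f x \<partial>M)"
    "(\<integral>x. (h x)\<^sup>2 \<partial>M) = (\<Sum>i. (\<integral>x. e i x * f x \<partial>M)\<^sup>2)"
    using riesz_fischer[OF bessel[OF f]] by blast
  have "(\<integral>x. e i x * (f x - h x) \<partial>M) = 0" for i
    unfolding right_diff_distrib using square_integrable_mult[OF e h(1)] square_integrable_mult[OF e f] h(2) by simp
  then have "AE x in M. f x - h x = 0"
    using square_integrable_diff[OF f h(1)] by (intro complete) auto
  then have "(\<integral>x. (f x)\<^sup>2 \<partial>M) = (\<integral>x. (h x)\<^sup>2 \<partial>M)"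
    using square_integrable_measurable[OF f] square_integrable_measurable[OF h(1)]
    by (intro integral_cong_AE) auto
  then show ?thesis using summable_sums[OF bessel[OF f]] unfolding h(3) by (simp only:)
qed

text \<open>Polarisation of \<open>parseval_norm\<close>.\<close>

lemma parseval:
  assumes f: "square_integrable M f" and g: "square_integrable M g"
  shows "(\<lambda>i. (\<integral>x. e i x * f x \<partial>M) * (\<integral>x. e i x * g x \<partial>M)) sums (\<integral>x. f x * g x \<partial>M)"
proof -
  note sums = sums_diff[OF parseval_norm[OF square_integrable_add[OF f g]]
      parseval_norm[OF square_integrable_diff[OF f g]]]
  have ef: "integrable M (\<lambda>x. e i x * f x)" and eg: "integrable M (\<lambda>x. e i x * g x)" for i
    using square_integrable_mult[OF e f] square_integrable_mult[OF e g] by auto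
  have fg: "(a + b)\<^sup>2 - (a - b)\<^sup>2 = 4 * (a * b)" for a b :: real
    by (simp add: power2_eq_square algebra_simps)
  have "(\<integral>x. (f x + g x)\<^sup>2 \<partial>M) - (\<integral>x. (f x - g x)\<^sup>2 \<partial>M) = (\<integral>x. (f x + g x)\<^sup>2 - (f x - g x)\<^sup>2 \<partial>M)"
    using square_integrable_square[OF square_integrable_add[OF f g]]
      square_integrable_square[OF square_integrable_diff[OF f g]] by simp
  also have "\<dots> = 4 * (\<integral>x. f x * g x \<partial>M)" unfolding fg by simp
  finally have "(\<lambda>i. 4 * ((\<integral>x. e i x * f x \<partial>M) * (\<integral>x. e i x * g x \<partial>M))) sums (4 * (\<integral>x. f x * g x \<partial>M))"
    using sums unfolding distrib_left right_diff_distrib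
    by (simp only: Bochner_Integration.integral_add[OF ef eg] Bochner_Integration.integral_diff[OF ef eg] fg)
  then show ?thesis by (simp add: sums_mult_iff)
qed

end

section \<open>Functions on a Borel set as functions on the restricted Lebesgue measure\<close>

lemma L2_fun_iff:
  assumes "S \<in> sets borel"
  shows "L2_fun S f \<longleftrightarrow> square_integrable (restrict_space lborel S) f"
  using assms unfolding L2_fun_def square_integrable_def set_borel_measurable_def set_integrable_def
  by (simp add: borel_measurable_restrict_space_iff integrable_restrict_space)

lemma L2_inner_eq:
  assumes "S \<in> sets borel"
  shows "L2_inner S f g = (\<integral>x. f x * g x \<partial>restrict_space lborel S)"
  using assms unfolding L2_inner_def set_lebesgue_integral_def
  by (simp add: integral_restrict_space)

lemma L2_orthonormal_basis_iff:
  assumes "S \<in> sets borel"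
  shows "L2_orthonormal_basis S e \<longleftrightarrow> orthonormal_basis (restrict_space lborel S) e"
  using assms unfolding L2_orthonormal_basis_def orthonormal_basis_def
  by (auto simp: L2_fun_iff L2_inner_eq AE_restrict_space_iff)

section \<open>Gram-Schmidt orthonormalisation and a basis of L2 of a half-line\<close>

fun gram_schmidt :: "'a measure \<Rightarrow> (nat \<Rightarrow> 'a \<Rightarrow> real) \<Rightarrow> nat \<Rightarrow> 'a \<Rightarrow> real" where
  "gram_schmidt M f n =
    (let g = (\<lambda>x. f n x - (\<Sum>k<n. (\<integral>y. gram_schmidt M f k y * f n y \<partial>M) * gram_schmidt M f k x))
     in (\<lambda>x. g x / sqrt (\<integral>y. (g y)\<^sup>2 \<partial>M)))"

declare gram_schmidt.simps [simp del]

text \<open>Linear independence is expressed by subspaces \<open>V n\<close> that contain the functions before \<open>f n\<close>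
  but no function equal to \<open>f n\<close> almost everywhere.\<close>

lemma orthonormal_basis_gram_schmidt:
  assumes f: "\<And>n. square_integrable M (f n)"
    and total: "\<And>h. square_integrable M h \<Longrightarrow> (\<And>n. (\<integral>x. f n x * h x \<partial>M) = 0) \<Longrightarrow> AE x in M. h x = 0"
    and V_lin: "\<And>n g h a b. V n g \<Longrightarrow> V n h \<Longrightarrow> V n (\<lambda>x. a * g x + b * h x)"
    and V_0: "\<And>n. V n (\<lambda>_. 0)"
    and V_f: "\<And>k n. k < n \<Longrightarrow> V n (f k)"
    and V_indep: "\<And>n g. V n g \<Longrightarrow> \<not> (AE x in M. f n x = g x)"
  shows "orthonormal_basis M (gram_schmidt M f)"
proof -
  define e where "e = gram_schmidt M f"
  define g where "g = (\<lambda>n x. f n x - (\<Sum>k<n. (\<integral>y. e k y * f n y \<partial>M) * e k x))"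
  define c where "c = (\<lambda>n. sqrt (\<integral>y. (g n y)\<^sup>2 \<partial>M))"
  have e_eq: "e n = (\<lambda>x. g n x / c n)" for n
    unfolding e_def g_def c_def by (subst gram_schmidt.simps) (simp add: Let_def)
  have V_sum: "V n (\<lambda>x. \<Sum>k\<in>A. a k * h k x)" if "finite A" "\<And>k. k \<in> A \<Longrightarrow> V n (h k)" for n A and a h
    using that
  proof (induction A rule: finite_induct)
    case (insert k A)
    have "V n (\<lambda>x. a k * h k x + 1 * (\<Sum>k\<in>A. a k * h k x))"
      using insert by (intro V_lin) auto
    then show ?case using insert by simp
  qed (simp add: V_0)
  have V_e: "V n (e k)" if "k < n" for k n
    using that
  proof (induction k rule: less_induct)
    case (less k)
    have "V n (\<lambda>x. \<Sum>j<k. (\<integral>y. e j y * f k y \<partial>M) * e j x)"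
      using less by (intro V_sum) auto
    then have "V n (\<lambda>x. (1 / c k) * f k x + (- 1 / c k) * (\<Sum>j<k. (\<integral>y. e j y * f k y \<partial>M) * e j x))"
      using V_f[OF less.prems] by (intro V_lin)
    also have "(\<lambda>x. (1 / c k) * f k x + (- 1 / c k) * (\<Sum>j<k. (\<integral>y. e j y * f k y \<partial>M) * e j x)) = e k"
      unfolding e_eq[of k] g_def by (simp add: diff_divide_distrib)
    finally show ?case .
  qed
  have main: "square_integrable M (e n) \<and> c n > 0 \<and> (\<forall>j\<le>n. (\<integral>x. e j x * e n x \<partial>M) = (if j = n then 1 else 0))" for n
  proof (induction n rule: less_induct)
    case (less n)
    have e: "square_integrable M (e k)" if "k < n" for k using less[OF that] by blast
    have ortho: "(\<integral>x. e j x * e k x \<partial>M) = (if j = k then 1 else 0)" if "j < n" "k < n" for j k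
    proof (cases "j \<le> k")
      case True then show ?thesis using less[OF that(2)] by auto
    next
      case False
      have "(\<integral>x. e j x * e k x \<partial>M) = (\<integral>x. e k x * e j x \<partial>M)" by (simp add: mult.commute)
      with False show ?thesis using less[OF that(1)] by auto
    qed
    have g: "square_integrable M (g n)"
      unfolding g_def using e by (intro square_integrable_diff square_integrable_sum square_integrable_cmult f) auto
    \<comment> \<open>Otherwise \<open>f n\<close> would agree almost everywhere with a combination
      of the earlier \<open>e k\<close>, and such a combination lies in \<open>V n\<close>.\<close>
    have "(\<integral>y. (g n y)\<^sup>2 \<partial>M) \<noteq> 0"
    proof
      assume "(\<integral>y. (g n y)\<^sup>2 \<partial>M) = 0"
      then have "AE x in M. (g n x)\<^sup>2 = 0"
        by (subst (asm) integral_nonneg_eq_0_iff_AE) (auto intro: square_integrable_square[OF g])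
      then have "AE x in M. f n x = (\<Sum>k<n. (\<integral>y. e k y * f n y \<partial>M) * e k x)"
        by eventually_elim (simp add: g_def)
      moreover have "V n (\<lambda>x. \<Sum>k<n. (\<integral>y. e k y * f n y \<partial>M) * e k x)"
        using V_e by (intro V_sum) auto
      note V_indep[OF this]
      ultimately show False by contradiction
    qed
    then have c: "c n > 0"
      unfolding c_def by (simp add: order_less_le)
    have sq: "square_integrable M (e n)"
      using square_integrable_cmult[OF g, of "1 / c n"] by (simp add: e_eq[of n])
    have "(\<integral>x. e j x * g n x \<partial>M) = 0" if j: "j < n" for j
    proof -
      have "(\<integral>x. e j x * g n x \<partial>M) =
          (\<integral>x. e j x * f n x - (\<Sum>k<n. (\<integral>y. e k y * f n y \<partial>M) * (e j x * e k x)) \<partial>M)"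
        by (simp add: g_def right_diff_distrib sum_distrib_left mult_ac)
      also have "\<dots> = (\<integral>x. e j x * f n x \<partial>M) - (\<Sum>k<n. (\<integral>y. e k y * f n y \<partial>M) * (\<integral>x. e j x * e k x \<partial>M))"
        using square_integrable_mult[OF e[OF j] e] square_integrable_mult[OF e[OF j] f]
        by (subst Bochner_Integration.integral_diff)
           (auto intro!: Bochner_Integration.integrable_sum simp: Bochner_Integration.integral_sum)
      also have "(\<Sum>k<n. (\<integral>y. e k y * f n y \<partial>M) * (\<integral>x. e j x * e k x \<partial>M)) =
          (\<Sum>k<n. if k = j then (\<integral>y. e j y * f n y \<partial>M) else 0)"
        using ortho[OF j] by (intro sum.cong) auto
      also have "\<dots> = (\<integral>y. e j y * f n y \<partial>M)"
        using j by simp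
      finally show ?thesis by simp
    qed
    moreover have "(\<integral>x. e n x * e n x \<partial>M) = 1"
    proof -
      have "(\<integral>x. e n x * e n x \<partial>M) = (\<integral>x. (g n x)\<^sup>2 \<partial>M) / (c n * c n)"
        by (simp add: e_eq[of n] power2_eq_square)
      also have "(\<integral>x. (g n x)\<^sup>2 \<partial>M) = c n * c n" by (simp add: c_def)
      finally show ?thesis using c by simp
    qed
    moreover have "(\<integral>x. e j x * e n x \<partial>M) = (\<integral>x. e j x * g n x \<partial>M) / c n" for j
      by (simp add: e_eq[of n])
    ultimately have "(\<integral>x. e j x * e n x \<partial>M) = (if j = n then 1 else 0)" if "j \<le> n" for j
      using that by (cases "j = n") simp_all
    with sq c show ?case by blast
  qed
  show ?thesis
    unfolding e_def[symmetric]
  proof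
    show "square_integrable M (e i)" for i using main by blast
    show "(\<integral>x. e i x * e j x \<partial>M) = (if i = j then 1 else 0)" for i j
    proof (cases "i \<le> j")
      case True then show ?thesis using main[of j] by auto
    next
      case False
      have "(\<integral>x. e i x * e j x \<partial>M) = (\<integral>x. e j x * e i x \<partial>M)" by (simp add: mult.commute)
      with False show ?thesis using main[of i] by auto
    qed
    fix h assume h: "square_integrable M h" "\<And>i. (\<integral>x. e i x * h x \<partial>M) = 0"
    \<comment> \<open>The triangular recursion is inverted: \<open>f n\<close> is a combination of
      \<open>e 0\<close>, ..., \<open>e n\<close>, so orthogonality to all \<open>e i\<close> passes
      to the total family \<open>f\<close>.\<close>
    have "(\<integral>x. f n x * h x \<partial>M) = 0" for n
    proof -
      define a where "a = (\<lambda>k. \<integral>y. e k y * f n y \<partial>M)"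
      have "f n x = c n * e n x + (\<Sum>k<n. a k * e k x)" for x
        using main[of n] by (simp add: e_eq[of n] g_def a_def)
      then have "(\<integral>x. f n x * h x \<partial>M) =
          (\<integral>x. c n * (e n x * h x) + (\<Sum>k<n. a k * (e k x * h x)) \<partial>M)"
        by (simp add: distrib_left sum_distrib_left mult_ac)
      also have "\<dots> = 0"
        using square_integrable_mult[OF _ h(1)] main h(2) by simp
      finally show ?thesis .
    qed
    then show "AE x in M. h x = 0" by (rule total[OF h(1)])
  qed
qed

text \<open>Approaching \<open>s\<close> from the right through points at rational distance from
  \<open>t\<close>, the integral of \<open>h\<close> over \<open>{t<..s}\<close> vanishes for every
  real \<open>s\<close>. Then the positive and negative parts of \<open>h\<close> on
  \<open>{t<..s}\<close> have equal mass on all right half-lines, so they are densities of the same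
  measure.\<close>

lemma AE_zero_if_interval_integrals_zero:
  fixes h :: "real \<Rightarrow> real"
  assumes h: "square_integrable (restrict_space lborel {t<..}) h"
    and zero: "\<And>q. q \<in> \<rat> \<Longrightarrow> q > 0 \<Longrightarrow> (\<integral>x. indicator {t<..t+q} x * h x \<partial>restrict_space lborel {t<..}) = 0"
  shows "AE x in restrict_space lborel {t<..}. h x = 0"
proof -
  have h': "square_integrable lborel (\<lambda>x. indicator {t<..} x * h x)"
  proof -
    have "(indicator {t<..} x * h x)\<^sup>2 = indicator {t<..} x * (h x)\<^sup>2" for x
      by (simp add: indicator_def)
    then show ?thesis
      using h unfolding square_integrable_def
      by (simp add: borel_measurable_restrict_space_iff integrable_restrict_space)
  qed
  have ind: "square_integrable lborel (indicator {a<..b} :: real \<Rightarrow> real)" for a b :: real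
  proof -
    have "integrable lborel (indicator {a<..b} :: real \<Rightarrow> real)"
      by (intro integrable_real_indicator emeasure_bounded_finite bounded_Ioc) simp
    moreover have "(indicator {a<..b} x)\<^sup>2 = (indicator {a<..b} x :: real)" for x
      by (simp add: indicator_def)
    ultimately show ?thesis by (simp add: square_integrable_def)
  qed
  define H where "H = (\<lambda>s x. indicator {t<..s} x * h x)"
  have H_int: "integrable lborel (H s)" for s
  proof -
    have "integrable lborel (\<lambda>x. indicator {t<..s} x * (indicator {t<..} x * h x))"
      by (rule square_integrable_mult[OF ind h'])
    also have "(\<lambda>x. indicator {t<..s} x * (indicator {t<..} x * h x)) = H s"
      by (auto simp: H_def indicator_def)
    finally show ?thesis .
  qed
  note [measurable] = borel_measurable_integrable[OF H_int]
  have H_rat: "integral\<^sup>L lborel (H (t + q)) = 0" if "q \<in> \<rat>" "q > 0" for q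
  proof -
    have "integral\<^sup>L lborel (H (t + q)) = (\<integral>x. indicator {t<..} x *\<^sub>R (indicator {t<..t+q} x * h x) \<partial>lborel)"
      by (intro Bochner_Integration.integral_cong) (auto simp: H_def indicator_def)
    also have "\<dots> = 0" using zero[OF that] by (simp add: integral_restrict_space)
    finally show ?thesis .
  qed
  have H_zero: "integral\<^sup>L lborel (H s) = 0" for s
  proof (cases "s > t")
    case False
    then have "H s = (\<lambda>_. 0)" by (auto simp: H_def)
    then show ?thesis by simp
  next
    case True
    have "\<exists>q\<in>\<rat>. s - t < q \<and> q < s - t + 1 / Suc n" for n :: nat
      using Rats_dense_in_real[of "s - t" "s - t + 1 / Suc n"] by auto
    then obtain q where q: "\<And>n. q n \<in> \<rat>" "\<And>n. s - t < q n" "\<And>n :: nat. q n < s - t + 1 / Suc n"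
      by metis
    have q_le: "q n \<le> s - t + 1" for n
    proof -
      have "1 / real (Suc n) \<le> 1" by simp
      then show ?thesis using q(3)[of n] by linarith
    qed
    have q_lim: "q \<longlonglongrightarrow> s - t"
    proof (rule tendsto_sandwich[OF _ _ tendsto_const])
      show "(\<lambda>n. s - t + 1 / Suc n) \<longlonglongrightarrow> s - t"
        using tendsto_add[OF tendsto_const LIMSEQ_inverse_real_of_nat, of "s - t"] by (simp add: inverse_eq_divide)
    qed (use q in \<open>auto intro!: always_eventually less_imp_le\<close>)
    have "(\<lambda>n. integral\<^sup>L lborel (H (t + q n))) \<longlonglongrightarrow> integral\<^sup>L lborel (H s)"
    proof (rule integral_dominated_convergence)
      show "integrable lborel (\<lambda>x. \<bar>H (s + 1) x\<bar>)" using H_int by simp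
      show "AE x in lborel. (\<lambda>n. H (t + q n) x) \<longlonglongrightarrow> H s x"
      proof (intro AE_I2)
        fix x
        show "(\<lambda>n. H (t + q n) x) \<longlonglongrightarrow> H s x"
        proof (cases "x \<le> s")
          case True
          then have "H (t + q n) x = H s x" for n using q(2)[of n] by (auto simp: H_def indicator_def)
          then show ?thesis by simp
        next
          case False
          then have "\<forall>\<^sub>F n in sequentially. q n < x - t" using q_lim by (intro order_tendstoD) auto
          then have "\<forall>\<^sub>F n in sequentially. H (t + q n) x = H s x"
            by eventually_elim (use False in \<open>auto simp: H_def indicator_def\<close>)
          then show ?thesis by (rule tendsto_eventually)
        qed
      qed
      show "AE x in lborel. norm (H (t + q n) x) \<le> \<bar>H (s + 1) x\<bar>" for n
        using q_le[of n] by (intro AE_I2) (auto simp: H_def indicator_def)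
    qed measurable
    moreover have "integral\<^sup>L lborel (H (t + q n)) = 0" for n
      using q(1,2)[of n] True by (intro H_rat) auto
    ultimately show ?thesis by (simp add: LIMSEQ_const_iff)
  qed
  have AE_H: "AE x in lborel. H s x = 0" for s
  proof -
    have half: "(\<integral>\<^sup>+y. ennreal (H s y) * indicator {x<..} y \<partial>lborel) = (\<integral>\<^sup>+y. ennreal (- H s y) * indicator {x<..} y \<partial>lborel)"
      and fin: "(\<integral>\<^sup>+y. ennreal (H s y) * indicator {x<..} y \<partial>lborel) < \<infinity>" for x
    proof -
      \<comment> \<open>The part of \<open>H s\<close> to the right of \<open>x\<close>;
        \<open>min\<close> covers the case that \<open>x\<close> lies beyond \<open>s\<close>, where
        this part is zero.\<close>
      define u where "u = (\<lambda>y. H s y - H (min x s) y)"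
      have u: "integrable lborel u" unfolding u_def using H_int by simp
      have u0: "integral\<^sup>L lborel u = 0" unfolding u_def using H_int H_zero by simp
      have u_eq: "u y = H s y * indicator {x<..} y" for y
        by (auto simp: u_def H_def indicator_def)
      have p: "ennreal (H s y) * indicator {x<..} y = ennreal (u y)"
        and n: "ennreal (- H s y) * indicator {x<..} y = ennreal (- u y)" for y
        by (auto simp: u_eq indicator_def)
      have fins: "(\<integral>\<^sup>+y. ennreal (u y) \<partial>lborel) < \<infinity>" "(\<integral>\<^sup>+y. ennreal (- u y) \<partial>lborel) < \<infinity>"
        using u by (auto simp: real_integrable_def less_top[symmetric])
      have "enn2real (\<integral>\<^sup>+y. ennreal (u y) \<partial>lborel) = enn2real (\<integral>\<^sup>+y. ennreal (- u y) \<partial>lborel)"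
        using u0 real_lebesgue_integral_def[OF u] by simp
      then have "(\<integral>\<^sup>+y. ennreal (u y) \<partial>lborel) = (\<integral>\<^sup>+y. ennreal (- u y) \<partial>lborel)"
        using fins by (metis ennreal_enn2real infinity_ennreal_def)
      then show "(\<integral>\<^sup>+y. ennreal (H s y) * indicator {x<..} y \<partial>lborel) = (\<integral>\<^sup>+y. ennreal (- H s y) * indicator {x<..} y \<partial>lborel)"
        and "(\<integral>\<^sup>+y. ennreal (H s y) * indicator {x<..} y \<partial>lborel) < \<infinity>"
        using fins unfolding p n by auto
    qed
    have "density lborel (\<lambda>y. ennreal (H s y)) = density lborel (\<lambda>y. ennreal (- H s y))"
      by (rule measure_eqI_lessThan) (use half fin in \<open>auto simp: emeasure_density\<close>)
    then have "AE x in lborel. ennreal (H s x) = ennreal (- H s x)"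
      by (intro sigma_finite_measure.density_unique[OF sigma_finite_lborel]) auto
    then show ?thesis
    proof eventually_elim
      case (elim x)
      then show ?case
        by (cases "H s x \<ge> 0") (auto simp: ennreal_neg)
    qed
  qed
  have "AE x in lborel. \<forall>n. H (real n) x = 0" using AE_H by (simp add: AE_all_countable)
  then have "AE x in lborel. x \<in> {t<..} \<longrightarrow> h x = 0"
  proof eventually_elim
    case (elim x)
    obtain n where "x \<le> real n" using real_arch_simple by blast
    then show ?case using elim[rule_format, of n] by (auto simp: H_def indicator_def)
  qed
  then show ?thesis by (simp add: AE_restrict_space_iff)
qed

text \<open>\<open>trace_exterior_power\<close> is a definite description over all bases and
  determines a value only if there is a basis. This one comes from the indicators of
  \<open>{t<..t + q}\<close>, \<open>q\<close> a positive rational: they are total, and each jumps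
  at a point near which the earlier ones are constant.\<close>

lemma orthonormal_basis_Ioi_exists:
  fixes t :: real
  shows "\<exists>e. L2_orthonormal_basis {t<..} e"
proof -
  let ?M = "restrict_space lborel {t<..}"
  define Q where "Q = {q :: real. q \<in> \<rat> \<and> q > 0}"
  have "infinite Q"
  proof -
    have "infinite (range (\<lambda>n. real (Suc n)))" by (intro range_inj_infinite) (auto simp: inj_def)
    moreover have "range (\<lambda>n. real (Suc n)) \<subseteq> Q" by (auto simp: Q_def)
    ultimately show ?thesis by (rule infinite_super[rotated])
  qed
  moreover have "countable Q" unfolding Q_def by (rule countable_subset[OF _ countable_rat]) auto
  ultimately have bij: "bij_betw (from_nat_into Q) UNIV Q" by (intro bij_betw_from_nat_into)
  define q where "q = from_nat_into Q"
  have q_pos: "q n > 0" for n using bij by (auto simp: q_def Q_def bij_betw_def)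
  have q_inj: "q m = q n \<longleftrightarrow> m = n" for m n using bij by (auto simp: q_def bij_betw_def inj_def)
  have q_surj: "\<exists>n. r = q n" if "r \<in> \<rat>" "r > 0" for r
    using bij that unfolding q_def bij_betw_def Q_def by (metis (mono_tags, lifting) imageE mem_Collect_eq)
  define f :: "nat \<Rightarrow> real \<Rightarrow> real" where "f = (\<lambda>n. indicator {t<..t + q n})"
  \<comment> \<open>the functions that are constant near the jump of \<open>f n\<close>\<close>
  define V :: "nat \<Rightarrow> (real \<Rightarrow> real) \<Rightarrow> bool"
    where "V = (\<lambda>n g. \<exists>d c. d > 0 \<and> (\<forall>x. \<bar>x - (t + q n)\<bar> < d \<longrightarrow> g x = c))"
  have "orthonormal_basis ?M (gram_schmidt ?M f)"
  proof (rule orthonormal_basis_gram_schmidt)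
    show "square_integrable ?M (f n)" for n
    proof -
      have "integrable lborel (indicator {t<..t + q n} :: real \<Rightarrow> real)"
        by (intro integrable_real_indicator emeasure_bounded_finite bounded_Ioc) simp
      moreover have "indicator {t<..} x * (indicator {t<..t + q n} x)\<^sup>2 = (indicator {t<..t + q n} x :: real)" for x
        by (simp add: indicator_def)
      moreover have "indicator {t<..} x * indicator {t<..t + q n} x = (indicator {t<..t + q n} x :: real)" for x
        by (simp add: indicator_def)
      ultimately show ?thesis
        by (simp add: square_integrable_def f_def borel_measurable_restrict_space_iff integrable_restrict_space)
    qed
    show "AE x in ?M. h x = 0" if "square_integrable ?M h" "\<And>n. (\<integral>x. f n x * h x \<partial>?M) = 0" for h
      using that(1)
    proof (rule AE_zero_if_interval_integrals_zero)
      fix r :: real assume "r \<in> \<rat>" "r > 0"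
      then obtain n where "r = q n" using q_surj by blast
      then show "(\<integral>x. indicator {t<..t + r} x * h x \<partial>?M) = 0"
        using that(2)[of n] by (simp add: f_def)
    qed
    show "V n (\<lambda>x. a * g x + b * h x)" if V: "V n g" "V n h" for n g h a b
    proof -
      obtain d c d' c' where "d > 0" "\<forall>x. \<bar>x - (t + q n)\<bar> < d \<longrightarrow> g x = c"
        "d' > 0" "\<forall>x. \<bar>x - (t + q n)\<bar> < d' \<longrightarrow> h x = c'"
        using V unfolding V_def by blast
      then show ?thesis unfolding V_def
        by (intro exI[of _ "min d d'"] exI[of _ "a * c + b * c'"]) auto
    qed
    show "V n (\<lambda>_. 0)" for n unfolding V_def by (intro exI[of _ 1] exI[of _ 0]) auto
    show "V n (f k)" if "k < n" for k n
    proof -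
      have "q k \<noteq> q n" using that q_inj by simp
      then show ?thesis unfolding V_def f_def
        \<comment> \<open>The radius keeps the neighbourhood to the right of \<open>t\<close> and
          away from the other jump \<open>t + q k\<close>.\<close>
        by (intro exI[of _ "min (q n) \<bar>q k - q n\<bar>"] exI[of _ "if q n < q k then 1 else 0"])
           (use q_pos[of n] in \<open>auto simp: indicator_def\<close>)
    qed
    show "\<not> (AE x in ?M. f n x = g x)" if V: "V n g" for n g
    proof
      assume "AE x in ?M. f n x = g x"
      then have AE: "AE x in lborel. t < x \<longrightarrow> f n x = g x" by (simp add: AE_restrict_space_iff)
      obtain d c where d: "d > 0" "\<And>x. \<bar>x - (t + q n)\<bar> < d \<Longrightarrow> g x = c"
        using V unfolding V_def by blast
      define d' where "d' = min d (q n)"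
      have d': "d' > 0" "d' \<le> d" "d' \<le> q n" using d(1) q_pos by (auto simp: d'_def)
      have no_AE: "\<not> (AE x in lborel. x \<notin> {a<..<b})" if "a < b" for a b :: real
      proof
        assume "AE x in lborel. x \<notin> {a<..<b}"
        then have "emeasure lborel {a<..<b} = 0" by (subst (asm) AE_iff_measurable[of "{a<..<b}"]) auto
        then show False using that by simp
      qed
      \<comment> \<open>Just left of the jump \<open>f n\<close> is 1 and just right of it 0, while
        \<open>g\<close> has the single value \<open>c\<close> on both sides.\<close>
      have "AE x in lborel. c = 1 \<or> x \<notin> {t + q n - d'<..<t + q n}"
        using AE by eventually_elim (use d d' in \<open>auto simp: f_def indicator_def\<close>)
      then have "c = 1"
        using no_AE[of "t + q n - d'" "t + q n"] d'(1) by (cases "c = 1") (simp_all del: greaterThanLessThan_iff)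
      have "AE x in lborel. c = 0 \<or> x \<notin> {t + q n<..<t + q n + d'}"
        using AE by eventually_elim (use d d' q_pos[of n] in \<open>auto simp: f_def indicator_def\<close>)
      then have "c = 0"
        using no_AE[of "t + q n" "t + q n + d'"] d'(1) by (cases "c = 0") (simp_all del: greaterThanLessThan_iff)
      with \<open>c = 1\<close> show False by simp
    qed
  qed
  then show ?thesis by (auto simp: L2_orthonormal_basis_iff)
qed

section \<open>Traces of exterior powers\<close>

abbreviation increasing_tuples :: "nat \<Rightarrow> (nat \<Rightarrow> nat) set" where
  "increasing_tuples k \<equiv> {i \<in> {..<k} \<rightarrow>\<^sub>E UNIV. strict_mono_on {..<k} i}"

text \<open>At the first position where the tuples differ, the smaller value would have to occur in
  the other tuple: earlier positions are excluded by agreement, later ones by monotonicity.\<close>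

lemma increasing_tuple_unique:
  assumes "i \<in> increasing_tuples k" "j \<in> increasing_tuples k" "i ` {..<k} = j ` {..<k}"
  shows "i = j"
proof -
  have "i m = j m" if "m < k" for m
    using that
  proof (induction m rule: less_induct)
    case (less m)
    have *: "\<not> u m < v m" if u: "u \<in> increasing_tuples k" and v: "v \<in> increasing_tuples k"
      and im: "u ` {..<k} = v ` {..<k}" and eq: "\<And>l. l < m \<Longrightarrow> u l = v l" for u v :: "nat \<Rightarrow> nat"
    proof
      assume lt: "u m < v m"
      obtain l where l: "l < k" "u m = v l" using im less.prems by auto
      show False
      proof (cases l m rule: linorder_cases)
        case less
        then have "u l = u m" using eq[of l] l by simp
        moreover have "u l < u m" using strict_mono_onD[of "{..<k}" u l m] u less l(1) \<open>m < k\<close> by simp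
        ultimately show False by simp
      next
        case equal then show False using l lt by simp
      next
        case greater
        then have "v m < v l" using v l \<open>m < k\<close> by (auto simp: strict_mono_on_def)
        then show False using l lt by simp
      qed
    qed
    have "\<not> i m < j m" by (rule *) (use assms less in auto)
    moreover have "\<not> j m < i m" by (rule *) (use assms less in auto)
    ultimately show ?case by simp
  qed
  moreover have "i m = j m" if "\<not> m < k" for m
    using that assms(1,2) by (auto simp: PiE_def extensional_def)
  ultimately show ?thesis by blast
qed

text \<open>An injective tuple is a sorted tuple read in a unique permuted order, so a symmetric sum
  over injective tuples counts each increasing one \<open>fact k\<close> times.\<close>

lemma increasing_tuples_permutations_bij:
  "bij_betw (\<lambda>(i, p). restrict (i \<circ> p) {..<k}) (increasing_tuples k \<times> {p. p permutes {..<k}})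
    {h \<in> {..<k} \<rightarrow>\<^sub>E (UNIV :: nat set). inj_on h {..<k}}"
  unfolding bij_betw_def
proof (intro conjI)
  have inj: "inj_on i {..<k}" if "i \<in> increasing_tuples k" for i
    using that strict_mono_on_imp_inj_on by auto
  show "inj_on (\<lambda>(i, p). restrict (i \<circ> p) {..<k}) (increasing_tuples k \<times> {p. p permutes {..<k}})"
  proof (rule inj_onI, safe)
    fix i j :: "nat \<Rightarrow> nat" and p q
    assume i: "i \<in> {..<k} \<rightarrow>\<^sub>E UNIV" "strict_mono_on {..<k} i"
      and j: "j \<in> {..<k} \<rightarrow>\<^sub>E UNIV" "strict_mono_on {..<k} j"
      and p: "p permutes {..<k}" and q: "q permutes {..<k}"
      and eq: "restrict (i \<circ> p) {..<k} = restrict (j \<circ> q) {..<k}"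
    have pw: "i (p m) = j (q m)" if "m < k" for m
      using fun_cong[OF eq, of m] that by simp
    have "i ` {..<k} = (\<lambda>m. i (p m)) ` {..<k}"
      using permutes_image[OF p] by (metis image_image)
    also have "\<dots> = (\<lambda>m. j (q m)) ` {..<k}" using pw by (intro image_cong) auto
    also have "\<dots> = j ` {..<k}" using permutes_image[OF q] by (metis image_image)
    finally have "i = j" using i j by (intro increasing_tuple_unique) auto
    then show "i = j" .
    show "p = q"
    proof
      fix m
      show "p m = q m"
      proof (cases "m < k")
        case True
        then have "p m < k" "q m < k" using permutes_in_image[OF p, of m] permutes_in_image[OF q, of m] by auto
        then show ?thesis using pw[OF True] inj[of i] i \<open>i = j\<close> by (auto simp: inj_on_def)
      next
        case False
        then show ?thesis using permutes_not_in[OF p, of m] permutes_not_in[OF q, of m] by simp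
      qed
    qed
  qed
  show "(\<lambda>(i, p). restrict (i \<circ> p) {..<k}) ` (increasing_tuples k \<times> {p. p permutes {..<k}}) =
    {h \<in> {..<k} \<rightarrow>\<^sub>E UNIV. inj_on h {..<k}}" (is "?L = ?R")
  proof
    show "?L \<subseteq> ?R"
    proof (rule image_subsetI, clarify, intro CollectI conjI PiE_I)
      fix i :: "nat \<Rightarrow> nat" and p assume i: "i \<in> {..<k} \<rightarrow>\<^sub>E UNIV" "strict_mono_on {..<k} i" and p: "p permutes {..<k}"
      show "restrict (i \<circ> p) {..<k} x \<in> UNIV" for x by simp
      show "restrict (i \<circ> p) {..<k} x = undefined" if "x \<notin> {..<k}" for x using that by simp
      have "inj_on (i \<circ> p) {..<k}"
        using inj[of i] i permutes_image[OF p] permutes_inj_on[OF p] by (intro comp_inj_on) auto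
      then show "inj_on (restrict (i \<circ> p) {..<k}) {..<k}" by (simp add: inj_on_restrict_eq)
    qed
    show "?R \<subseteq> ?L"
    proof safe
      fix h :: "nat \<Rightarrow> nat" assume h: "h \<in> {..<k} \<rightarrow>\<^sub>E UNIV" "inj_on h {..<k}"
      define R where "R = h ` {..<k}"
      have R: "finite R" "card R = k" using h by (auto simp: R_def card_image)
      define i where "i = restrict (enumerate R) {..<k}"
      have i_bij: "bij_betw (enumerate R) {..<k} R" using finite_bij_enumerate[OF R(1)] R(2) by simp
      have i: "i \<in> increasing_tuples k"
        using R finite_enumerate_mono[of _ _ R] by (auto simp: i_def strict_mono_on_def)
      have h_bij: "bij_betw h {..<k} R" using h by (simp add: bij_betw_def R_def)
      \<comment> \<open>\<open>p m\<close> is the rank of \<open>h m\<close> within the image of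
        \<open>h\<close>.\<close>
      define p where "p = (\<lambda>m. if m < k then inv_into {..<k} (enumerate R) (h m) else m)"
      have "bij_betw (inv_into {..<k} (enumerate R) \<circ> h) {..<k} {..<k}"
        using bij_betw_trans[OF h_bij bij_betw_inv_into[OF i_bij]] .
      then have "bij_betw p {..<k} {..<k}"
        by (subst bij_betw_cong[of _ _ "inv_into {..<k} (enumerate R) \<circ> h"]) (auto simp: p_def)
      then have p: "p permutes {..<k}" by (intro bij_imp_permutes) (auto simp: p_def)
      have "restrict (i \<circ> p) {..<k} = h"
      proof
        fix m
        show "restrict (i \<circ> p) {..<k} m = h m"
        proof (cases "m < k")
          case True
          then have "p m < k" using permutes_in_image[OF p, of m] by auto
          moreover have "enumerate R (inv_into {..<k} (enumerate R) (h m)) = h m"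
            using True i_bij by (intro f_inv_into_f) (auto simp: bij_betw_def R_def)
          ultimately show ?thesis using True by (simp add: i_def p_def)
        next
          case False then show ?thesis using h(1) by (auto simp: PiE_def extensional_def)
        qed
      qed
      then show "h \<in> ?L" using i p by force
    qed
  qed
qed

text \<open>Turns an integral over all tuples into the sum over increasing ones that
  \<open>trace_exterior_power\<close> asks for: repeated indices contribute nothing, and each
  increasing tuple has \<open>fact k\<close> rearrangements.\<close>

lemma has_sum_increasing_tuples:
  fixes f :: "(nat \<Rightarrow> nat) \<Rightarrow> real"
  assumes nonneg: "\<And>i. i \<in> {..<k} \<rightarrow>\<^sub>E UNIV \<Longrightarrow> 0 \<le> f i"
    and sym: "\<And>i p. i \<in> {..<k} \<rightarrow>\<^sub>E UNIV \<Longrightarrow> p permutes {..<k} \<Longrightarrow> f (restrict (i \<circ> p) {..<k}) = f i"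
    and inj: "\<And>i. i \<in> {..<k} \<rightarrow>\<^sub>E UNIV \<Longrightarrow> \<not> inj_on i {..<k} \<Longrightarrow> f i = 0"
    and T: "(\<integral>\<^sup>+i. ennreal (f i) \<partial>(\<Pi>\<^sub>M i\<in>{..<k}. count_space UNIV)) = ennreal T" "0 \<le> T"
  shows "(f has_sum (T / fact k)) (increasing_tuples k)"
proof -
  let ?I = "{..<k} \<rightarrow>\<^sub>E (UNIV :: nat set)"
  have PiM: "(\<Pi>\<^sub>M i\<in>{..<k}. count_space (UNIV :: nat set)) = count_space ?I"
    by (rule count_space_PiM_finite) auto
  have int: "integrable (count_space ?I) f" "integral\<^sup>L (count_space ?I) f = T"
  proof -
    have "has_bochner_integral (count_space ?I) f T"
      using T nonneg unfolding PiM by (intro has_bochner_integral_nn_integral) (auto simp: AE_count_space)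
    then show "integrable (count_space ?I) f" "integral\<^sup>L (count_space ?I) f = T"
      by (auto simp: has_bochner_integral_iff)
  qed
  then have "Infinite_Set_Sum.abs_summable_on f ?I"
    by (simp add: Infinite_Set_Sum.abs_summable_on_def)
  then have "f summable_on ?I" "infsum f ?I = T"
    using int(2) infsetsum_infsum[of f ?I] abs_summable_equivalent[of f ?I] abs_summable_summable[of f ?I]
    by (auto simp: infsetsum_def)
  then have "(f has_sum T) ?I" by (metis has_sum_infsum)
  then have "(f has_sum T) {h \<in> ?I. inj_on h {..<k}}"
    by (subst has_sum_cong_neutral[of "?I" _ f f]) (auto intro: inj)
  then have "((\<lambda>x. f (case x of (i, p) \<Rightarrow> restrict (i \<circ> p) {..<k})) has_sum T)
      (increasing_tuples k \<times> {p. p permutes {..<k}})"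
    by (subst has_sum_reindex_bij_betw[OF increasing_tuples_permutations_bij])
  then have "((\<lambda>i. fact k * f i) has_sum T) (increasing_tuples k)"
  proof (rule has_sum_SigmaD)
    fix i assume i: "i \<in> increasing_tuples k"
    have "((\<lambda>p. f i) has_sum (\<Sum>p | p permutes {..<k}. f i)) {p. p permutes {..<k}}"
      by (intro has_sum_finite finite_permutations) simp
    also have "(\<Sum>p | p permutes {..<k}. f i) = fact k * f i" by (simp add: card_permutations)
    finally show "((\<lambda>p. f (case (i, p) of (i, p) \<Rightarrow> restrict (i \<circ> p) {..<k})) has_sum fact k * f i) {p. p permutes {..<k}}"
      by (rule has_sum_cong[THEN iffD1, rotated]) (use i sym in auto)
  qed
  then show ?thesis by (subst (asm) has_sum_cmult_right_iff) auto
qed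

lemma integrable_mult_pair:
  fixes u :: "'a \<Rightarrow> real" and v :: "'b \<Rightarrow> real"
  assumes M: "sigma_finite_measure M" and N: "sigma_finite_measure N"
    and u: "integrable M u" and v: "integrable N v"
  shows "integrable (M \<Otimes>\<^sub>M N) (\<lambda>(x, z). u x * v z)"
proof -
  interpret M: sigma_finite_measure M by fact
  interpret N: sigma_finite_measure N by fact
  interpret pair_sigma_finite M N by standard
  note [measurable] = borel_measurable_integrable[OF u] borel_measurable_integrable[OF v]
  show ?thesis
  proof (rule Fubini_integrable)
    show "(\<lambda>(x, z). u x * v z) \<in> borel_measurable (M \<Otimes>\<^sub>M N)" by measurable
    show "integrable M (\<lambda>x. \<integral>z. norm (case (x, z) of (x, z) \<Rightarrow> u x * v z) \<partial>N)"
      using u v by (simp add: abs_mult)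
    show "AE x in M. integrable N (\<lambda>z. case (x, z) of (x, z) \<Rightarrow> u x * v z)"
      using v by simp
  qed
qed

text \<open>Let \<open>c i z\<close> be the i-th coefficient of \<open>\<lambda>x. b x z\<close>.
  The matrix elements are Gram integrals of the \<open>c i\<close> over \<open>z\<close>; duality
  moves the minors to the variable \<open>z\<close>, Parseval's identity removes the basis, and a
  second duality returns to \<open>x\<close>.\<close>

lemma (in orthonormal_basis) trace_exterior_power_gram:
  fixes N :: "'b measure" and b :: "'a \<Rightarrow> 'b \<Rightarrow> real"
  assumes M: "sigma_finite_measure M" and N: "sigma_finite_measure N"
    and b [measurable]: "case_prod b \<in> borel_measurable (M \<Otimes>\<^sub>M N)"
    and bN: "\<And>x. x \<in> space M \<Longrightarrow> integrable N (\<lambda>z. (b x z)\<^sup>2)"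
    and bM: "\<And>z. z \<in> space N \<Longrightarrow> integrable M (\<lambda>x. (b x z)\<^sup>2)"
    and b2: "integrable (M \<Otimes>\<^sub>M N) (\<lambda>(x, z). (b x z)\<^sup>2)"
    and T: "(\<integral>\<^sup>+x. ennreal (fdet k (\<lambda>i j. \<integral>z. b (x i) z * b (x j) z \<partial>N)) \<partial>(\<Pi>\<^sub>M i\<in>{..<k}. M)) = ennreal T"
      "0 \<le> T"
  shows "((\<lambda>i. fdet k (\<lambda>m n. \<integral>x. e (i m) x * (\<integral>y. (\<integral>z. b x z * b y z \<partial>N) * e (i n) y \<partial>M) \<partial>M))
    has_sum (T / fact k)) (increasing_tuples k)"
proof -
  interpret M: sigma_finite_measure M by fact
  interpret N: sigma_finite_measure N by fact
  interpret pair_sigma_finite M N by standard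
  note [measurable] = square_integrable_measurable[OF e]
  have b_sqN: "square_integrable N (b x)" if "x \<in> space M" for x
    using that bN by (auto simp: square_integrable_def)
  have b_sqM: "square_integrable M (\<lambda>x. b x z)" if "z \<in> space N" for z
    using that bM by (auto simp: square_integrable_def)
  \<comment> \<open>Fubini applies because the integrand is a product of \<open>u x * v z\<close>
    and \<open>b x z\<close>, both square-integrable on the product space.\<close>
  have swap: "(\<integral>x. u x * (\<integral>z. b x z * v z \<partial>N) \<partial>M) = (\<integral>z. (\<integral>x. u x * b x z \<partial>M) * v z \<partial>N)"
    if u: "square_integrable M u" and v: "square_integrable N v" for u v
  proof -
    note [measurable] = square_integrable_measurable[OF u] square_integrable_measurable[OF v]
    have "integrable (M \<Otimes>\<^sub>M N) (\<lambda>p. (\<lambda>(x, z). u x * v z) p * (\<lambda>(x, z). b x z) p)"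
    proof (rule integrable_mult_of_squares)
      show "integrable (M \<Otimes>\<^sub>M N) (\<lambda>p. (case p of (x, z) \<Rightarrow> u x * v z)\<^sup>2)"
        using integrable_mult_pair[OF M N square_integrable_square[OF u] square_integrable_square[OF v]]
        by (simp add: split_beta' power_mult_distrib)
      show "integrable (M \<Otimes>\<^sub>M N) (\<lambda>p. (case p of (x, z) \<Rightarrow> b x z)\<^sup>2)"
        using b2 by (simp add: split_beta')
    qed measurable
    then have int: "integrable (M \<Otimes>\<^sub>M N) (\<lambda>(x, z). u x * b x z * v z)"
      by (simp add: split_beta' mult_ac)
    have "(\<integral>x. u x * (\<integral>z. b x z * v z \<partial>N) \<partial>M) = (\<integral>x. \<integral>z. u x * b x z * v z \<partial>N \<partial>M)"
      by (simp add: mult.assoc)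
    also have "\<dots> = (\<integral>z. \<integral>x. u x * b x z * v z \<partial>M \<partial>N)"
      by (rule Fubini_integral[OF int, symmetric])
    finally show ?thesis by simp
  qed
  define c where "c = (\<lambda>i z. \<integral>x. e i x * b x z \<partial>M)"
  have [measurable]: "c i \<in> borel_measurable N" for i
    unfolding c_def by (intro M.borel_measurable_lebesgue_integral) measurable
  have c_sq: "square_integrable N (c i)" for i
    unfolding square_integrable_def
  proof (intro conjI)
    show "integrable N (\<lambda>z. (c i z)\<^sup>2)"
    proof (rule Bochner_Integration.integrable_bound)
      show "integrable N (\<lambda>z. \<integral>x. (b x z)\<^sup>2 \<partial>M)"
        using integrable_snd[OF b2] by simp
      show "AE z in N. norm ((c i z)\<^sup>2) \<le> norm (\<integral>x. (b x z)\<^sup>2 \<partial>M)"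
      proof (intro AE_I2)
        fix z assume "z \<in> space N"
        then have "(c i z)\<^sup>2 \<le> (\<integral>x. (e i x)\<^sup>2 \<partial>M) * (\<integral>x. (b x z)\<^sup>2 \<partial>M)"
          unfolding c_def by (intro cauchy_schwarz_integral e b_sqM)
        also have "(\<integral>x. (e i x)\<^sup>2 \<partial>M) = 1" using ortho[of i i] by (simp add: power2_eq_square)
        finally show "norm ((c i z)\<^sup>2) \<le> norm (\<integral>x. (b x z)\<^sup>2 \<partial>M)" by simp
      qed
    qed measurable
  qed measurable
  have matrix_element: "(\<integral>x. e i x * (\<integral>y. (\<integral>z. b x z * b y z \<partial>N) * e j y \<partial>M) \<partial>M) = (\<integral>z. c i z * c j z \<partial>N)"
    for i j
  proof -
    have "(\<integral>y. (\<integral>z. b x z * b y z \<partial>N) * e j y \<partial>M) = (\<integral>z. b x z * c j z \<partial>N)" if x: "x \<in> space M" for x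
    proof -
      have "(\<integral>y. (\<integral>z. b x z * b y z \<partial>N) * e j y \<partial>M) = (\<integral>y. e j y * (\<integral>z. b y z * b x z \<partial>N) \<partial>M)"
        by (simp add: mult.commute)
      also have "\<dots> = (\<integral>z. c j z * b x z \<partial>N)"
        unfolding c_def by (rule swap[OF e b_sqN[OF x]])
      finally show ?thesis by (simp add: mult.commute)
    qed
    then have "(\<integral>x. e i x * (\<integral>y. (\<integral>z. b x z * b y z \<partial>N) * e j y \<partial>M) \<partial>M) = (\<integral>x. e i x * (\<integral>z. b x z * c j z \<partial>N) \<partial>M)"
      by (intro Bochner_Integration.integral_cong) auto
    also have "\<dots> = (\<integral>z. c i z * c j z \<partial>N)"
      using swap[OF e c_sq, of i j] by (simp only: c_def)
    finally show ?thesis .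
  qed
  let ?C = "count_space (UNIV :: nat set)"
  have C: "sigma_finite_measure ?C" by (rule sigma_finite_measure_count_space)
  have c_meas: "case_prod c \<in> borel_measurable (?C \<Otimes>\<^sub>M N)"
    by (rule measurable_pair_measure_countable1) auto
  have c_sum: "integrable ?C (\<lambda>i. (c i z)\<^sup>2)" if "z \<in> space N" for z
    using bessel[OF b_sqM[OF that]] unfolding integrable_count_space_nat_iff c_def by simp
  have c_parseval: "(\<integral>i. c i z * c i w \<partial>?C) = (\<integral>x. b x z * b x w \<partial>M)"
    if "z \<in> space N" "w \<in> space N" for z w
  proof -
    have "integrable ?C (\<lambda>i. c i z * c i w)"
      using c_sum that by (intro integrable_mult_of_squares) auto
    then have "(\<integral>i. c i z * c i w \<partial>?C) = (\<Sum>i. c i z * c i w)"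
      by (rule integral_count_space_nat)
    also have "\<dots> = (\<integral>x. b x z * b x w \<partial>M)"
      using parseval[OF b_sqM[OF that(1)] b_sqM[OF that(2)]] unfolding c_def by (rule sums_unique[symmetric])
    finally show ?thesis .
  qed
  have "(\<integral>\<^sup>+i. ennreal (fdet k (\<lambda>m n. \<integral>z. c (i m) z * c (i n) z \<partial>N)) \<partial>(\<Pi>\<^sub>M i\<in>{..<k}. ?C)) =
    (\<integral>\<^sup>+z. ennreal (fdet k (\<lambda>m n. \<integral>i. c i (z m) * c i (z n) \<partial>?C)) \<partial>(\<Pi>\<^sub>M i\<in>{..<k}. N))"
    using square_integrable_square[OF c_sq] c_sum by (intro gram_det_duality C N c_meas) auto
  also have "\<dots> = (\<integral>\<^sup>+z. ennreal (fdet k (\<lambda>m n. \<integral>x. b x (z m) * b x (z n) \<partial>M)) \<partial>(\<Pi>\<^sub>M i\<in>{..<k}. N))"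
    by (intro nn_integral_cong arg_cong[of _ _ ennreal] fdet_cong c_parseval) (auto simp: space_PiM)
  also have "\<dots> = (\<integral>\<^sup>+x. ennreal (fdet k (\<lambda>i j. \<integral>z. b (x i) z * b (x j) z \<partial>N)) \<partial>(\<Pi>\<^sub>M i\<in>{..<k}. M))"
    by (intro gram_det_duality[symmetric] M N b bN bM)
  finally have main: "(\<integral>\<^sup>+i. ennreal (fdet k (\<lambda>m n. \<integral>z. c (i m) z * c (i n) z \<partial>N)) \<partial>(\<Pi>\<^sub>M i\<in>{..<k}. ?C)) = ennreal T"
    using T by simp
  show ?thesis
    unfolding matrix_element
  proof (rule has_sum_increasing_tuples[OF _ _ _ main T(2)])
    fix i :: "nat \<Rightarrow> nat"
    have A: "(\<integral>z. (fdet k (\<lambda>a b. c (i a) (z b)))\<^sup>2 \<partial>(\<Pi>\<^sub>M i\<in>{..<k}. N)) = fact k * fdet k (\<lambda>a b. \<integral>z. c (i a) z * c (i b) z \<partial>N)"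
      using square_integrable_mult[OF c_sq c_sq] by (intro andreief N) auto
    have "0 \<le> (fact k :: real) * fdet k (\<lambda>a b. \<integral>z. c (i a) z * c (i b) z \<partial>N)"
      unfolding A[symmetric] by simp
    then show "0 \<le> fdet k (\<lambda>m n. \<integral>z. c (i m) z * c (i n) z \<partial>N)"
      by (simp add: zero_le_mult_iff not_le[THEN iffD2, OF fact_gt_zero])
    show "fdet k (\<lambda>m n. \<integral>z. c (restrict (i \<circ> p) {..<k} m) z * c (restrict (i \<circ> p) {..<k} n) z \<partial>N) =
      fdet k (\<lambda>m n. \<integral>z. c (i m) z * c (i n) z \<partial>N)" if p: "p permutes {..<k}" for p
      by (subst fdet_permute[OF p, symmetric]) (intro fdet_cong, simp)
    show "fdet k (\<lambda>m n. \<integral>z. c (i m) z * c (i n) z \<partial>N) = 0" if i: "\<not> inj_on i {..<k}"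
    proof -
      obtain m n where "m < k" "n < k" "m \<noteq> n" "i m = i n" using i by (auto simp: inj_on_def)
      then show ?thesis by (intro fdet_identical_rows[of m k n]) auto
    qed
  qed
qed

section \<open>The Fourier transform on the line\<close>

text \<open>Sign and normalisation are those of characteristic functions, so Plancherel's identity
  carries the factor 2 pi.\<close>

definition fourier :: "(real \<Rightarrow> complex) \<Rightarrow> real \<Rightarrow> complex" where
  "fourier u t = (\<integral>x. iexp (t * x) * u x \<partial>lborel)"

lemma norm_iexp_mult [simp]: "norm (exp (\<i> * (complex_of_real s * complex_of_real t)) * z) = norm z"
  by (simp add: norm_mult norm_exp_eq_Re)

lemma cnj_measurable [measurable (raw)]:
  "f \<in> borel_measurable M \<Longrightarrow> (\<lambda>x. cnj (f x)) \<in> borel_measurable M"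
  by (rule measurable_compose[of f M borel]) (auto intro!: borel_measurable_continuous_onI continuous_intros)

lemma integrable_iexp_mult:
  assumes "integrable lborel u"
  shows "integrable lborel (\<lambda>x. iexp (t * x) * u x)"
  by (rule Bochner_Integration.integrable_bound[OF assms])
     (use borel_measurable_integrable[OF assms] in auto)

lemma fourier_measurable [measurable]:
  assumes [measurable]: "u \<in> borel_measurable borel"
  shows "fourier u \<in> borel_measurable borel"
  unfolding fourier_def
  by (intro sigma_finite_measure.borel_measurable_lebesgue_integral[OF sigma_finite_lborel]) measurable

lemma norm_fourier_le: "norm (fourier u t) \<le> (\<integral>x. norm (u x) \<partial>lborel)"
  unfolding fourier_def using integral_norm_bound[of lborel "\<lambda>x. iexp (t * x) * u x"] by simp

lemma fourier_multiplication_formula: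
  assumes u: "integrable lborel u" and v: "integrable lborel v"
  shows "(\<integral>x. u x * fourier v x \<partial>lborel) = (\<integral>t. fourier u t * v t \<partial>lborel)"
proof -
  note [measurable] = borel_measurable_integrable[OF u] borel_measurable_integrable[OF v]
  have "integrable (lborel \<Otimes>\<^sub>M lborel) (\<lambda>(x, t). u x * (iexp (x * t) * v t))"
  proof (rule lborel_pair.Fubini_integrable)
    show "integrable lborel (\<lambda>x. \<integral>t. norm (case (x, t) of (x, t) \<Rightarrow> u x * (iexp (x * t) * v t)) \<partial>lborel)"
      using u by (simp add: norm_mult)
    show "AE x in lborel. integrable lborel (\<lambda>t. case (x, t) of (x, t) \<Rightarrow> u x * (iexp (x * t) * v t))"
      using integrable_iexp_mult[OF v] by simp
  qed measurable
  from lborel_pair.Fubini_integral[OF this]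
  have "(\<integral>x. \<integral>t. u x * (iexp (x * t) * v t) \<partial>lborel \<partial>lborel) = (\<integral>t. \<integral>x. u x * (iexp (x * t) * v t) \<partial>lborel \<partial>lborel)"
    by simp
  then show ?thesis
    by (simp add: fourier_def mult_ac flip: integral_mult_left_zero integral_mult_right_zero)
qed

text \<open>Scaled from the characteristic function of the standard normal distribution; the
  transform is written as a density so that it can act as an approximate identity.\<close>

lemma gaussian_fourier:
  assumes "d > 0"
  shows "integrable lborel (\<lambda>x. complex_of_real (exp (- (d * x)\<^sup>2 / 2)))"
    and "fourier (\<lambda>x. complex_of_real (exp (- (d * x)\<^sup>2 / 2))) t = 2 * pi * normal_density 0 d t"
proof -
  have dens: "complex_of_real (exp (- (d * x)\<^sup>2 / 2)) = of_real (sqrt (2 * pi) / d) * of_real (normal_density 0 (1 / d) x)" for x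
  proof -
    have 1: "sqrt (2 * pi * (1 / d)\<^sup>2) = sqrt (2 * pi) / d"
      using assms by (simp add: real_sqrt_mult)
    have 2: "- (x - 0)\<^sup>2 / (2 * (1 / d)\<^sup>2) = - (d * x)\<^sup>2 / 2"
      using assms by (simp add: power_mult_distrib power_divide)
    have "exp (- (d * x)\<^sup>2 / 2) = sqrt (2 * pi) / d * normal_density 0 (1 / d) x"
      unfolding normal_density_def 1 2 using assms by simp
    then show ?thesis by (simp only: of_real_mult)
  qed
  have int: "integrable lborel (normal_density 0 (1 / d))"
    using assms by (intro integrable_normal_density) simp
  then show "integrable lborel (\<lambda>x. complex_of_real (exp (- (d * x)\<^sup>2 / 2)))"
    unfolding dens by (intro integrable_mult_right integrable_of_real)
  let ?g = "\<lambda>x. complex_of_real (exp (- x\<^sup>2 / 2))"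
  have "fourier (\<lambda>x. ?g (d * x)) t = (1 / d) * (\<integral>x. iexp ((t / d) * x) * ?g x \<partial>lborel)"
    unfolding fourier_def using assms
    by (subst lborel_integral_real_affine[where c = "1 / d" and t = 0]) (auto simp: scaleR_conv_of_real)
  also have "(\<integral>x. iexp ((t / d) * x) * ?g x \<partial>lborel) =
      sqrt (2 * pi) * (\<integral>x. std_normal_density x *\<^sub>R iexp ((t / d) * x) \<partial>lborel)"
    unfolding integral_mult_right_zero[symmetric]
    by (intro Bochner_Integration.integral_cong) (auto simp: std_normal_density_def scaleR_conv_of_real)
  also have "(\<integral>x. std_normal_density x *\<^sub>R iexp ((t / d) * x) \<partial>lborel) = char std_normal_distribution (t / d)"
    unfolding char_def by (subst integral_density) auto
  also have "char std_normal_distribution (t / d) = complex_of_real (exp (- (t / d)\<^sup>2 / 2))"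
    by (simp add: char_std_normal_distribution)
  finally have "fourier (\<lambda>x. ?g (d * x)) t = complex_of_real (sqrt (2 * pi) / d * exp (- (t / d)\<^sup>2 / 2))"
    by simp
  also have "sqrt (2 * pi) / d * exp (- (t / d)\<^sup>2 / 2) = 2 * pi * normal_density 0 d t"
  proof -
    have 1: "sqrt (2 * pi * d\<^sup>2) = sqrt (2 * pi) * d" using assms by (simp add: real_sqrt_mult)
    have "2 * pi / sqrt (2 * pi) = sqrt (2 * pi)" by (rule real_div_sqrt) simp
    then have 2: "sqrt (2 * pi) / d = 2 * pi / sqrt (2 * pi * d\<^sup>2)"
      unfolding 1 by (metis divide_divide_eq_left)
    have 3: "- (t - 0)\<^sup>2 / (2 * d\<^sup>2) = - (t / d)\<^sup>2 / 2" by (simp add: power_divide)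
    show ?thesis unfolding normal_density_def 2 3 by simp
  qed
  finally show "fourier (\<lambda>x. ?g (d * x)) t = 2 * pi * normal_density 0 d t" .
qed


lemma gaussian_bound_integrable:
  assumes "a > 0"
  shows "integrable lborel (\<lambda>x. C * exp (- a * x\<^sup>2) :: real)"
proof -
  define d where "d = sqrt (2 * a)"
  have d: "d > 0" "d\<^sup>2 = 2 * a" using assms by (auto simp: d_def)
  have *: "(\<lambda>x. C * exp (- a * x\<^sup>2)) = (\<lambda>x. C * Re (complex_of_real (exp (- (d * x)\<^sup>2 / 2))))"
    by (simp add: power_mult_distrib d(2))
  show ?thesis
    unfolding * by (intro integrable_mult_right integrable_Re gaussian_fourier(1)[OF d(1)])
qed

text \<open>The Gaussian weight makes the left side integrable before square-integrability of the
  transforms is known. Under the multiplication formula it becomes a normal density of width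
  \<open>d\<close>, which smooths \<open>g2\<close>.\<close>

lemma plancherel_regularized:
  fixes g1 g2 :: "real \<Rightarrow> complex"
  assumes g1: "integrable lborel g1" and g2: "integrable lborel g2" and d: "d > 0"
  shows "(\<integral>x. complex_of_real (exp (- (d * x)\<^sup>2 / 2)) * (fourier g1 x * cnj (fourier g2 x)) \<partial>lborel) =
    2 * pi * (\<integral>t. g1 t * (\<integral>v. std_normal_density v * cnj (g2 (t - d * v)) \<partial>lborel) \<partial>lborel)"
proof -
  define w where "w = (\<lambda>x. complex_of_real (exp (- (d * x)\<^sup>2 / 2)))"
  \<comment> \<open>Reflected and conjugated, so that its transform is the conjugate of that of
    \<open>g2\<close>.\<close>
  define k where "k = (\<lambda>s. cnj (g2 (- s)))"
  note [measurable] = borel_measurable_integrable[OF g1] borel_measurable_integrable[OF g2]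
  have w: "integrable lborel w" unfolding w_def by (rule gaussian_fourier(1)[OF d])
  note [measurable] = borel_measurable_integrable[OF w]
  have "integrable lborel (\<lambda>s. g2 (- s))"
    using lborel_integrable_real_affine[OF g2, of "-1" 0] by simp
  then have k: "integrable lborel k" unfolding k_def by simp
  note [measurable] = borel_measurable_integrable[OF k]
  have cnj_g2: "cnj (fourier g2 x) = fourier k x" for x
  proof -
    have "cnj (fourier g2 x) = (\<integral>s. iexp (- (x * s)) * cnj (g2 s) \<partial>lborel)"
      unfolding fourier_def Bochner_Integration.integral_cnj[symmetric] by (simp add: exp_cnj)
    also have "\<dots> = fourier k x"
      unfolding fourier_def k_def by (subst lborel_integral_real_affine[where c = "-1" and t = 0]) auto
    finally show ?thesis .
  qed
  define h where "h = (\<lambda>x. w x * fourier k x)"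
  have h: "integrable lborel h"
  proof (rule Bochner_Integration.integrable_bound)
    show "integrable lborel (\<lambda>x. (\<integral>s. norm (k s) \<partial>lborel) * norm (w x))"
      using w by simp
    have bnd: "norm (h x) \<le> (\<integral>s. norm (k s) \<partial>lborel) * norm (w x)" for x
      using norm_fourier_le[of k x] by (simp add: h_def norm_mult mult.commute mult_left_mono)
    show "AE x in lborel. norm (h x) \<le> norm ((\<integral>s. norm (k s) \<partial>lborel) * norm (w x))"
      by (intro AE_I2 order_trans[OF bnd]) simp
    show "h \<in> borel_measurable lborel" unfolding h_def by measurable
  qed
  have fh: "fourier h t = 2 * pi * (\<integral>v. std_normal_density v * cnj (g2 (t - d * v)) \<partial>lborel)" for t
  proof -
    have wt: "integrable lborel (\<lambda>x. iexp (t * x) * w x)" by (rule integrable_iexp_mult[OF w])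
    have "fourier h t = (\<integral>x. (iexp (t * x) * w x) * fourier k x \<partial>lborel)"
      unfolding fourier_def[of h t] by (simp add: h_def mult_ac)
    also have "\<dots> = (\<integral>s. fourier (\<lambda>x. iexp (t * x) * w x) s * k s \<partial>lborel)"
      by (rule fourier_multiplication_formula[OF wt k])
    also have "\<dots> = (\<integral>s. fourier w (t + s) * k s \<partial>lborel)"
      unfolding fourier_def by (simp add: distrib_right distrib_left exp_add mult_ac)
    also have "\<dots> = (\<integral>s. complex_of_real (2 * pi * normal_density 0 d (t + s)) * k s \<partial>lborel)"
      unfolding w_def gaussian_fourier(2)[OF d] by simp
    also have "\<dots> = 2 * pi * (\<integral>s. normal_density 0 d (t + s) * k s \<partial>lborel)"
      unfolding integral_mult_right_zero[symmetric] by (simp add: mult.assoc)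
    also have "(\<integral>s. normal_density 0 d (t + s) * k s \<partial>lborel) = (\<integral>v. std_normal_density v * cnj (g2 (t - d * v)) \<partial>lborel)"
    proof -
      have "d * normal_density 0 d (d * v) = std_normal_density v" for v
        using d by (simp add: normal_density_def real_sqrt_mult power_mult_distrib)
      then have dens: "complex_of_real d * complex_of_real (normal_density 0 d (d * v)) = std_normal_density v" for v
        by (simp only: of_real_mult[symmetric])
      have "(\<integral>s. normal_density 0 d (t + s) * k s \<partial>lborel) =
          d * (\<integral>v. normal_density 0 d (d * v) * cnj (g2 (t - d * v)) \<partial>lborel)"
        using d by (subst lborel_integral_real_affine[where c = d and t = "- t"]) (auto simp: k_def scaleR_conv_of_real)
      also have "\<dots> = (\<integral>v. std_normal_density v * cnj (g2 (t - d * v)) \<partial>lborel)"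
        unfolding integral_mult_right_zero[symmetric] mult.assoc[symmetric] dens ..
      finally show ?thesis .
    qed
    finally show ?thesis .
  qed
  have "(\<integral>x. complex_of_real (exp (- (d * x)\<^sup>2 / 2)) * (fourier g1 x * cnj (fourier g2 x)) \<partial>lborel) = (\<integral>x. h x * fourier g1 x \<partial>lborel)"
    unfolding cnj_g2 h_def w_def by (simp add: mult_ac)
  also have "\<dots> = (\<integral>t. fourier h t * g1 t \<partial>lborel)"
    by (rule fourier_multiplication_formula[OF h g1])
  also have "\<dots> = 2 * pi * (\<integral>t. g1 t * (\<integral>v. std_normal_density v * cnj (g2 (t - d * v)) \<partial>lborel) \<partial>lborel)"
    unfolding fh integral_mult_right_zero[symmetric] by (simp add: mult_ac)
  finally show ?thesis .
qed

text \<open>The width \<open>d\<close> tends to 0 in the regularised identity. With equal arguments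
  Fatou's lemma first gives square-integrability of each transform; then dominated convergence
  removes the weight.\<close>

lemma plancherel:
  fixes g1 g2 :: "real \<Rightarrow> complex"
  assumes g: "continuous_on UNIV g1" "continuous_on UNIV g2" and a: "a > 0"
    and bound: "\<And>t. norm (g1 t) \<le> C * exp (- a * t\<^sup>2)" "\<And>t. norm (g2 t) \<le> C * exp (- a * t\<^sup>2)"
  shows "integrable lborel (\<lambda>x. fourier g1 x * cnj (fourier g2 x))"
    and "(\<integral>x. fourier g1 x * cnj (fourier g2 x) \<partial>lborel) = 2 * pi * (\<integral>t. g1 t * cnj (g2 t) \<partial>lborel)"
proof -
  define d where "d = (\<lambda>n :: nat. 1 / real (Suc n))"
  have d: "d n > 0" for n by (simp add: d_def)
  have d_lim: "d \<longlonglongrightarrow> 0" unfolding d_def using LIMSEQ_inverse_real_of_nat by (simp add: inverse_eq_divide)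
  define w where "w = (\<lambda>n x. exp (- (d n * x)\<^sup>2 / 2))"
  have w_le: "0 \<le> w n x" "w n x \<le> 1" for n x by (auto simp: w_def)
  have w_lim: "(\<lambda>n. w n x) \<longlonglongrightarrow> 1" for x
  proof -
    have "(\<lambda>n. w n x) \<longlonglongrightarrow> exp (- (0 * x)\<^sup>2 / 2)"
      unfolding w_def by (intro tendsto_intros d_lim) simp
    then show ?thesis by simp
  qed
  have w_int: "integrable lborel (w n)" for n
    using integrable_Re[OF gaussian_fourier(1)[OF d, of n]] by (simp add: w_def)
  have [measurable]: "w n \<in> borel_measurable borel" for n using borel_measurable_integrable[OF w_int] by simp
  define good where "good = (\<lambda>g :: real \<Rightarrow> complex. continuous_on UNIV g \<and> (\<forall>t. norm (g t) \<le> C * exp (- a * t\<^sup>2)))"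
  have good_meas: "g \<in> borel_measurable borel" if "good g" for g
    using that by (auto simp: good_def intro: borel_measurable_continuous_onI)
  have good_int: "integrable lborel g" if "good g" for g
    by (rule Bochner_Integration.integrable_bound[OF gaussian_bound_integrable[OF a, of C]])
       (use that good_meas[OF that] in \<open>auto simp: good_def intro!: AE_I2 order_trans[OF _ abs_ge_self]\<close>)
  have good_le: "norm (g t) \<le> C" if "good g" for g t
  proof -
    have *: "norm (g t) \<le> C * exp (- a * t\<^sup>2)" using that by (auto simp: good_def)
    then have "0 \<le> C * exp (- a * t\<^sup>2)" by (rule order_trans[OF norm_ge_zero])
    then have "0 \<le> C" by (simp add: zero_le_mult_iff)
    then have "C * exp (- a * t\<^sup>2) \<le> C * 1" using a by (intro mult_left_mono) auto
    with * show ?thesis by simp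
  qed
  have std_int: "integrable lborel std_normal_density" by (rule integrable_normal_density) simp
  have lim: "(\<lambda>n. \<integral>x. complex_of_real (w n x) * (fourier g x * cnj (fourier h x)) \<partial>lborel)
      \<longlonglongrightarrow> 2 * pi * (\<integral>t. g t * cnj (h t) \<partial>lborel)" if g: "good g" and h: "good h" for g h
  proof -
    note [measurable] = good_meas[OF g] good_meas[OF h]
    define J where "J = (\<lambda>n t. \<integral>v. std_normal_density v * cnj (h (t - d n * v)) \<partial>lborel)"
    have [measurable]: "J n \<in> borel_measurable borel" for n
      unfolding J_def by (intro sigma_finite_measure.borel_measurable_lebesgue_integral[OF sigma_finite_lborel]) measurable
    have bnd: "norm (std_normal_density v * cnj (h s)) \<le> C * std_normal_density v" for v s
      using good_le[OF h, of s] by (simp add: norm_mult mult.commute[of C] mult_left_mono)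
    have J_int: "integrable lborel (\<lambda>v. std_normal_density v * cnj (h (t - d n * v)))" for n t
      by (rule Bochner_Integration.integrable_bound[of _ "\<lambda>v. C * std_normal_density v"])
         (use std_int in \<open>auto intro!: AE_I2 order_trans[OF bnd abs_ge_self] simp del: norm_mult\<close>)
    have J_le: "norm (J n t) \<le> C" for n t
    proof -
      have "norm (J n t) \<le> (\<integral>v. norm (std_normal_density v * cnj (h (t - d n * v))) \<partial>lborel)"
        unfolding J_def by (rule integral_norm_bound)
      also have "\<dots> \<le> (\<integral>v. C * std_normal_density v \<partial>lborel)"
        using J_int std_int bnd by (intro integral_mono integrable_norm integrable_mult_right) auto
      also have "\<dots> = C" by simp
      finally show ?thesis .
    qed
    have J_lim: "(\<lambda>n. J n t) \<longlonglongrightarrow> cnj (h t)" for t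
    proof -
      have "(\<lambda>n. J n t) \<longlonglongrightarrow> (\<integral>v. std_normal_density v * cnj (h t) \<partial>lborel)"
        unfolding J_def
      proof (rule integral_dominated_convergence[where w = "\<lambda>v. C * std_normal_density v"])
        show "AE v in lborel. (\<lambda>n. std_normal_density v * cnj (h (t - d n * v))) \<longlonglongrightarrow> std_normal_density v * cnj (h t)"
        proof (intro AE_I2)
          fix v :: real
          have "(\<lambda>n. t - d n * v) \<longlonglongrightarrow> t - 0 * v" by (intro tendsto_intros d_lim)
          then have "(\<lambda>n. h (t - d n * v)) \<longlonglongrightarrow> h t"
            using h by (auto simp: good_def continuous_on_eq_continuous_at intro: isCont_tendsto_compose[of t h])
          then show "(\<lambda>n. std_normal_density v * cnj (h (t - d n * v))) \<longlonglongrightarrow> std_normal_density v * cnj (h t)"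
            by (intro tendsto_intros)
        qed
        show "integrable lborel (\<lambda>v. C * std_normal_density v)" using std_int by simp
        show "AE v in lborel. norm (std_normal_density v * cnj (h (t - d n * v))) \<le> C * std_normal_density v" for n
          using bnd by (intro AE_I2)
      qed measurable
      moreover have "(\<integral>v. std_normal_density v * cnj (h t) \<partial>lborel) = cnj (h t)"
        by (simp add: integral_complex_of_real)
      ultimately show ?thesis by (simp only:)
    qed
    have "(\<lambda>n. \<integral>t. g t * J n t \<partial>lborel) \<longlonglongrightarrow> (\<integral>t. g t * cnj (h t) \<partial>lborel)"
    proof (rule integral_dominated_convergence[where w = "\<lambda>t. C * norm (g t)"])
      show "integrable lborel (\<lambda>t. C * norm (g t))" using good_int[OF g] by simp
      show "AE t in lborel. (\<lambda>n. g t * J n t) \<longlonglongrightarrow> g t * cnj (h t)"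
        by (intro AE_I2 tendsto_intros J_lim)
      show "AE t in lborel. norm (g t * J n t) \<le> C * norm (g t)" for n
        using J_le by (intro AE_I2) (simp add: norm_mult mult.commute[of C] mult_left_mono)
    qed measurable
    then have "(\<lambda>n. 2 * pi * (\<integral>t. g t * J n t \<partial>lborel)) \<longlonglongrightarrow> 2 * pi * (\<integral>t. g t * cnj (h t) \<partial>lborel)"
      by (intro tendsto_intros)
    then show ?thesis
      unfolding w_def J_def plancherel_regularized[OF good_int[OF g] good_int[OF h] d] .
  qed
  have L2: "integrable lborel (\<lambda>x. (norm (fourier g x))\<^sup>2)" if g: "good g" for g
  proof -
    note [measurable] = good_meas[OF g]
    define L where "L = Re (2 * pi * (\<integral>t. g t * cnj (g t) \<partial>lborel))"
    define B where "B = (\<integral>t. norm (g t) \<partial>lborel)"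
    have int: "integrable lborel (\<lambda>x. complex_of_real (w n x) * (fourier g x * cnj (fourier g x)))" for n
    proof (rule Bochner_Integration.integrable_bound)
      show "integrable lborel (\<lambda>x. B\<^sup>2 * w n x)" using w_int by simp
      have bnd: "norm (complex_of_real (w n x) * (fourier g x * cnj (fourier g x))) \<le> B\<^sup>2 * w n x" for x
      proof -
        have "norm (fourier g x) * norm (fourier g x) \<le> B * B"
          using norm_fourier_le[of g x] by (intro mult_mono) (auto simp: B_def)
        then show ?thesis using w_le[of n x]
          by (simp add: norm_mult power2_eq_square mult.commute[of _ "w n x"] mult_left_mono)
      qed
      show "AE x in lborel. norm (complex_of_real (w n x) * (fourier g x * cnj (fourier g x))) \<le> norm (B\<^sup>2 * w n x)"
        by (intro AE_I2 order_trans[OF bnd]) simp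
    qed measurable
    have Re_eq: "Re (complex_of_real (w n x) * (fourier g x * cnj (fourier g x))) = w n x * (norm (fourier g x))\<^sup>2" for n x
      by (simp only: complex_norm_square[symmetric] of_real_mult[symmetric] Re_complex_of_real)
    have lim': "(\<lambda>n. \<integral>x. w n x * (norm (fourier g x))\<^sup>2 \<partial>lborel) \<longlonglongrightarrow> L"
      using tendsto_Re[OF lim[OF g g]] unfolding integral_Re[OF int, symmetric] Re_eq L_def .
    have int': "integrable lborel (\<lambda>x. w n x * (norm (fourier g x))\<^sup>2)" for n
      using integrable_Re[OF int[of n]] unfolding Re_eq .
    have "(\<integral>\<^sup>+x. ennreal ((norm (fourier g x))\<^sup>2) \<partial>lborel) =
        (\<integral>\<^sup>+x. liminf (\<lambda>n. ennreal (w n x * (norm (fourier g x))\<^sup>2)) \<partial>lborel)"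
    proof (rule nn_integral_cong)
      fix x
      have "(\<lambda>n. ennreal (w n x * (norm (fourier g x))\<^sup>2)) \<longlonglongrightarrow> ennreal (1 * (norm (fourier g x))\<^sup>2)"
        by (intro tendsto_ennrealI tendsto_intros w_lim)
      then show "ennreal ((norm (fourier g x))\<^sup>2) = liminf (\<lambda>n. ennreal (w n x * (norm (fourier g x))\<^sup>2))"
        by (intro lim_imp_Liminf[symmetric]) auto
    qed
    also have "\<dots> \<le> liminf (\<lambda>n. \<integral>\<^sup>+x. ennreal (w n x * (norm (fourier g x))\<^sup>2) \<partial>lborel)"
      by (intro nn_integral_liminf) measurable
    also have "(\<lambda>n. \<integral>\<^sup>+x. ennreal (w n x * (norm (fourier g x))\<^sup>2) \<partial>lborel) =
        (\<lambda>n. ennreal (\<integral>x. w n x * (norm (fourier g x))\<^sup>2 \<partial>lborel))"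
      using int' w_le by (intro ext nn_integral_eq_integral) auto
    also have "liminf \<dots> = ennreal L"
      using lim' by (intro lim_imp_Liminf tendsto_ennrealI) auto
    also have "ennreal L < \<infinity>" by simp
    finally have "(\<integral>\<^sup>+x. ennreal ((norm (fourier g x))\<^sup>2) \<partial>lborel) < \<infinity>" .
    then show ?thesis by (intro integrableI_bounded) auto
  qed
  have G: "good g1" "good g2" using g bound by (auto simp: good_def)
  note [measurable] = good_meas[OF G(1)] good_meas[OF G(2)]
  have "integrable lborel (\<lambda>x. norm (fourier g1 x) * norm (fourier g2 x))"
    using L2[OF G(1)] L2[OF G(2)] by (intro integrable_mult_of_squares) auto
  then show int: "integrable lborel (\<lambda>x. fourier g1 x * cnj (fourier g2 x))"
    by (rule Bochner_Integration.integrable_bound) (auto simp: norm_mult)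
  have "(\<lambda>n. \<integral>x. complex_of_real (w n x) * (fourier g1 x * cnj (fourier g2 x)) \<partial>lborel)
      \<longlonglongrightarrow> (\<integral>x. fourier g1 x * cnj (fourier g2 x) \<partial>lborel)"
  proof (rule integral_dominated_convergence[where w = "\<lambda>x. norm (fourier g1 x * cnj (fourier g2 x))"])
    show "AE x in lborel. (\<lambda>n. complex_of_real (w n x) * (fourier g1 x * cnj (fourier g2 x))) \<longlonglongrightarrow> fourier g1 x * cnj (fourier g2 x)"
    proof (intro AE_I2)
      fix x
      have "(\<lambda>n. complex_of_real (w n x) * (fourier g1 x * cnj (fourier g2 x))) \<longlonglongrightarrow>
          complex_of_real 1 * (fourier g1 x * cnj (fourier g2 x))"
        by (intro tendsto_intros w_lim)
      then show "(\<lambda>n. complex_of_real (w n x) * (fourier g1 x * cnj (fourier g2 x))) \<longlonglongrightarrow> fourier g1 x * cnj (fourier g2 x)"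
        by simp
    qed
    show "AE x in lborel. norm (complex_of_real (w n x) * (fourier g1 x * cnj (fourier g2 x))) \<le> norm (fourier g1 x * cnj (fourier g2 x))" for n
      using w_le[of n] by (intro AE_I2) (simp add: norm_mult mult_left_le_one_le)
  qed (use int in auto)
  then show "(\<integral>x. fourier g1 x * cnj (fourier g2 x) \<partial>lborel) = 2 * pi * (\<integral>t. g1 t * cnj (g2 t) \<partial>lborel)"
    by (rule LIMSEQ_unique[OF _ lim[OF G]])
qed

section \<open>The Airy function and the heat kernel\<close>

definition airy_integrand :: "real \<Rightarrow> complex \<Rightarrow> complex" where
  "airy_integrand x z = exp (\<i> * (z ^ 3 / 3 + of_real x * z))"

text \<open>The factor of the integrand on the line of imaginary part \<open>a\<close> that does not
  depend on \<open>x\<close>. For positive \<open>a\<close> its modulus is Gaussian, whereas on the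
  real axis there is no decay at all.\<close>

definition airy_symbol :: "real \<Rightarrow> real \<Rightarrow> complex" where
  "airy_symbol a t = exp (\<i> * (Complex t a) ^ 3 / 3)"

lemma norm_airy_symbol: "norm (airy_symbol a t) = exp (a ^ 3 / 3) * exp (- a * t\<^sup>2)"
proof -
  have "Im ((Complex t a) ^ 3) = 3 * (a * t\<^sup>2) - a ^ 3"
    by (simp add: power3_eq_cube power2_eq_square algebra_simps)
  then have "Re (\<i> * (Complex t a) ^ 3 / 3) = a ^ 3 / 3 - a * t\<^sup>2"
    by (simp add: diff_divide_distrib)
  then show ?thesis unfolding airy_symbol_def norm_exp_eq_Re exp_add[symmetric] by simp
qed

lemma continuous_airy_symbol: "continuous_on UNIV (airy_symbol a)"
  unfolding airy_symbol_def Complex_eq by (intro continuous_intros) simp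

lemma airy_integrand_shifted:
  "airy_integrand x (Complex t a) = complex_of_real (exp (- a * x)) * (iexp (x * t) * airy_symbol a t)"
proof -
  have "\<i> * ((Complex t a) ^ 3 / 3 + of_real x * Complex t a) =
      of_real (- a * x) + \<i> * of_real (x * t) + \<i> * (Complex t a) ^ 3 / 3"
    by (simp add: complex_eq_iff algebra_simps)
  then show ?thesis
    by (simp only: airy_integrand_def airy_symbol_def exp_add exp_of_real mult.assoc)
qed

lemma norm_airy_integrand_shifted:
  "norm (airy_integrand x (Complex t a)) = exp (a ^ 3 / 3 - a * x - a * t\<^sup>2)"
proof -
  have "norm (airy_integrand x (Complex t a)) = exp (- a * x) * (exp (a ^ 3 / 3) * exp (- a * t\<^sup>2))"
    unfolding airy_integrand_shifted by (simp add: norm_mult norm_airy_symbol)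
  also have "\<dots> = exp (- a * x + (a ^ 3 / 3 + - a * t\<^sup>2))" by (simp only: exp_add)
  finally show ?thesis by (simp add: algebra_simps)
qed

lemma integrable_airy_symbol: "a > 0 \<Longrightarrow> integrable lborel (airy_symbol a)"
  by (rule Bochner_Integration.integrable_bound[OF gaussian_bound_integrable[of a "exp (a ^ 3 / 3)"]])
     (auto simp: norm_airy_symbol intro: borel_measurable_continuous_onI continuous_airy_symbol)

lemma integrable_airy_integrand_shifted:
  assumes "a > 0"
  shows "integrable lborel (\<lambda>t. airy_integrand x (Complex t a))"
  unfolding airy_integrand_shifted
  by (intro integrable_mult_right integrable_iexp_mult integrable_airy_symbol assms)

text \<open>Integrating over the rectangle with corners \<open>0\<close>, \<open>T\<close>, \<open>T + \<i>a\<close>, \<open>\<i>a\<close>: the left side is purely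
  imaginary and the right side vanishes as \<open>T \<rightarrow> \<infinity>\<close>.\<close>

lemma airy_contour_shift:
  assumes a: "a > 0" and T: "T > 0"
  shows "(\<lambda>t. cos (t ^ 3 / 3 + x * t)) integrable_on {0..T}"
    and "\<bar>integral {0..T} (\<lambda>t. cos (t ^ 3 / 3 + x * t)) -
      Re (integral {0..T} (\<lambda>t. airy_integrand x (Complex t a)))\<bar> \<le> exp (a ^ 3 / 3 + \<bar>x\<bar> * a) / T\<^sup>2"
proof -
  have "airy_integrand x holomorphic_on UNIV" unfolding airy_integrand_def by (intro holomorphic_intros) auto
  \<comment> \<open>An entire integrand has a global primitive, so the integrals over the four sides
    are differences of \<open>G\<close> and Cauchy's theorem becomes a telescoping sum.\<close>
  then obtain G where G: "\<And>z. (G has_field_derivative airy_integrand x z) (at z)"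
    using holomorphic_convex_primitive'[of UNIV "airy_integrand x"] by auto
  have cont: "continuous_on UNIV (airy_integrand x)"
    unfolding airy_integrand_def by (intro continuous_intros) auto
  have seg: "((\<lambda>t. c * airy_integrand x (p + of_real t * c)) has_integral (G (p + of_real S * c) - G p)) {0..S}"
    if "S > 0" for S :: real and p c :: complex
  proof -
    have "((\<lambda>t. c * airy_integrand x (p + of_real t * c)) has_integral
        (G (p + of_real S * c) - G (p + of_real 0 * c))) {0..S}"
    proof (rule fundamental_theorem_of_calculus)
      fix t assume "t \<in> {0..S}"
      have "((\<lambda>t. p + of_real t * c) has_vector_derivative c) (at t within {0..S})"
        by (auto intro!: derivative_eq_intros simp: has_vector_derivative_def scaleR_conv_of_real mult.commute)
      from field_vector_diff_chain_within[OF this has_field_derivative_at_within[OF G]]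
      show "((\<lambda>t. G (p + of_real t * c)) has_vector_derivative c * airy_integrand x (p + of_real t * c)) (at t within {0..S})"
        by (simp add: o_def)
    qed (use that in simp)
    then show ?thesis by simp
  qed
  have bottom: "((\<lambda>t. airy_integrand x (of_real t)) has_integral (G (of_real T) - G 0)) {0..T}"
    using seg[OF T, of 1 0] by simp
  have top: "((\<lambda>t. airy_integrand x (Complex t a)) has_integral (G (Complex T a) - G (Complex 0 a))) {0..T}"
    using seg[OF T, of 1 "Complex 0 a"] by (simp add: Complex_eq add.commute)
  have left: "((\<lambda>y. \<i> * airy_integrand x (Complex 0 y)) has_integral (G (Complex 0 a) - G 0)) {0..a}"
    using seg[OF a, of \<i> 0] by (simp add: Complex_eq mult.commute)
  have right: "((\<lambda>y. \<i> * airy_integrand x (Complex T y)) has_integral (G (Complex T a) - G (of_real T))) {0..a}"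
    using seg[OF a, of \<i> "of_real T"] by (simp add: Complex_eq mult.commute)
  have cos_eq: "Re (airy_integrand x (of_real t)) = cos (t ^ 3 / 3 + x * t)" for t
  proof -
    have "airy_integrand x (of_real t) = iexp (t ^ 3 / 3 + x * t)" by (simp add: airy_integrand_def)
    then show ?thesis by (simp only: cis_conv_exp[symmetric] cis.sel)
  qed
  have cos_int: "((\<lambda>t. cos (t ^ 3 / 3 + x * t)) has_integral Re (G (of_real T) - G 0)) {0..T}"
    using has_integral_Re[OF bottom] by (simp only: cos_eq)
  then show "(\<lambda>t. cos (t ^ 3 / 3 + x * t)) integrable_on {0..T}" by blast
  have left_re: "Re (G (Complex 0 a) - G 0) = 0"
  proof -
    have "Re (\<i> * airy_integrand x (Complex 0 y)) = 0" for y
    proof -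
      have "\<i> * (Complex 0 y ^ 3 / 3 + of_real x * Complex 0 y) = of_real (y ^ 3 / 3 - x * y)"
        by (simp add: complex_eq_iff power3_eq_cube)
      then have "airy_integrand x (Complex 0 y) = of_real (exp (y ^ 3 / 3 - x * y))"
        by (simp only: airy_integrand_def exp_of_real)
      then show ?thesis by simp
    qed
    with has_integral_Re[OF left] have "((\<lambda>y. 0) has_integral Re (G (Complex 0 a) - G 0)) {0..a}" by simp
    then show ?thesis using has_integral_unique has_integral_0 by blast
  qed
  have "norm (G (Complex T a) - G (of_real T)) \<le> exp (a ^ 3 / 3 + \<bar>x\<bar> * a) / T\<^sup>2"
  proof -
    define C where "C = exp (a ^ 3 / 3 + \<bar>x\<bar> * a)"
    \<comment> \<open>On the right side the modulus is at most
      \<open>C * exp (- T\<^sup>2 * y)\<close>, whose integral over \<open>y\<close> is at most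
      \<open>C / T\<^sup>2\<close>.\<close>
    have exp_int: "((\<lambda>y. C * exp (- T\<^sup>2 * y)) has_integral (C * (- exp (- T\<^sup>2 * a) / T\<^sup>2) - C * (- exp (- T\<^sup>2 * 0) / T\<^sup>2))) {0..a}"
      using a T by (intro fundamental_theorem_of_calculus)
        (auto intro!: derivative_eq_intros simp: power2_eq_square simp flip: has_real_derivative_iff_has_vector_derivative)
    have "norm (G (Complex T a) - G (of_real T)) \<le> C * (- exp (- T\<^sup>2 * a) / T\<^sup>2) - C * (- exp (- T\<^sup>2 * 0) / T\<^sup>2)"
      unfolding integral_unique[OF right, symmetric] integral_unique[OF exp_int, symmetric]
    proof (rule integral_norm_bound_integral[OF has_integral_integrable[OF right] has_integral_integrable[OF exp_int]])
      fix y assume y: "y \<in> {0..a}"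
      have "y ^ 3 \<le> a ^ 3" using y by (intro power_mono) auto
      moreover have "- y * x \<le> \<bar>x\<bar> * a"
      proof -
        have "- y * x \<le> y * \<bar>x\<bar>" using y by (simp add: abs_if mult_left_mono)
        also have "\<dots> \<le> a * \<bar>x\<bar>" using y by (intro mult_right_mono) auto
        finally show ?thesis by (simp add: mult.commute)
      qed
      ultimately have "y ^ 3 / 3 - y * x - y * T\<^sup>2 \<le> (a ^ 3 / 3 + \<bar>x\<bar> * a) + (- T\<^sup>2 * y)" by (simp add: mult.commute)
      then show "norm (\<i> * airy_integrand x (Complex T y)) \<le> C * exp (- T\<^sup>2 * y)"
        unfolding C_def exp_add[symmetric] by (simp add: norm_mult norm_airy_integrand_shifted)
    qed
    also have "\<dots> \<le> C / T\<^sup>2" by (simp add: C_def)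
    finally show ?thesis by (simp add: C_def)
  qed
  then have "\<bar>Re (G (Complex T a) - G (of_real T))\<bar> \<le> exp (a ^ 3 / 3 + \<bar>x\<bar> * a) / T\<^sup>2"
    using abs_Re_le_cmod order_trans by blast
  moreover have "integral {0..T} (\<lambda>t. cos (t ^ 3 / 3 + x * t)) = Re (G (of_real T) - G 0)"
    using cos_int by (rule integral_unique)
  moreover have "integral {0..T} (\<lambda>t. airy_integrand x (Complex t a)) = G (Complex T a) - G (Complex 0 a)"
    using top by (rule integral_unique)
  ultimately show "\<bar>integral {0..T} (\<lambda>t. cos (t ^ 3 / 3 + x * t)) -
      Re (integral {0..T} (\<lambda>t. airy_integrand x (Complex t a)))\<bar> \<le> exp (a ^ 3 / 3 + \<bar>x\<bar> * a) / T\<^sup>2"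
    using left_re by simp
qed

text \<open>Links the integral over \<open>{0..}\<close> in the definition of \<open>Ai\<close> to
  the integrals over \<open>{0..T}\<close>, which the contour shift controls.\<close>

lemma has_integral_improper_Ici:
  fixes f :: "real \<Rightarrow> real"
  assumes int: "\<And>T. T > 0 \<Longrightarrow> f integrable_on {0..T}"
    and lim: "((\<lambda>T. integral {0..T} f) \<longlongrightarrow> L) at_top"
  shows "(f has_integral L) {0..}"
  unfolding has_integral_alt'
proof (intro conjI allI impI)
  fix p q :: real
  show "(\<lambda>x. if x \<in> {0..} then f x else 0) integrable_on cbox p q"
  proof -
    have "f integrable_on {0..\<bar>q\<bar> + 1}" by (rule int) simp
    then have "f integrable_on {max p 0..q}" by (rule integrable_on_subinterval) auto
    moreover have "{max p 0..q} = {0..} \<inter> {p..q}" by auto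
    ultimately show ?thesis unfolding integrable_restrict_Int by (simp only: interval_cbox)
  qed
next
  fix e :: real assume "e > 0"
  then have "\<forall>\<^sub>F T in at_top. dist (integral {0..T} f) L < e" using lim by (simp add: tendsto_iff)
  then obtain B where B: "\<And>T. T \<ge> B \<Longrightarrow> dist (integral {0..T} f) L < e" by (auto simp: eventually_at_top_linorder)
  show "\<exists>B>0. \<forall>a b. ball 0 B \<subseteq> cbox a b \<longrightarrow> norm (integral (cbox a b) (\<lambda>x. if x \<in> {0..} then f x else 0) - L) < e"
  \<comment> \<open>A box containing this ball contains 0 and \<open>max B 1\<close>, so it starts
    at or left of 0 and ends at or beyond \<open>B\<close>.\<close>
  proof (intro exI[of _ "max B 1 + 1"] conjI allI impI)
    fix p q :: real assume sub: "ball 0 (max B 1 + 1) \<subseteq> cbox p q"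
    have "0 \<in> ball (0::real) (max B 1 + 1)" "max B 1 \<in> ball (0::real) (max B 1 + 1)" by (auto simp: dist_real_def)
    then have "0 \<in> cbox p q" "max B 1 \<in> cbox p q" using sub by blast+
    then have pq: "p \<le> 0" "B \<le> q" by auto
    have "integral {p..q} (\<lambda>x. if x \<in> {0..} then f x else 0) = integral {0..q} f"
    proof -
      have "integral {p..q} (\<lambda>x. if x \<in> {0..} then f x else 0) = integral ({0..} \<inter> {p..q}) f"
        by (rule integral_restrict_Int)
      also have "{0..} \<inter> {p..q} = {0..q}" using pq by auto
      finally show ?thesis .
    qed
    then show "norm (integral (cbox p q) (\<lambda>x. if x \<in> {0..} then f x else 0) - L) < e"
      using B[OF pq(2)] by (simp add: dist_real_def)
  qed auto
qed


text \<open>Letting \<open>T\<close> tend to infinity in the contour shift gives a half-line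
  integral on the shifted line. There the values at \<open>- t\<close> and \<open>t\<close> are
  conjugate, so the real part is even and the imaginary part integrates to zero, which extends the
  half-line to the whole line.\<close>

lemma Ai_fourier:
  assumes a: "a > 0"
  shows "complex_of_real (exp (a * x) * Ai x) = 1 / (2 * pi) * fourier (airy_symbol a) x"
proof -
  let ?F = "\<lambda>t. airy_integrand x (Complex t a)"
  let ?c = "\<lambda>t. cos (t ^ 3 / 3 + x * t)"
  have int: "integrable lborel ?F" by (rule integrable_airy_integrand_shifted[OF a])
  have sint: "set_integrable lborel S ?F" if "S \<in> sets borel" for S
    using that int unfolding set_integrable_def by (intro integrable_mult_indicator) auto
  have "((\<lambda>T. LINT t:{0..T}|lborel. ?F t) \<longlongrightarrow> (LINT t:{0..}|lborel. ?F t)) at_top"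
    by (rule tendsto_set_lebesgue_integral_at_top) (auto intro: sint)
  also have "(\<lambda>T. LINT t:{0..T}|lborel. ?F t) = (\<lambda>T. integral {0..T} ?F)"
    by (intro ext set_borel_integral_eq_integral(2) sint) auto
  finally have lim: "((\<lambda>T. Re (integral {0..T} ?F)) \<longlongrightarrow> Re (LINT t:{0..}|lborel. ?F t)) at_top"
    by (rule tendsto_Re)
  have "((\<lambda>T. integral {0..T} ?c - Re (integral {0..T} ?F)) \<longlongrightarrow> 0) at_top"
  proof (rule Lim_null_comparison)
    show "\<forall>\<^sub>F T in at_top. norm (integral {0..T} ?c - Re (integral {0..T} ?F)) \<le> exp (a ^ 3 / 3 + \<bar>x\<bar> * a) / T\<^sup>2"
      using eventually_gt_at_top[of 0] by eventually_elim (use airy_contour_shift(2)[OF a] in auto)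
    show "((\<lambda>T. exp (a ^ 3 / 3 + \<bar>x\<bar> * a) / T\<^sup>2) \<longlongrightarrow> 0) at_top"
      by (intro tendsto_divide_0[OF tendsto_const] filterlim_at_top_imp_at_infinity filterlim_pow_at_top filterlim_ident) auto
  qed
  from tendsto_add[OF this lim]
  have "((\<lambda>T. integral {0..T} ?c) \<longlongrightarrow> Re (LINT t:{0..}|lborel. ?F t)) at_top" by simp
  then have "(?c has_integral Re (LINT t:{0..}|lborel. ?F t)) {0..}"
    using airy_contour_shift(1)[OF a] by (intro has_integral_improper_Ici)
  then have Ai: "Ai x = 1 / pi * Re (LINT t:{0..}|lborel. ?F t)"
    unfolding Ai_def by (simp add: integral_unique)
  have F_cnj: "?F (- t) = cnj (?F t)" for t
  proof -
    have "Complex (- t) a = - cnj (Complex t a)" by (simp add: complex_eq_iff)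
    then have "\<i> * (Complex (- t) a ^ 3 / 3 + of_real x * Complex (- t) a) = cnj (\<i> * (Complex t a ^ 3 / 3 + of_real x * Complex t a))"
      by (simp add: power3_eq_cube algebra_simps)
    then show ?thesis by (simp only: airy_integrand_def exp_cnj)
  qed
  have "has_bochner_integral lborel (\<lambda>t. Re (?F t)) (2 *\<^sub>R Re (LINT t:{0..}|lborel. ?F t))"
  proof (rule has_bochner_integral_even_function)
    have "has_bochner_integral lborel (\<lambda>t. Re (indicator {0..} t *\<^sub>R ?F t)) (Re (LINT t:{0..}|lborel. ?F t))"
      using sint[of "{0..}"] unfolding set_integrable_def set_lebesgue_integral_def
      by (intro has_bochner_integral_bounded_linear[OF bounded_linear_Re] has_bochner_integral_integrable) auto
    then show "has_bochner_integral lborel (\<lambda>t. indicator {0..} t *\<^sub>R Re (?F t)) (Re (LINT t:{0..}|lborel. ?F t))"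
      by simp
    show "Re (?F (- t)) = Re (?F t)" for t by (simp add: F_cnj)
  qed
  then have Re_int: "Re (\<integral>t. ?F t \<partial>lborel) = 2 * pi * Ai x"
    using integral_Re[OF int] by (simp add: has_bochner_integral_iff Ai)
  have "(\<integral>t. ?F t \<partial>lborel) = (\<integral>t. ?F (- t) \<partial>lborel)"
    by (subst lborel_integral_real_affine[where c = "-1" and t = 0]) auto
  also have "\<dots> = cnj (\<integral>t. ?F t \<partial>lborel)" by (simp add: F_cnj)
  finally have "Im (\<integral>t. ?F t \<partial>lborel) = 0" by (simp add: complex_eq_iff)
  with Re_int have "(\<integral>t. ?F t \<partial>lborel) = complex_of_real (2 * pi * Ai x)"
    by (simp add: complex_eq_iff)
  moreover have "(\<integral>t. ?F t \<partial>lborel) = complex_of_real (exp (- a * x)) * fourier (airy_symbol a) x"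
    unfolding airy_integrand_shifted fourier_def by simp
  ultimately have "complex_of_real (exp (- a * x)) * fourier (airy_symbol a) x = complex_of_real (2 * pi * Ai x)" by simp
  then have "complex_of_real (exp (a * x)) * (complex_of_real (exp (- a * x)) * fourier (airy_symbol a) x) =
      complex_of_real (exp (a * x) * (2 * pi * Ai x))" by simp
  moreover have "complex_of_real (exp (a * x)) * complex_of_real (exp (- a * x)) = 1"
    by (simp add: exp_minus flip: of_real_mult)
  ultimately have "fourier (airy_symbol a) x = complex_of_real (exp (a * x) * (2 * pi * Ai x))"
    by (simp only: mult.assoc[symmetric] mult_1_left)
  then show ?thesis by simp
qed

lemma Ai_measurable [measurable]: "Ai \<in> borel_measurable borel"
proof -
  have "Ai x = exp (- x) * Re (1 / (2 * pi) * fourier (airy_symbol 1) x)" for x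
  proof -
    have "exp (1 * x) * Ai x = Re (1 / (2 * pi) * fourier (airy_symbol 1) x)"
      by (simp only: Ai_fourier[of 1 x, symmetric] zero_less_one Re_complex_of_real)
    moreover have "exp (- x) * (exp (1 * x) * Ai x) = Ai x" by (simp add: exp_minus)
    ultimately show ?thesis by metis
  qed
  then have eq: "Ai = (\<lambda>x. exp (- x) * Re (1 / (2 * pi) * fourier (airy_symbol 1) x))" by blast
  have [measurable]: "airy_symbol 1 \<in> borel_measurable borel"
    by (intro borel_measurable_continuous_onI continuous_airy_symbol)
  show ?thesis by (subst eq) measurable
qed

text \<open>The kernel of exp(-\<alpha> H) for the Airy operator H = -d^2/dx^2 + x: as a function of
  x, Ai(x + u) is a generalised eigenfunction of H with eigenvalue -u.\<close>

definition heat_kernel :: "real \<Rightarrow> real \<Rightarrow> real \<Rightarrow> real" where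
  "heat_kernel \<alpha> x y = exp (\<alpha> ^ 3 / 12 - \<alpha> * (x + y) / 2) * normal_density 0 (sqrt (2 * \<alpha>)) (x - y)"

lemma exp_weighted_Ai_product:
  assumes \<alpha>: "\<alpha> > 0"
  shows "integrable lborel (\<lambda>u. exp (\<alpha> * u) * (Ai (x + u) * Ai (y + u)))"
    and "(\<integral>u. exp (\<alpha> * u) * (Ai (x + u) * Ai (y + u)) \<partial>lborel) = heat_kernel \<alpha> x y"
proof -
  \<comment> \<open>Each Airy factor takes half of the exponential weight; the two prefactors
    \<open>exp (a ^ 3 / 3)\<close> then multiply to \<open>exp (\<alpha> ^ 3 / 12)\<close>.\<close>
  define a where "a = \<alpha> / 2"
  have a: "a > 0" using \<alpha> by (simp add: a_def)
  define g where "g = (\<lambda>x t. iexp (x * t) * airy_symbol a t)"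
  have g_cont: "continuous_on UNIV (g x)" for x
    unfolding g_def by (intro continuous_intros continuous_airy_symbol)
  have g_bound: "norm (g x t) \<le> exp (a ^ 3 / 3) * exp (- a * t\<^sup>2)" for x t
    by (simp add: g_def norm_airy_symbol)
  have f: "fourier (g x) u = complex_of_real (2 * pi * exp (a * (x + u)) * Ai (x + u))" for x u
  proof -
    have "fourier (g x) u = fourier (airy_symbol a) (x + u)"
      unfolding fourier_def g_def by (simp add: distrib_right distrib_left exp_add mult_ac)
    also have "\<dots> = complex_of_real (2 * pi) * (1 / (2 * pi) * fourier (airy_symbol a) (x + u))" by simp
    also have "\<dots> = complex_of_real (2 * pi * exp (a * (x + u)) * Ai (x + u))"
      unfolding Ai_fourier[OF a, of "x + u", symmetric] by simp
    finally show ?thesis .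
  qed
  have prod: "fourier (g x) u * cnj (fourier (g y) u) =
      complex_of_real (4 * pi\<^sup>2 * exp (a * (x + y)) * (exp (\<alpha> * u) * (Ai (x + u) * Ai (y + u))))" for u
  proof -
    have "exp (a * (x + u)) * exp (a * (y + u)) = exp (a * (x + y)) * exp (\<alpha> * u)"
      unfolding exp_add[symmetric] by (simp add: a_def field_simps)
    then have "(2 * pi * exp (a * (x + u)) * Ai (x + u)) * (2 * pi * exp (a * (y + u)) * Ai (y + u)) =
        4 * pi\<^sup>2 * exp (a * (x + y)) * (exp (\<alpha> * u) * (Ai (x + u) * Ai (y + u)))"
      by (simp add: power2_eq_square mult_ac)
    then show ?thesis unfolding f by (simp only: complex_cnj_complex_of_real of_real_mult[symmetric])
  qed
  define K where "K = 4 * pi\<^sup>2 * exp (a * (x + y))"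
  have K: "K > 0" by (simp add: K_def)
  have int: "integrable lborel (\<lambda>u. complex_of_real (K * (exp (\<alpha> * u) * (Ai (x + u) * Ai (y + u)))))"
    using plancherel(1)[OF g_cont g_cont a g_bound g_bound, of x y] unfolding prod K_def .
  from integrable_Re[OF this] have "integrable lborel (\<lambda>u. K * (exp (\<alpha> * u) * (Ai (x + u) * Ai (y + u))))" by simp
  then show "integrable lborel (\<lambda>u. exp (\<alpha> * u) * (Ai (x + u) * Ai (y + u)))"
    using K by simp
  have gg: "g x t * cnj (g y t) = exp (\<alpha> ^ 3 / 12) * (iexp ((x - y) * t) * complex_of_real (exp (- (sqrt (2 * \<alpha>) * t)\<^sup>2 / 2)))" for t
  proof -
    have "airy_symbol a t * cnj (airy_symbol a t) = complex_of_real ((norm (airy_symbol a t))\<^sup>2)"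
      by (rule complex_norm_square[symmetric])
    also have "(norm (airy_symbol a t))\<^sup>2 = exp (\<alpha> ^ 3 / 12) * exp (- (sqrt (2 * \<alpha>) * t)\<^sup>2 / 2)"
    proof -
      have "(norm (airy_symbol a t))\<^sup>2 = exp (2 * (a ^ 3 / 3) + 2 * (- a * t\<^sup>2))"
        unfolding norm_airy_symbol exp_add[symmetric] exp_double[symmetric] by (simp add: distrib_left)
      also have "2 * (a ^ 3 / 3) + 2 * (- a * t\<^sup>2) = \<alpha> ^ 3 / 12 + - (sqrt (2 * \<alpha>) * t)\<^sup>2 / 2"
        using \<alpha> by (simp add: a_def power_mult_distrib power_divide)
      finally show ?thesis by (simp only: exp_add)
    qed
    finally have "airy_symbol a t * cnj (airy_symbol a t) = complex_of_real (exp (\<alpha> ^ 3 / 12)) * complex_of_real (exp (- (sqrt (2 * \<alpha>) * t)\<^sup>2 / 2))"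
      by (simp only: of_real_mult)
    moreover have "iexp (x * t) * cnj (iexp (y * t)) = iexp ((x - y) * t)"
      unfolding exp_cnj exp_add[symmetric] by (simp add: algebra_simps)
    moreover have "g x t * cnj (g y t) = (iexp (x * t) * cnj (iexp (y * t))) * (airy_symbol a t * cnj (airy_symbol a t))"
      unfolding g_def complex_cnj_mult by (simp only: mult_ac)
    ultimately show ?thesis by (simp only: mult_ac)
  qed
  have "complex_of_real (K * (\<integral>u. exp (\<alpha> * u) * (Ai (x + u) * Ai (y + u)) \<partial>lborel)) =
      (\<integral>u. complex_of_real (K * (exp (\<alpha> * u) * (Ai (x + u) * Ai (y + u)))) \<partial>lborel)"
    unfolding integral_complex_of_real by simp
  also have "\<dots> = 2 * pi * (\<integral>t. g x t * cnj (g y t) \<partial>lborel)"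
    using plancherel(2)[OF g_cont g_cont a g_bound g_bound, of x y] unfolding prod K_def .
  also have "(\<integral>t. g x t * cnj (g y t) \<partial>lborel) = exp (\<alpha> ^ 3 / 12) * fourier (\<lambda>t. complex_of_real (exp (- (sqrt (2 * \<alpha>) * t)\<^sup>2 / 2))) (x - y)"
    unfolding gg fourier_def by simp
  also have "\<dots> = complex_of_real (exp (\<alpha> ^ 3 / 12) * (2 * pi * normal_density 0 (sqrt (2 * \<alpha>)) (x - y)))"
    using \<alpha> by (subst gaussian_fourier(2)) auto
  finally have "K * (\<integral>u. exp (\<alpha> * u) * (Ai (x + u) * Ai (y + u)) \<partial>lborel) =
      2 * pi * (exp (\<alpha> ^ 3 / 12) * (2 * pi * normal_density 0 (sqrt (2 * \<alpha>)) (x - y)))"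
    by (simp only: of_real_mult[symmetric] of_real_eq_iff)
  also have "\<dots> = K * heat_kernel \<alpha> x y"
  proof -
    have "exp (\<alpha> ^ 3 / 12) = exp (a * (x + y)) * exp (\<alpha> ^ 3 / 12 - \<alpha> * (x + y) / 2)"
      unfolding exp_add[symmetric] by (simp add: a_def)
    then show ?thesis by (simp add: K_def heat_kernel_def power2_eq_square)
  qed
  finally show "(\<integral>u. exp (\<alpha> * u) * (Ai (x + u) * Ai (y + u)) \<partial>lborel) = heat_kernel \<alpha> x y"
    using K by simp
qed

section \<open>Fredholm series of positive semidefinite kernels\<close>

locale psd_kernel =
  fixes K :: "real \<Rightarrow> real \<Rightarrow> real"
  assumes K_measurable [measurable]: "case_prod K \<in> borel_measurable (borel \<Otimes>\<^sub>M borel)"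
    and K_psd: "psd k (\<lambda>i j. K (x i) (x j))"
begin

lemma K_diag_nonneg: "0 \<le> K x x"
  using psd_diag_nonneg[OF K_psd, of 0 1 "\<lambda>_. x"] by simp

lemma kernel_minor_measurable [measurable]: "kernel_minor K k \<in> borel_measurable (\<Pi>\<^sub>M i\<in>{..<k}. lborel)"
proof -
  have "(\<lambda>x. fdet k (\<lambda>i j. K (x i) (x j))) \<in> borel_measurable (\<Pi>\<^sub>M i\<in>{..<k}. lborel)"
    by measurable
  also have "(\<lambda>x. fdet k (\<lambda>i j. K (x i) (x j))) = kernel_minor K k"
    by (auto simp: kernel_minor_eq_fdet)
  finally show ?thesis .
qed

lemma kernel_minor_bounds: "0 \<le> kernel_minor K k x" "kernel_minor K k x \<le> (\<Prod>j<k. K (x j) (x j))"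
  using hadamard_inequality[OF K_psd] by (auto simp: kernel_minor_eq_fdet)

end

definition kernel_trace :: "(real \<Rightarrow> real \<Rightarrow> real) \<Rightarrow> real set \<Rightarrow> real" where
  "kernel_trace K S = (\<integral>x. indicator S x * K x x \<partial>lborel)"

text \<open>The restriction to S^k is a product of indicators because that is what the test function
  \<open>z * indicator B\<close> produces in the correlation identity.\<close>

definition minor_integral :: "(real \<Rightarrow> real \<Rightarrow> real) \<Rightarrow> real set \<Rightarrow> nat \<Rightarrow> real" where
  "minor_integral K S k = (\<integral>x. (\<Prod>j<k. indicator S (x j)) * kernel_minor K k x \<partial>(\<Pi>\<^sub>M i\<in>{..<k}. lborel))"

definition fredholm_series :: "(real \<Rightarrow> real \<Rightarrow> real) \<Rightarrow> real set \<Rightarrow> real" where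
  "fredholm_series K S = (\<Sum>k. (-1) ^ k / fact k * minor_integral K S k)"

interpretation lborel_product: product_sigma_finite "\<lambda>_::nat. lborel :: real measure"
  by standard

lemma integral_lborel_power:
  fixes f :: "real \<Rightarrow> real"
  assumes "integrable lborel f"
  shows "integrable (\<Pi>\<^sub>M i\<in>{..<k}. lborel) (\<lambda>x. \<Prod>j<k. f (x j))"
    and "(\<integral>x. (\<Prod>j<k. f (x j)) \<partial>(\<Pi>\<^sub>M i\<in>{..<k}. lborel)) = (integral\<^sup>L lborel f) ^ k"
  using lborel_product.product_integrable_prod[of "{..<k}" "\<lambda>_. f"]
    lborel_product.product_integral_prod[of "{..<k}" "\<lambda>_. f"] assms by auto

locale trace_class_kernel = psd_kernel +
  fixes S :: "real set"
  assumes S [measurable]: "S \<in> sets borel"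
    and trace: "integrable lborel (\<lambda>x. indicator S x * K x x)"
begin

lemma minor_bounds:
  "0 \<le> (\<Prod>j<k. indicator S (x j)) * kernel_minor K k x"
  "(\<Prod>j<k. indicator S (x j)) * kernel_minor K k x \<le> (\<Prod>j<k. indicator S (x j) * K (x j) (x j))"
  unfolding prod.distrib using kernel_minor_bounds
  by (auto intro!: mult_nonneg_nonneg mult_left_mono prod_nonneg)

lemma minor_integrable:
  "integrable (\<Pi>\<^sub>M i\<in>{..<k}. lborel) (\<lambda>x. (\<Prod>j<k. indicator S (x j)) * kernel_minor K k x)"
proof (rule Bochner_Integration.integrable_bound[OF integral_lborel_power(1)[OF trace]])
  show "AE x in (\<Pi>\<^sub>M i\<in>{..<k}. lborel). norm ((\<Prod>j<k. indicator S (x j)) * kernel_minor K k x)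
      \<le> norm (\<Prod>j<k. indicator S (x j) * K (x j) (x j))"
    using minor_bounds by (intro AE_I2) (simp only: real_norm_def abs_of_nonneg order_trans[OF minor_bounds])
qed measurable

lemma kernel_trace_nonneg: "0 \<le> kernel_trace K S"
  unfolding kernel_trace_def by (intro integral_nonneg_AE AE_I2 mult_nonneg_nonneg K_diag_nonneg) auto

lemma minor_integral_nonneg: "0 \<le> minor_integral K S k"
  unfolding minor_integral_def using minor_bounds(1) by (intro integral_nonneg_AE AE_I2)

lemma minor_integral_le: "minor_integral K S k \<le> kernel_trace K S ^ k"
  unfolding minor_integral_def kernel_trace_def integral_lborel_power(2)[OF trace, symmetric]
  by (intro integral_mono minor_integrable integral_lborel_power(1)[OF trace] minor_bounds)

lemma norm_fredholm_series_term: "norm ((-1) ^ k / fact k * minor_integral K S k) \<le> kernel_trace K S ^ k / fact k"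
  using minor_integral_nonneg minor_integral_le[of k] by (simp add: abs_mult divide_right_mono)

lemma fredholm_series_sums: "(\<lambda>k. (-1) ^ k / fact k * minor_integral K S k) sums fredholm_series K S"
  unfolding fredholm_series_def
proof (rule summable_sums, rule summable_comparison_test')
  show "summable (\<lambda>k. kernel_trace K S ^ k / fact k)"
    using summable_exp[of "kernel_trace K S"] by (simp add: field_simps)
qed (rule norm_fredholm_series_term)

end

text \<open>A common bound \<open>B\<close> on the traces dominates the k-th terms by
  \<open>B ^ k / fact k\<close>, so termwise convergence suffices.\<close>

lemma fredholm_series_tendsto_tannery:
  assumes tc: "\<And>n. trace_class_kernel (K n) (S n)"
    and B: "\<And>n. kernel_trace (K n) (S n) \<le> B"
    and lim: "\<And>k. (\<lambda>n. minor_integral (K n) (S n) k) \<longlonglongrightarrow> m k"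
  shows "(\<lambda>n. fredholm_series (K n) (S n)) \<longlonglongrightarrow> (\<Sum>k. (-1) ^ k / fact k * m k)"
  unfolding fredholm_series_def
proof (rule tannerys_theorem[THEN conjunct2, THEN conjunct2])
  show "(\<lambda>n. (-1) ^ k / fact k * minor_integral (K n) (S n) k) \<longlonglongrightarrow> (-1) ^ k / fact k * m k" for k
    by (intro tendsto_intros lim)
  show "\<forall>\<^sub>F (k, n) in at_top \<times>\<^sub>F sequentially. norm ((-1) ^ k / fact k * minor_integral (K n) (S n) k) \<le> B ^ k / fact k"
  proof (intro always_eventually allI, clarify)
    fix k n
    interpret trace_class_kernel "K n" "S n" by (rule tc)
    have "kernel_trace (K n) (S n) ^ k / fact k \<le> B ^ k / fact k"
      by (intro divide_right_mono power_mono B kernel_trace_nonneg) simp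
    with norm_fredholm_series_term[of k]
    show "norm ((-1) ^ k / fact k * minor_integral (K n) (S n) k) \<le> B ^ k / fact k" by linarith
  qed
  show "summable (\<lambda>k. B ^ k / fact k)"
    using summable_exp[of B] by (simp add: field_simps)
qed simp

lemma kernel_minor_tendsto:
  assumes "\<And>i j. i < k \<Longrightarrow> j < k \<Longrightarrow> (\<lambda>n. K n (x i) (x j)) \<longlonglongrightarrow> L (x i) (x j)"
  shows "(\<lambda>n. kernel_minor (K n) k x) \<longlonglongrightarrow> kernel_minor L k x"
  unfolding kernel_minor_eq_fdet fdet_leibniz
proof (intro tendsto_intros)
  fix p i assume "p \<in> {p. p permutes {..<k}}" "i \<in> {..<k}"
  then show "(\<lambda>n. K n (x i) (x (p i))) \<longlonglongrightarrow> L (x i) (x (p i))"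
    using permutes_in_image[of p "{..<k}" i] by (intro assms) auto
qed

text \<open>Serves two limits: a fixed kernel on growing intervals, and varying kernels on a fixed
  half-line. Hadamard's inequality reduces the domination of all minors to the diagonal bound
  \<open>H\<close>.\<close>

lemma fredholm_series_tendsto:
  assumes tc: "\<And>n. trace_class_kernel (K n) (S n)" and tcL: "trace_class_kernel L T"
    and H: "integrable lborel (\<lambda>x. indicator T x * H x)"
    and sub: "\<And>n. S n \<subseteq> T" and le: "\<And>n x. x \<in> T \<Longrightarrow> K n x x \<le> H x"
    and S_lim: "\<And>x. (\<lambda>n. indicator (S n) x :: real) \<longlonglongrightarrow> indicator T x"
    and K_lim: "\<And>x y. x \<in> T \<Longrightarrow> y \<in> T \<Longrightarrow> (\<lambda>n. K n x y) \<longlonglongrightarrow> L x y"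
  shows "(\<lambda>n. fredholm_series (K n) (S n)) \<longlonglongrightarrow> fredholm_series L T"
proof -
  have dom: "indicator (S n) x * K n x x \<le> indicator T x * H x" "0 \<le> indicator (S n) x * K n x x" for n x
  proof -
    interpret trace_class_kernel "K n" "S n" by (rule tc)
    show "0 \<le> indicator (S n) x * K n x x" using K_diag_nonneg by simp
    show "indicator (S n) x * K n x x \<le> indicator T x * H x"
      using sub[of n] le[of x n] K_diag_nonneg[of x] by (auto simp: indicator_def)
  qed
  have "(\<lambda>n. fredholm_series (K n) (S n)) \<longlonglongrightarrow> (\<Sum>k. (-1) ^ k / fact k * minor_integral L T k)"
  proof (rule fredholm_series_tendsto_tannery[OF tc])
    show "kernel_trace (K n) (S n) \<le> (\<integral>x. indicator T x * H x \<partial>lborel)" for n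
    proof -
      interpret trace_class_kernel "K n" "S n" by (rule tc)
      show ?thesis unfolding kernel_trace_def by (intro integral_mono trace H dom)
    qed
    fix k
    show "(\<lambda>n. minor_integral (K n) (S n) k) \<longlonglongrightarrow> minor_integral L T k"
      unfolding minor_integral_def
    proof (rule integral_dominated_convergence)
      show "integrable (\<Pi>\<^sub>M i\<in>{..<k}. lborel) (\<lambda>x. \<Prod>j<k. indicator T (x j) * H (x j))"
        by (rule integral_lborel_power(1)[OF H])
      interpret L: trace_class_kernel L T by (rule tcL)
      show "(\<lambda>x. (\<Prod>j<k. indicator T (x j)) * kernel_minor L k x) \<in> borel_measurable (\<Pi>\<^sub>M i\<in>{..<k}. lborel)"
        by measurable
      show "(\<lambda>x. (\<Prod>j<k. indicator (S n) (x j)) * kernel_minor (K n) k x) \<in> borel_measurable (\<Pi>\<^sub>M i\<in>{..<k}. lborel)" for n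
      proof -
        interpret trace_class_kernel "K n" "S n" by (rule tc)
        show ?thesis by measurable
      qed
      show "AE x in \<Pi>\<^sub>M i\<in>{..<k}. lborel. norm ((\<Prod>j<k. indicator (S n) (x j)) * kernel_minor (K n) k x)
          \<le> (\<Prod>j<k. indicator T (x j) * H (x j))" for n
      proof (intro AE_I2)
        fix x
        interpret trace_class_kernel "K n" "S n" by (rule tc)
        have "(\<Prod>j<k. indicator (S n) (x j) * K n (x j) (x j)) \<le> (\<Prod>j<k. indicator T (x j) * H (x j))"
          using dom by (intro prod_mono) auto
        then show "norm ((\<Prod>j<k. indicator (S n) (x j)) * kernel_minor (K n) k x) \<le> (\<Prod>j<k. indicator T (x j) * H (x j))"
          using minor_bounds[of x k] by simp
      qed
      show "AE x in \<Pi>\<^sub>M i\<in>{..<k}. lborel. (\<lambda>n. (\<Prod>j<k. indicator (S n) (x j)) * kernel_minor (K n) k x)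
          \<longlonglongrightarrow> (\<Prod>j<k. indicator T (x j)) * kernel_minor L k x"
      proof (intro AE_I2)
        fix x
        show "(\<lambda>n. (\<Prod>j<k. indicator (S n) (x j)) * kernel_minor (K n) k x)
          \<longlonglongrightarrow> (\<Prod>j<k. indicator T (x j)) * kernel_minor L k x"
        proof (cases "\<forall>j<k. x j \<in> T")
          case True
          then show ?thesis by (intro tendsto_intros S_lim kernel_minor_tendsto K_lim) auto
        next
          case False
          then obtain j where j: "j < k" "x j \<notin> T" by blast
          then have "x j \<notin> S n" for n using sub by blast
          then have z: "(\<Prod>j<k. indicator (S n) (x j) :: real) = 0" "(\<Prod>j<k. indicator T (x j) :: real) = 0" for n
            using j by (auto intro!: prod_zero bexI[of _ j])
          show ?thesis unfolding z by simp
        qed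
      qed
    qed
  qed
  then show ?thesis by (simp add: fredholm_series_def)
qed

text \<open>All factors but \<open>i = m\<close> are bounded by \<open>\<bar>a i j\<bar> \<le> sqrt (a i i) * sqrt (a j j)\<close>; the remaining one is
  split off by the inequality of arithmetic and geometric means.\<close>

lemma prod_permutation_offdiag_le:
  assumes a: "psd k a" and p: "p permutes {..<k}" and m: "m < k" "p m \<noteq> m" and e: "e > 0"
  shows "\<bar>\<Prod>i<k. a i (p i)\<bar> \<le>
    ((a m (p m))\<^sup>2 / e * (\<Prod>l\<in>{..<k} - {m, p m}. a l l) + e * (\<Prod>l<k. a l l))"
proof -
  let ?n = "p m"
  have n: "?n < k" using permutes_in_image[OF p, of m] m by simp
  have d: "0 \<le> a i i" if "i < k" for i using psd_diag_nonneg[OF a that] .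
  define r where "r = (\<lambda>i. sqrt (a i i))"
  have r: "0 \<le> r i" "r i * r i = a i i" if "i < k" for i using d[OF that] by (auto simp: r_def)
  define P where "P = (\<Prod>l\<in>{..<k} - {m, ?n}. a l l)"
  have P: "0 \<le> P" unfolding P_def using d by (intro prod_nonneg) auto
  have inj: "inj_on p ({..<k} - {m})" using permutes_inj_on[OF p] .
  have img: "p ` ({..<k} - {m}) = {..<k} - {?n}"
    using permutes_image[OF p] permutes_inj[OF p] by (simp add: image_set_diff)
  have "\<bar>\<Prod>i<k. a i (p i)\<bar> = \<bar>a m ?n\<bar> * (\<Prod>i\<in>{..<k} - {m}. \<bar>a i (p i)\<bar>)"
    using m by (simp add: abs_prod abs_mult prod.remove[of _ m])
  also have "(\<Prod>i\<in>{..<k} - {m}. \<bar>a i (p i)\<bar>) \<le> (\<Prod>i\<in>{..<k} - {m}. r i * r (p i))"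
  proof (intro prod_mono conjI)
    fix i assume "i \<in> {..<k} - {m}"
    then have "i < k" "p i < k" using permutes_in_image[OF p, of i] by auto
    then show "\<bar>a i (p i)\<bar> \<le> r i * r (p i)" unfolding r_def by (rule psd_offdiag_le[OF a])
  qed simp
  also have "(\<Prod>i\<in>{..<k} - {m}. r i * r (p i)) = (\<Prod>i\<in>{..<k} - {m}. r i) * (\<Prod>i\<in>{..<k} - {?n}. r i)"
    unfolding prod.distrib img[symmetric] prod.reindex[OF inj] by simp
  also have "(\<Prod>i\<in>{..<k} - {m}. r i) = r ?n * (\<Prod>l\<in>{..<k} - {m, ?n}. r l)"
  proof -
    have "{..<k} - {m} - {?n} = {..<k} - {m, ?n}" by auto
    then show ?thesis using n m by (subst prod.remove[of _ ?n]) auto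
  qed
  also have "(\<Prod>i\<in>{..<k} - {?n}. r i) = r m * (\<Prod>l\<in>{..<k} - {m, ?n}. r l)"
  proof -
    have "{..<k} - {?n} - {m} = {..<k} - {m, ?n}" by auto
    then show ?thesis using n m by (subst prod.remove[of _ m]) auto
  qed
  also have "r ?n * (\<Prod>l\<in>{..<k} - {m, ?n}. r l) * (r m * (\<Prod>l\<in>{..<k} - {m, ?n}. r l)) = r m * r ?n * P"
  proof -
    have "(\<Prod>l\<in>{..<k} - {m, ?n}. r l) * (\<Prod>l\<in>{..<k} - {m, ?n}. r l) = P"
      unfolding prod.distrib[symmetric] P_def using r by (intro prod.cong) auto
    then show ?thesis by (simp add: mult_ac)
  qed
  finally have "\<bar>\<Prod>i<k. a i (p i)\<bar> \<le> \<bar>a m ?n\<bar> * (r m * r ?n * P)" by (simp add: mult_left_mono)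
  also have "\<dots> = (\<bar>a m ?n\<bar> * (r m * r ?n)) * P" by (simp add: mult_ac)
  also have "\<dots> \<le> ((a m ?n)\<^sup>2 / e + e * (a m m * a ?n ?n)) * P"
  proof (intro mult_right_mono P)
    define u v where "u = \<bar>a m ?n\<bar>" and "v = r m * r ?n"
    have uv: "0 \<le> u" "0 \<le> v" using r(1)[OF m(1)] r(1)[OF n] by (auto simp: u_def v_def)
    \<comment> \<open>The free parameter \<open>e\<close> is later set to the Hilbert-Schmidt bound,
      which balances the two terms.\<close>
    have "0 \<le> (u - e * v)\<^sup>2 / e" using e by simp
    also have "\<dots> = u\<^sup>2 / e + e * v\<^sup>2 - 2 * (u * v)"
      using e by (simp add: field_simps power2_eq_square)
    finally have "u * v \<le> u\<^sup>2 / e + e * v\<^sup>2" using mult_nonneg_nonneg[OF uv] by linarith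
    moreover have "v\<^sup>2 = a m m * a ?n ?n"
    proof -
      have "v\<^sup>2 = (r m * r m) * (r ?n * r ?n)" by (simp add: v_def power2_eq_square mult_ac)
      then show ?thesis using r(2)[OF m(1)] r(2)[OF n] by simp
    qed
    ultimately show "\<bar>a m ?n\<bar> * (r m * r ?n) \<le> (a m ?n)\<^sup>2 / e + e * (a m m * a ?n ?n)"
      by (simp add: u_def v_def)
  qed
  also have "(\<Prod>l<k. a l l) = a m m * a ?n ?n * P"
  proof -
    have "{..<k} - {m} - {?n} = {..<k} - {m, ?n}" by auto
    then show ?thesis using n m unfolding P_def
      by (subst prod.remove[of _ m]; simp) (subst prod.remove[of _ ?n]; simp add: mult.assoc)
  qed
  then have "((a m ?n)\<^sup>2 / e + e * (a m m * a ?n ?n)) * P = (a m ?n)\<^sup>2 / e * P + e * (\<Prod>l<k. a l l)"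
    by (simp add: distrib_right mult.assoc)
  finally show ?thesis by (simp add: P_def)
qed

text \<open>The diagonal product is the Leibniz term of the identity. Any other permutation moves
  some \<open>m\<close>, and its term is bounded through the pair \<open>m\<close>,
  \<open>p m\<close>; the sum over all pairs, taken for each of \<open>fact k\<close> permutations,
  overcounts these bounds.\<close>

lemma fdet_minus_diag_le:
  assumes a: "psd k a" and e: "e > 0"
  shows "\<bar>fdet k a - (\<Prod>i<k. a i i)\<bar> \<le> fact k *
    (\<Sum>m<k. \<Sum>n\<in>{..<k} - {m}. (a m n)\<^sup>2 / e * (\<Prod>l\<in>{..<k} - {m, n}. a l l) + e * (\<Prod>l<k. a l l))"
    (is "_ \<le> fact k * ?Q")
proof -
  let ?P = "{p. p permutes {..<k}}"
  let ?t = "\<lambda>m n. (a m n)\<^sup>2 / e * (\<Prod>l\<in>{..<k} - {m, n}. a l l) + e * (\<Prod>l<k. a l l)"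
  have t_nonneg: "0 \<le> ?t m n" for m n
    using e psd_diag_nonneg[OF a] by (intro add_nonneg_nonneg mult_nonneg_nonneg prod_nonneg) auto
  have Q: "0 \<le> ?Q" using t_nonneg by (intro sum_nonneg)
  have id: "id \<in> ?P" by (simp add: permutes_id)
  have fin: "finite ?P" by (rule finite_permutations) simp
  have "fdet k a - (\<Prod>i<k. a i i) = (\<Sum>p\<in>?P - {id}. of_int (sign p) * (\<Prod>i<k. a i (p i)))"
    unfolding fdet_leibniz by (subst sum.remove[OF fin id]) (simp add: sign_id)
  also have "\<bar>\<dots>\<bar> \<le> (\<Sum>p\<in>?P - {id}. \<bar>of_int (sign p) * (\<Prod>i<k. a i (p i))\<bar>)" by (rule sum_abs)
  also have "\<dots> \<le> (\<Sum>p\<in>?P - {id}. ?Q)"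
  proof (rule sum_mono)
    fix p assume p: "p \<in> ?P - {id}"
    then obtain m where m: "p m \<noteq> m" by (auto simp: fun_eq_iff)
    with p have mk: "m < k" using permutes_not_in[of p "{..<k}" m] by auto
    have pm: "p m < k" using permutes_in_image[of p "{..<k}" m] p mk by auto
    have "\<bar>of_int (sign p) * (\<Prod>i<k. a i (p i))\<bar> = \<bar>\<Prod>i<k. a i (p i)\<bar>"
      by (simp add: abs_mult sign_def)
    also have "\<dots> \<le> ?t m (p m)"
      using p m mk by (intro prod_permutation_offdiag_le a e) auto
    also have "\<dots> \<le> (\<Sum>n\<in>{..<k} - {m}. ?t m n)"
      using pm m t_nonneg by (intro member_le_sum) auto
    also have "\<dots> \<le> ?Q"
      using mk t_nonneg by (intro member_le_sum[of m "{..<k}" "\<lambda>m. \<Sum>n\<in>{..<k} - {m}. ?t m n"] sum_nonneg) auto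
    finally show "\<bar>of_int (sign p) * (\<Prod>i<k. a i (p i))\<bar> \<le> ?Q" .
  qed
  also have "\<dots> \<le> (\<Sum>p\<in>?P. ?Q)"
    using Q fin by (intro sum_mono2) auto
  also have "\<dots> = fact k * ?Q" by (simp add: card_permutations)
  finally show ?thesis .
qed


section \<open>From small Hilbert-Schmidt norms to the exponential limit\<close>

lemma nn_integral_pair_times_prod:
  fixes h :: "real \<Rightarrow> real \<Rightarrow> ennreal" and d :: "real \<Rightarrow> ennreal"
  assumes [measurable]: "case_prod h \<in> borel_measurable (borel \<Otimes>\<^sub>M borel)" "d \<in> borel_measurable borel"
    and mn: "m < k" "n < k" "m \<noteq> n"
  shows "(\<integral>\<^sup>+x. h (x m) (x n) * (\<Prod>l\<in>{..<k} - {m, n}. d (x l)) \<partial>(\<Pi>\<^sub>M i\<in>{..<k}. lborel)) =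
    (\<integral>\<^sup>+y. \<integral>\<^sup>+z. h y z \<partial>lborel \<partial>lborel) * (\<integral>\<^sup>+y. d y \<partial>lborel) ^ (k - 2)"
proof -
  have dcomp: "(\<lambda>x. d (x l)) \<in> borel_measurable (PiM J (\<lambda>_. lborel))" if "l \<in> J" for l and J :: "nat set"
    by (rule measurable_compose[OF measurable_component_singleton[of l J "\<lambda>_. lborel"]]) (use that in auto)
  have hz: "(\<lambda>z. \<integral>\<^sup>+y. h y z \<partial>lborel) \<in> borel_measurable lborel" by measurable
  define I where "I = {..<k} - {m, n}"
  have I: "finite I" "m \<notin> insert n I" "n \<notin> I" "m \<notin> I" "insert m (insert n I) = {..<k}" using mn by (auto simp: I_def)
  have cI: "card I = k - 2" unfolding I_def using mn by (subst card_Diff_subset) auto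
  let ?f = "\<lambda>x. h (x m) (x n) * (\<Prod>l\<in>I. d (x l))"
  have hm: "(\<lambda>x. h (x m) (x n)) \<in> borel_measurable (PiM (insert m (insert n I)) (\<lambda>_. lborel))"
  proof -
    have "(\<lambda>x. (x m, x n)) \<in> measurable (PiM (insert m (insert n I)) (\<lambda>_. lborel)) (borel \<Otimes>\<^sub>M borel)"
      by measurable
    from measurable_compose[OF this assms(1)] show ?thesis by simp
  qed
  have f: "?f \<in> borel_measurable (PiM (insert m (insert n I)) (\<lambda>_. lborel))"
    by (intro borel_measurable_times_ennreal hm borel_measurable_prod_ennreal
        dcomp) auto
  have "(\<integral>\<^sup>+x. ?f x \<partial>(\<Pi>\<^sub>M i\<in>{..<k}. lborel)) =
      (\<integral>\<^sup>+x. \<integral>\<^sup>+y. ?f (x(m := y)) \<partial>lborel \<partial>PiM (insert n I) (\<lambda>_. lborel))"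
    unfolding I(5)[symmetric] using I f by (intro lborel_product.product_nn_integral_insert) auto
  also have "\<dots> = (\<integral>\<^sup>+x. (\<integral>\<^sup>+y. h y (x n) \<partial>lborel) * (\<Prod>l\<in>I. d (x l)) \<partial>PiM (insert n I) (\<lambda>_. lborel))"
  proof (rule nn_integral_cong)
    fix x :: "nat \<Rightarrow> real"
    have "?f (x(m := y)) = h y (x n) * (\<Prod>l\<in>I. d (x l))" for y
      using I mn by (intro arg_cong2[of _ _ _ _ "(*)"] prod.cong) auto
    then show "(\<integral>\<^sup>+y. ?f (x(m := y)) \<partial>lborel) = (\<integral>\<^sup>+y. h y (x n) \<partial>lborel) * (\<Prod>l\<in>I. d (x l))"
      by (simp add: nn_integral_multc)
  qed
  also have "\<dots> = (\<integral>\<^sup>+x. \<integral>\<^sup>+z. (\<integral>\<^sup>+y. h y ((x(n := z)) n) \<partial>lborel) * (\<Prod>l\<in>I. d ((x(n := z)) l)) \<partial>lborel \<partial>PiM I (\<lambda>_. lborel))"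
    using I
    by (intro lborel_product.product_nn_integral_insert borel_measurable_times_ennreal borel_measurable_prod_ennreal
        dcomp
        measurable_compose[OF measurable_component_singleton[of n "insert n I" "\<lambda>_. lborel"] hz]) auto
  also have "\<dots> = (\<integral>\<^sup>+x. (\<integral>\<^sup>+z. \<integral>\<^sup>+y. h y z \<partial>lborel \<partial>lborel) * (\<Prod>l\<in>I. d (x l)) \<partial>PiM I (\<lambda>_. lborel))"
  proof (rule nn_integral_cong)
    fix x :: "nat \<Rightarrow> real"
    have "(\<Prod>l\<in>I. d ((x(n := z)) l)) = (\<Prod>l\<in>I. d (x l))" for z using I by (intro prod.cong) auto
    then show "(\<integral>\<^sup>+z. (\<integral>\<^sup>+y. h y ((x(n := z)) n) \<partial>lborel) * (\<Prod>l\<in>I. d ((x(n := z)) l)) \<partial>lborel) =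
      (\<integral>\<^sup>+z. \<integral>\<^sup>+y. h y z \<partial>lborel \<partial>lborel) * (\<Prod>l\<in>I. d (x l))"
      by (simp add: nn_integral_multc)
  qed
  also have "\<dots> = (\<integral>\<^sup>+z. \<integral>\<^sup>+y. h y z \<partial>lborel \<partial>lborel) * (\<integral>\<^sup>+x. (\<Prod>l\<in>I. d (x l)) \<partial>PiM I (\<lambda>_. lborel))"
    by (intro nn_integral_cmult borel_measurable_prod_ennreal
        dcomp) auto
  also have "(\<integral>\<^sup>+x. (\<Prod>l\<in>I. d (x l)) \<partial>PiM I (\<lambda>_. lborel)) = (\<integral>\<^sup>+y. d y \<partial>lborel) ^ (k - 2)"
    using I(1) by (subst lborel_product.product_nn_integral_prod) (auto simp: cI)
  also have "(\<integral>\<^sup>+z. \<integral>\<^sup>+y. h y z \<partial>lborel \<partial>lborel) = (\<integral>\<^sup>+y. \<integral>\<^sup>+z. h y z \<partial>lborel \<partial>lborel)"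
    by (rule lborel_pair.Fubini') measurable
  finally show ?thesis by (simp add: I_def)
qed

text \<open>An ordered pair contributes at most \<open>e\<^sup>2 / e\<close> times the (k - 2)-th
  power of the trace plus \<open>e\<close> times the k-th one, so at most
  \<open>2 * e * B ^ k\<close>, where \<open>1 \<le> B\<close> lets \<open>B ^ k\<close> cover the
  lower power. There are at most k^2 pairs and \<open>fact k\<close> permutations.\<close>

lemma (in trace_class_kernel) minor_integral_diff_le:
  assumes HS: "(\<integral>\<^sup>+x. \<integral>\<^sup>+y. ennreal (indicator S x * indicator S y * (K x y)\<^sup>2) \<partial>lborel \<partial>lborel) \<le> ennreal (e\<^sup>2)"
    and e: "e > 0" and B: "kernel_trace K S \<le> B" "1 \<le> B"
  shows "\<bar>minor_integral K S k - kernel_trace K S ^ k\<bar> \<le> 2 * fact k * real k ^ 2 * B ^ k * e"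
proof -
  let ?PM = "\<Pi>\<^sub>M i\<in>{..<k}. lborel :: real measure"
  define D where "D = (\<lambda>x. indicator S x * K x x)"
  have D_nonneg: "0 \<le> D x" for x using K_diag_nonneg by (simp add: D_def)
  have [measurable]: "D \<in> borel_measurable borel" unfolding D_def by measurable
  have D_int: "integrable lborel D" using trace by (simp add: D_def)
  have tr: "(\<integral>\<^sup>+y. ennreal (D y) \<partial>lborel) = ennreal (kernel_trace K S)"
    unfolding kernel_trace_def D_def[symmetric] using D_nonneg by (intro nn_integral_eq_integral D_int) auto
  define h where "h = (\<lambda>x y. indicator S x * indicator S y * (K x y)\<^sup>2)"
  have h_nonneg: "0 \<le> h x y" for x y by (simp add: h_def)
  have [measurable]: "case_prod h \<in> borel_measurable (borel \<Otimes>\<^sub>M borel)" unfolding h_def by measurable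
  define q where "q = (\<lambda>m n (x :: nat \<Rightarrow> real). h (x m) (x n) / e * (\<Prod>l\<in>{..<k} - {m, n}. D (x l)))"
  have q_nonneg: "0 \<le> q m n x" for m n x using e D_nonneg h_nonneg by (auto simp: q_def intro!: divide_nonneg_pos mult_nonneg_nonneg prod_nonneg)
  let ?B = "B ^ k"
  have tB: "kernel_trace K S ^ j \<le> ?B" if "j \<le> k" for j
  proof -
    have "kernel_trace K S ^ j \<le> B ^ j" using B kernel_trace_nonneg by (intro power_mono) auto
    also have "\<dots> \<le> B ^ k" using B that by (intro power_increasing) auto
    finally show ?thesis .
  qed
  have q_nn: "(\<integral>\<^sup>+x. ennreal (q m n x) \<partial>?PM) \<le> ennreal (e * ?B)" and q_meas: "q m n \<in> borel_measurable ?PM"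
    if mn: "m < k" "n \<in> {..<k} - {m}" for m n
  proof -
    have mn': "n < k" "m \<noteq> n" using mn by auto
    have comp: "(\<lambda>x. D (x l)) \<in> borel_measurable ?PM" if "l < k" for l
      using that by (intro measurable_compose[OF measurable_component_singleton]) auto
    have coord: "(\<lambda>x. x l) \<in> borel_measurable ?PM" if "l < k" for l
      using measurable_component_singleton[of l "{..<k}" "\<lambda>_. lborel :: real measure"] that by simp
    have pair: "(\<lambda>x. (x m, x n)) \<in> measurable ?PM (borel \<Otimes>\<^sub>M borel)"
      using mn(1) mn' by (intro measurable_Pair coord)
    show "q m n \<in> borel_measurable ?PM"
      unfolding q_def using measurable_compose[OF pair, of "case_prod h" borel] comp
      by (intro borel_measurable_times borel_measurable_divide borel_measurable_prod) auto
    have "(\<integral>\<^sup>+x. ennreal (q m n x) \<partial>?PM) =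
        (\<integral>\<^sup>+x. ennreal (h (x m) (x n) / e) * (\<Prod>l\<in>{..<k} - {m, n}. ennreal (D (x l))) \<partial>?PM)"
    proof (intro nn_integral_cong)
      fix x :: "nat \<Rightarrow> real"
      have "ennreal (q m n x) = ennreal (h (x m) (x n) / e) * ennreal (\<Prod>l\<in>{..<k} - {m, n}. D (x l))"
        unfolding q_def using e D_nonneg h_nonneg by (intro ennreal_mult prod_nonneg divide_nonneg_pos) auto
      then show "ennreal (q m n x) = ennreal (h (x m) (x n) / e) * (\<Prod>l\<in>{..<k} - {m, n}. ennreal (D (x l)))"
        using D_nonneg by (simp add: prod_ennreal)
    qed
    also have "\<dots> = (\<integral>\<^sup>+y. \<integral>\<^sup>+z. ennreal (h y z / e) \<partial>lborel \<partial>lborel) * (\<integral>\<^sup>+y. ennreal (D y) \<partial>lborel) ^ (k - 2)"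
      using mn mn' by (intro nn_integral_pair_times_prod[where h = "\<lambda>y z. ennreal (h y z / e)" and d = "\<lambda>y. ennreal (D y)"]) auto
    also have "\<dots> \<le> ennreal e * ennreal ?B"
    proof (intro mult_mono)
      have "(\<integral>\<^sup>+y. \<integral>\<^sup>+z. ennreal (h y z / e) \<partial>lborel \<partial>lborel) = ennreal (1 / e) * (\<integral>\<^sup>+y. \<integral>\<^sup>+z. ennreal (h y z) \<partial>lborel \<partial>lborel)"
        using e h_nonneg
        by (simp add: nn_integral_cmult[symmetric] ennreal_mult[symmetric] flip: nn_integral_cmult)
      also have "\<dots> \<le> ennreal (1 / e) * ennreal (e\<^sup>2)" using HS by (intro mult_left_mono) (auto simp: h_def)
      also have "\<dots> = ennreal e" using e by (simp add: ennreal_mult[symmetric] power2_eq_square)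
      finally show "(\<integral>\<^sup>+y. \<integral>\<^sup>+z. ennreal (h y z / e) \<partial>lborel \<partial>lborel) \<le> ennreal e" .
      show "(\<integral>\<^sup>+y. ennreal (D y) \<partial>lborel) ^ (k - 2) \<le> ennreal ?B"
        unfolding tr using tB[of "k - 2"] kernel_trace_nonneg by (simp add: ennreal_power ennreal_leI)
    qed auto
    finally show "(\<integral>\<^sup>+x. ennreal (q m n x) \<partial>?PM) \<le> ennreal (e * ?B)" using e by (simp add: ennreal_mult')
  qed
  have q_int: "integrable ?PM (q m n)" and q_le: "(\<integral>x. q m n x \<partial>?PM) \<le> e * ?B" if mn: "m < k" "n \<in> {..<k} - {m}" for m n
  proof -
    show int: "integrable ?PM (q m n)"
      using q_nn[OF mn] q_meas[OF mn] q_nonneg by (intro integrableI_nonneg) (auto intro: le_less_trans)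
    have "ennreal (\<integral>x. q m n x \<partial>?PM) \<le> ennreal (e * ?B)"
      using q_nn[OF mn] nn_integral_eq_integral[OF int] q_nonneg by simp
    then show "(\<integral>x. q m n x \<partial>?PM) \<le> e * ?B"
      using e B by (subst (asm) ennreal_le_iff) auto
  qed
  have Dk_int: "integrable ?PM (\<lambda>x. \<Prod>j<k. D (x j))" and Dk: "(\<integral>x. (\<Prod>j<k. D (x j)) \<partial>?PM) = kernel_trace K S ^ k"
    using integral_lborel_power[OF D_int, of k] by (simp_all add: kernel_trace_def D_def)
  let ?Q = "\<lambda>x. fact k * (\<Sum>m<k. \<Sum>n\<in>{..<k} - {m}. q m n x + e * (\<Prod>j<k. D (x j)))"
  have Q_int: "integrable ?PM ?Q"
    using q_int Dk_int by (intro integrable_mult_right Bochner_Integration.integrable_sum Bochner_Integration.integrable_add) auto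
  have "minor_integral K S k - kernel_trace K S ^ k =
      (\<integral>x. (\<Prod>j<k. indicator S (x j)) * kernel_minor K k x - (\<Prod>j<k. D (x j)) \<partial>?PM)"
    unfolding minor_integral_def Dk[symmetric] using minor_integrable Dk_int by simp
  also have "\<bar>\<dots>\<bar> \<le> (\<integral>x. ?Q x \<partial>?PM)"
  proof (rule integral_abs_bound[THEN order_trans], rule integral_mono)
    show "integrable ?PM (\<lambda>x. \<bar>(\<Prod>j<k. indicator S (x j)) * kernel_minor K k x - (\<Prod>j<k. D (x j))\<bar>)"
      using minor_integrable Dk_int by simp
    show "integrable ?PM ?Q" by (rule Q_int)
    fix x :: "nat \<Rightarrow> real"
    show "\<bar>(\<Prod>j<k. indicator S (x j)) * kernel_minor K k x - (\<Prod>j<k. D (x j))\<bar> \<le> ?Q x"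
    proof (cases "\<forall>j<k. x j \<in> S")
      case True
      have "\<bar>fdet k (\<lambda>i j. K (x i) (x j)) - (\<Prod>i<k. K (x i) (x i))\<bar> \<le> fact k *
        (\<Sum>m<k. \<Sum>n\<in>{..<k} - {m}. (K (x m) (x n))\<^sup>2 / e * (\<Prod>l\<in>{..<k} - {m, n}. K (x l) (x l)) + e * (\<Prod>l<k. K (x l) (x l)))"
        by (rule fdet_minus_diag_le[OF K_psd e])
      also have "\<dots> = ?Q x"
        using True by (intro arg_cong[of _ _ "(*) (fact k)"] sum.cong refl arg_cong2[of _ _ _ _ "(+)"])
          (auto simp: q_def h_def D_def intro!: prod.cong)
      finally show ?thesis using True by (simp add: kernel_minor_eq_fdet D_def)
    next
      case False
      then obtain j where j: "j < k" "x j \<notin> S" by blast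
      have z: "(\<Prod>j<k. indicator S (x j) :: real) = 0" "(\<Prod>j<k. D (x j)) = 0"
        using j by (auto intro!: prod_zero bexI[of _ j] simp: D_def)
      have "0 \<le> ?Q x" using q_nonneg e D_nonneg
        by (intro mult_nonneg_nonneg sum_nonneg add_nonneg_nonneg prod_nonneg) auto
      then show ?thesis unfolding z by simp
    qed
  qed
  also have "(\<integral>x. ?Q x \<partial>?PM) = fact k * (\<Sum>m<k. \<Sum>n\<in>{..<k} - {m}. (\<integral>x. q m n x \<partial>?PM) + e * kernel_trace K S ^ k)"
    by (intro has_bochner_integral_integral_eq has_bochner_integral_mult_right has_bochner_integral_sum
        has_bochner_integral_add) (auto simp: has_bochner_integral_iff q_int Dk_int Dk)
  also have "\<dots> \<le> fact k * (\<Sum>m<k. \<Sum>n\<in>{..<k} - {m}. 2 * e * ?B)"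
  proof (intro mult_left_mono sum_mono)
    fix m n assume "m \<in> {..<k}" "n \<in> {..<k} - {m}"
    then have "(\<integral>x. q m n x \<partial>?PM) \<le> e * ?B" by (intro q_le) auto
    moreover have "e * kernel_trace K S ^ k \<le> e * ?B" using e tB[of k] by simp
    ultimately show "(\<integral>x. q m n x \<partial>?PM) + e * kernel_trace K S ^ k \<le> 2 * e * ?B" by simp
  qed simp
  also have "\<dots> \<le> fact k * (\<Sum>m<k. \<Sum>n<k. 2 * e * ?B)"
    using e B by (intro mult_left_mono sum_mono sum_mono2) auto
  also have "\<dots> = 2 * fact k * real k ^ 2 * B ^ k * e" by (simp add: power2_eq_square)
  finally show ?thesis .
qed

text \<open>The error bound grows with \<open>k\<close> like \<open>fact k\<close>, but only its
  limit for fixed \<open>k\<close> enters; uniformity in \<open>k\<close> comes from the common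
  trace bound.\<close>

lemma fredholm_series_tendsto_exp:
  assumes tc: "\<And>n. trace_class_kernel (K n) (S n)"
    and tr: "(\<lambda>n. kernel_trace (K n) (S n)) \<longlonglongrightarrow> \<tau>"
    and HS: "\<And>n. (\<integral>\<^sup>+x. \<integral>\<^sup>+y. ennreal (indicator (S n) x * indicator (S n) y * (K n x y)\<^sup>2) \<partial>lborel \<partial>lborel) \<le> ennreal ((e n)\<^sup>2)"
    and e: "\<And>n. e n > 0" "e \<longlonglongrightarrow> 0"
  shows "(\<lambda>n. fredholm_series (K n) (S n)) \<longlonglongrightarrow> exp (- \<tau>)"
proof -
  from tr have "Bseq (\<lambda>n. kernel_trace (K n) (S n))" by (intro convergent_imp_Bseq convergentI)
  then obtain B0 where "\<And>n. \<bar>kernel_trace (K n) (S n)\<bar> \<le> B0" by (auto simp: Bseq_def)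
  then have B: "kernel_trace (K n) (S n) \<le> max B0 1" for n by (meson abs_le_D1 max.coboundedI1)
  have "(\<lambda>n. fredholm_series (K n) (S n)) \<longlonglongrightarrow> (\<Sum>k. (-1) ^ k / fact k * \<tau> ^ k)"
  proof (rule fredholm_series_tendsto_tannery[OF tc B])
    fix k
    have "(\<lambda>n. minor_integral (K n) (S n) k - kernel_trace (K n) (S n) ^ k) \<longlonglongrightarrow> 0"
    proof (rule Lim_null_comparison)
      show "\<forall>\<^sub>F n in sequentially. norm (minor_integral (K n) (S n) k - kernel_trace (K n) (S n) ^ k)
          \<le> 2 * fact k * real k ^ 2 * max B0 1 ^ k * e n"
      proof (intro always_eventually allI)
        fix n
        interpret trace_class_kernel "K n" "S n" by (rule tc)
        show "norm (minor_integral (K n) (S n) k - kernel_trace (K n) (S n) ^ k) \<le> 2 * fact k * real k ^ 2 * max B0 1 ^ k * e n"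
          unfolding real_norm_def by (rule minor_integral_diff_le[OF HS e(1) B]) simp
      qed
      show "(\<lambda>n. 2 * fact k * real k ^ 2 * max B0 1 ^ k * e n) \<longlonglongrightarrow> 0"
        by (rule tendsto_mult_right_zero[OF e(2)])
    qed
    from tendsto_add[OF this tendsto_power[OF tr, of k]]
    show "(\<lambda>n. minor_integral (K n) (S n) k) \<longlonglongrightarrow> \<tau> ^ k" by simp
  qed
  moreover have "(\<lambda>k. (-1) ^ k / fact k * \<tau> ^ k) sums exp (- \<tau>)"
    using exp_converges[of "- \<tau>"] by (simp add: power_minus[of \<tau>] divide_inverse mult_ac)
  ultimately show ?thesis by (simp add: sums_iff)
qed

section \<open>Kernels with an exponentially bounded weight\<close>

definition weighted_kernel :: "(real \<Rightarrow> real) \<Rightarrow> real \<Rightarrow> real \<Rightarrow> real" where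
  "weighted_kernel w x y = (\<integral>u. w u * (Ai (x + u) * Ai (y + u)) \<partial>lborel)"

lemma interpolating_kernel_eq: "interpolating_kernel \<alpha> = weighted_kernel (\<lambda>u. exp (\<alpha> * u) / (exp (\<alpha> * u) + 1))"
  by (simp add: fun_eq_iff interpolating_kernel_def weighted_kernel_def mult.assoc)

lemma Airy_kernel_eq: "Airy_kernel = weighted_kernel (indicator {0..})"
  by (simp add: fun_eq_iff Airy_kernel_def weighted_kernel_def set_lebesgue_integral_def)

lemma exp_tail_integral:
  fixes \<alpha> t :: real
  assumes "\<alpha> > 0"
  shows "has_bochner_integral lborel (\<lambda>x. indicator {t<..} x * exp (- \<alpha> * x)) (exp (- \<alpha> * t) / \<alpha>)"
proof (rule has_bochner_integral_nn_integral)
  have lim: "((\<lambda>x. - exp (- \<alpha> * x) / \<alpha>) \<longlongrightarrow> - 0 / \<alpha>) at_top"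
  proof (intro tendsto_intros)
    have "filterlim (\<lambda>x. \<alpha> * x) at_top at_top"
      using assms by (intro filterlim_tendsto_pos_mult_at_top[OF tendsto_const] filterlim_ident)
    then have "filterlim (\<lambda>x. - \<alpha> * x) at_bot at_top" by (simp add: filterlim_uminus_at_top)
    then show "((\<lambda>x. exp (- \<alpha> * x)) \<longlongrightarrow> 0) at_top" by (rule filterlim_compose[OF exp_at_bot])
  qed (use assms in auto)
  have "(\<integral>\<^sup>+x. ennreal (exp (- \<alpha> * x)) * indicator {t..} x \<partial>lborel) = ennreal (- 0 / \<alpha> - (- exp (- \<alpha> * t) / \<alpha>))"
    using assms
    by (intro nn_integral_FTC_atLeast[where F = "\<lambda>x. - exp (- \<alpha> * x) / \<alpha>"] lim) (auto intro!: derivative_eq_intros)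
  also have "(\<integral>\<^sup>+x. ennreal (exp (- \<alpha> * x)) * indicator {t..} x \<partial>lborel) =
      (\<integral>\<^sup>+x. ennreal (indicator {t<..} x * exp (- \<alpha> * x)) \<partial>lborel)"
    using AE_lborel_singleton[of t] by (intro nn_integral_cong_AE) (auto simp: indicator_def elim!: eventually_mono)
  finally show "(\<integral>\<^sup>+x. ennreal (indicator {t<..} x * exp (- \<alpha> * x)) \<partial>lborel) = ennreal (exp (- \<alpha> * t) / \<alpha>)" by simp
qed (use assms in auto)

lemma heat_kernel_diag:
  assumes "\<alpha> > 0"
  shows "heat_kernel \<alpha> x x = exp (\<alpha> ^ 3 / 12) / sqrt (4 * pi * \<alpha>) * exp (- \<alpha> * x)"
proof -
  have "normal_density 0 (sqrt (2 * \<alpha>)) (x - x) = 1 / sqrt (4 * pi * \<alpha>)"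
    using assms by (simp add: normal_density_def mult_ac)
  moreover have "exp (\<alpha> ^ 3 / 12 - \<alpha> * (x + x) / 2) = exp (\<alpha> ^ 3 / 12) * exp (- \<alpha> * x)"
    unfolding exp_add[symmetric] by simp
  ultimately show ?thesis by (simp add: heat_kernel_def)
qed

lemma heat_kernel_trace:
  assumes "\<alpha> > 0"
  shows "has_bochner_integral lborel (\<lambda>x. indicator {t<..} x * heat_kernel \<alpha> x x)
    (exp (\<alpha> ^ 3 / 12) / sqrt (4 * pi * \<alpha>) * (exp (- \<alpha> * t) / \<alpha>))"
proof -
  have "has_bochner_integral lborel (\<lambda>x. exp (\<alpha> ^ 3 / 12) / sqrt (4 * pi * \<alpha>) * (indicator {t<..} x * exp (- \<alpha> * x)))
    (exp (\<alpha> ^ 3 / 12) / sqrt (4 * pi * \<alpha>) * (exp (- \<alpha> * t) / \<alpha>))"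
    by (intro has_bochner_integral_mult_right exp_tail_integral assms)
  then show ?thesis by (simp add: heat_kernel_diag[OF assms] mult_ac)
qed

text \<open>On \<open>{t<..}\<close> the factor \<open>exp (u + x)\<close> is at least
  \<open>exp (t + u)\<close>, so the integrand of the heat kernel identity with exponent 1
  dominates.\<close>

lemma Ai_tail_square_integrable: "integrable lborel (\<lambda>x. indicator {t<..} x * (Ai (x + u))\<^sup>2)"
proof (rule Bochner_Integration.integrable_bound)
  have "integrable lborel (\<lambda>x. exp (1 * (u + 1 * x)) * (Ai (0 + (u + 1 * x)) * Ai (0 + (u + 1 * x))))"
    using exp_weighted_Ai_product(1)[of 1 0 0] by (intro lborel_integrable_real_affine) auto
  then show "integrable lborel (\<lambda>x. exp (- (t + u)) * (exp (u + x) * (Ai (x + u))\<^sup>2))"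
    by (simp add: power2_eq_square add.commute)
  show "AE x in lborel. norm (indicator {t<..} x * (Ai (x + u))\<^sup>2) \<le> norm (exp (- (t + u)) * (exp (u + x) * (Ai (x + u))\<^sup>2))"
  proof (intro AE_I2)
    fix x
    have "1 \<le> exp (- (t + u)) * exp (u + x)" if "t < x" unfolding exp_add[symmetric] using that by simp
    then have "indicator {t<..} x * (Ai (x + u))\<^sup>2 \<le> (exp (- (t + u)) * exp (u + x)) * (Ai (x + u))\<^sup>2"
      by (intro mult_right_mono) (auto simp: indicator_def)
    then show "norm (indicator {t<..} x * (Ai (x + u))\<^sup>2) \<le> norm (exp (- (t + u)) * (exp (u + x) * (Ai (x + u))\<^sup>2))"
      by (simp add: abs_mult mult.assoc)
  qed
qed measurable

locale airy_weight =
  fixes w :: "real \<Rightarrow> real" and \<alpha> :: real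
  assumes \<alpha>: "\<alpha> > 0" and w_measurable [measurable]: "w \<in> borel_measurable borel"
    and w_nonneg: "0 \<le> w u" and w_le: "w u \<le> exp (\<alpha> * u)"
begin

text \<open>The factor B in K = B B^T; it makes positivity visible and feeds the duality of Gram
  determinants.\<close>

definition amplitude :: "real \<Rightarrow> real \<Rightarrow> real" where
  "amplitude x u = sqrt (w u) * Ai (x + u)"

lemma amplitude_mult: "amplitude x u * amplitude y u = w u * (Ai (x + u) * Ai (y + u))"
proof -
  have "amplitude x u * amplitude y u = (sqrt (w u) * sqrt (w u)) * (Ai (x + u) * Ai (y + u))"
    by (simp add: amplitude_def mult_ac)
  then show ?thesis using w_nonneg by simp
qed

lemma amplitude_measurable [measurable]: "case_prod amplitude \<in> borel_measurable (borel \<Otimes>\<^sub>M borel)"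
  unfolding amplitude_def by measurable

lemma weighted_kernel_amplitude: "weighted_kernel w x y = (\<integral>u. amplitude x u * amplitude y u \<partial>lborel)"
  by (simp add: weighted_kernel_def amplitude_mult)

lemma amplitude_square_integrable: "integrable lborel (\<lambda>u. (amplitude x u)\<^sup>2)"
proof (rule Bochner_Integration.integrable_bound[OF exp_weighted_Ai_product(1)[OF \<alpha>, of x x]])
  have "w u * (Ai (x + u))\<^sup>2 \<le> exp (\<alpha> * u) * (Ai (x + u))\<^sup>2" for u
    using w_le by (intro mult_right_mono) auto
  then show "AE u in lborel. norm ((amplitude x u)\<^sup>2) \<le> norm (exp (\<alpha> * u) * (Ai (x + u) * Ai (x + u)))"
    using w_nonneg by (intro AE_I2) (simp add: power2_eq_square amplitude_mult abs_mult)
qed measurable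

lemma amplitude_integrable: "integrable lborel (\<lambda>u. amplitude x u * amplitude y u)"
  by (intro integrable_mult_of_squares amplitude_square_integrable) auto

sublocale psd_kernel "weighted_kernel w"
proof
  show "case_prod (weighted_kernel w) \<in> borel_measurable (borel \<Otimes>\<^sub>M borel)"
    unfolding weighted_kernel_def[abs_def] by measurable
  show "psd k (\<lambda>i j. weighted_kernel w (x i) (x j))" for k x
    unfolding psd_def
  proof (intro conjI allI impI)
    show "weighted_kernel w (x i) (x j) = weighted_kernel w (x j) (x i)" for i j
      by (simp add: weighted_kernel_def mult.commute)
    fix v :: "nat \<Rightarrow> real"
    have "0 \<le> (\<integral>u. (\<Sum>i<k. v i * amplitude (x i) u)\<^sup>2 \<partial>lborel)" by simp
    also have "\<dots> = (\<integral>u. (\<Sum>i<k. \<Sum>j<k. v i * v j * (amplitude (x i) u * amplitude (x j) u)) \<partial>lborel)"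
      by (simp add: power2_eq_square sum_product mult_ac)
    also have "\<dots> = (\<Sum>i<k. \<Sum>j<k. v i * v j * weighted_kernel w (x i) (x j))"
      unfolding weighted_kernel_amplitude
      by (intro has_bochner_integral_integral_eq has_bochner_integral_sum has_bochner_integral_mult_right
          has_bochner_integral_integrable amplitude_integrable)
    finally show "0 \<le> (\<Sum>i<k. \<Sum>j<k. v i * v j * weighted_kernel w (x i) (x j))" .
  qed
qed

lemma weighted_kernel_diag_le: "weighted_kernel w x x \<le> heat_kernel \<alpha> x x"
  unfolding weighted_kernel_def exp_weighted_Ai_product(2)[OF \<alpha>, symmetric]
  using amplitude_integrable[of x x] w_le
  by (intro integral_mono exp_weighted_Ai_product(1) \<alpha>) (auto simp: amplitude_mult intro!: mult_right_mono)

lemma trace_class: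
  assumes S: "S \<in> sets borel" "S \<subseteq> {t<..}"
  shows "trace_class_kernel (weighted_kernel w) S"
proof
  show "integrable lborel (\<lambda>x. indicator S x * weighted_kernel w x x)"
  proof (rule Bochner_Integration.integrable_bound)
    show "integrable lborel (\<lambda>x. indicator {t<..} x * heat_kernel \<alpha> x x)"
      using heat_kernel_trace[OF \<alpha>] by (rule integrable.intros)
    show "AE x in lborel. norm (indicator S x * weighted_kernel w x x) \<le> norm (indicator {t<..} x * heat_kernel \<alpha> x x)"
    proof (intro AE_I2)
      fix x
      show "norm (indicator S x * weighted_kernel w x x) \<le> norm (indicator {t<..} x * heat_kernel \<alpha> x x)"
        using weighted_kernel_diag_le[of x] K_diag_nonneg[of x] S(2) by (auto simp: indicator_def)
    qed
  qed (use S(1) in measurable)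
qed (rule S(1))

text \<open>The basis lives on the restricted measure, the minors on Lebesgue measure with
  indicators. Instead of comparing the two product spaces, duality passes to the weight variable,
  where both have the same Gram matrix, and back.\<close>

lemma minor_integral_has_sum:
  assumes e: "L2_orthonormal_basis {t<..} e"
  shows "((\<lambda>i. Determinant.det (mat k k (\<lambda>(a, b). L2_inner {t<..} (e (i a)) (integral_operator {t<..} (weighted_kernel w) (e (i b))))))
    has_sum minor_integral (weighted_kernel w) {t<..} k / fact k) (increasing_tuples k)"
proof -
  let ?S = "{t<..}" and ?K = "weighted_kernel w"
  let ?M = "restrict_space lborel ?S"
  let ?b' = "\<lambda>x u. indicator ?S x * amplitude x u"
  interpret trace_class_kernel ?K ?S by (rule trace_class) auto
  interpret orthonormal_basis ?M e using e by (simp add: L2_orthonormal_basis_iff)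
  have M: "sigma_finite_measure ?M" by (intro sigma_finite_measure_restrict_space sigma_finite_lborel) simp
  have N: "sigma_finite_measure (lborel :: real measure)" by (rule sigma_finite_lborel)
  interpret M: sigma_finite_measure ?M by (rule M)
  interpret MN: pair_sigma_finite ?M "lborel :: real measure" by standard
  have id_meas: "(\<lambda>x. x) \<in> measurable ?M borel" by (rule measurable_restrict_space1) simp
  have amp_meas: "case_prod amplitude \<in> borel_measurable (?M \<Otimes>\<^sub>M lborel)"
  proof -
    have "(\<lambda>p. (fst p, snd p)) \<in> measurable (?M \<Otimes>\<^sub>M lborel) (borel \<Otimes>\<^sub>M borel)"
      by (intro measurable_Pair measurable_compose[OF measurable_fst id_meas]) (auto intro: measurable_compose[OF measurable_snd])
    from measurable_compose[OF this amplitude_measurable] show ?thesis by simp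
  qed
  have ampM: "integrable ?M (\<lambda>x. (amplitude x u)\<^sup>2)" for u
  proof -
    have "integrable lborel (\<lambda>x. w u * (indicator ?S x * (Ai (x + u))\<^sup>2))"
      by (intro integrable_mult_right Ai_tail_square_integrable)
    then show ?thesis
      using w_nonneg by (simp add: integrable_restrict_space amplitude_def power_mult_distrib mult.left_commute)
  qed
  have amp2: "integrable (?M \<Otimes>\<^sub>M lborel) (\<lambda>(x, u). (amplitude x u)\<^sup>2)"
  proof (rule MN.Fubini_integrable)
    show "(\<lambda>(x, u). (amplitude x u)\<^sup>2) \<in> borel_measurable (?M \<Otimes>\<^sub>M lborel)"
      using borel_measurable_power[OF amp_meas, of 2] by (simp add: split_beta')
    have "(\<lambda>x. \<integral>u. norm (case (x, u) of (x, u) \<Rightarrow> (amplitude x u)\<^sup>2) \<partial>lborel) = (\<lambda>x. ?K x x)"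
      by (simp add: weighted_kernel_amplitude power2_eq_square)
    then show "integrable ?M (\<lambda>x. \<integral>u. norm (case (x, u) of (x, u) \<Rightarrow> (amplitude x u)\<^sup>2) \<partial>lborel)"
      using trace by (simp add: integrable_restrict_space)
    show "AE x in ?M. integrable lborel (\<lambda>u. case (x, u) of (x, u) \<Rightarrow> (amplitude x u)\<^sup>2)"
      using amplitude_square_integrable by simp
  qed
  have "(\<integral>\<^sup>+x. ennreal (fdet k (\<lambda>i j. \<integral>u. amplitude (x i) u * amplitude (x j) u \<partial>lborel)) \<partial>(\<Pi>\<^sub>M i\<in>{..<k}. ?M)) =
      (\<integral>\<^sup>+z. ennreal (fdet k (\<lambda>i j. \<integral>x. amplitude x (z i) * amplitude x (z j) \<partial>?M)) \<partial>(\<Pi>\<^sub>M i\<in>{..<k}. lborel))"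
    by (intro gram_det_duality M N amp_meas amplitude_square_integrable ampM)
  also have "\<dots> = (\<integral>\<^sup>+z. ennreal (fdet k (\<lambda>i j. \<integral>x. ?b' x (z i) * ?b' x (z j) \<partial>lborel)) \<partial>(\<Pi>\<^sub>M i\<in>{..<k}. lborel))"
  proof -
    have "(\<integral>x. amplitude x u * amplitude x v \<partial>?M) = (\<integral>x. ?b' x u * ?b' x v \<partial>lborel)" for u v
      by (subst integral_restrict_space) (auto intro!: Bochner_Integration.integral_cong simp: indicator_def)
    then show ?thesis by simp
  qed
  also have "\<dots> = (\<integral>\<^sup>+x. ennreal (fdet k (\<lambda>i j. \<integral>u. ?b' (x i) u * ?b' (x j) u \<partial>lborel)) \<partial>(\<Pi>\<^sub>M i\<in>{..<k}. lborel))"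
  proof (intro gram_det_duality[symmetric] N)
    show "(\<lambda>(x, u). ?b' x u) \<in> borel_measurable (lborel \<Otimes>\<^sub>M lborel)" by measurable
    show "integrable lborel (\<lambda>u. (?b' x u)\<^sup>2)" for x
      using amplitude_square_integrable by (simp add: power_mult_distrib)
    show "integrable lborel (\<lambda>x. (?b' x u)\<^sup>2)" for u
    proof -
      have "(\<lambda>x. (?b' x u)\<^sup>2) = (\<lambda>x. indicator ?S x * (amplitude x u)\<^sup>2)" by (auto simp: indicator_def)
      then show ?thesis using ampM[of u] by (simp add: integrable_restrict_space)
    qed
  qed
  also have "\<dots> = (\<integral>\<^sup>+x. ennreal ((\<Prod>j<k. indicator ?S (x j)) * kernel_minor ?K k x) \<partial>(\<Pi>\<^sub>M i\<in>{..<k}. lborel))"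
  proof (intro nn_integral_cong arg_cong[of _ _ ennreal])
    fix x :: "nat \<Rightarrow> real"
    have gram: "(\<integral>u. ?b' (x i) u * ?b' (x j) u \<partial>lborel) = indicator ?S (x i) * (indicator ?S (x j) * ?K (x i) (x j))" for i j
      by (simp add: weighted_kernel_amplitude mult_ac flip: integral_mult_right_zero)
    show "fdet k (\<lambda>i j. \<integral>u. ?b' (x i) u * ?b' (x j) u \<partial>lborel) = (\<Prod>j<k. indicator ?S (x j)) * kernel_minor ?K k x"
    proof (cases "\<forall>j<k. x j \<in> ?S")
      case True
      then have "fdet k (\<lambda>i j. \<integral>u. ?b' (x i) u * ?b' (x j) u \<partial>lborel) = kernel_minor ?K k x"
        unfolding gram kernel_minor_eq_fdet by (intro fdet_cong) auto
      then show ?thesis using True by simp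
    next
      case False
      then obtain j where j: "j < k" "x j \<notin> ?S" by blast
      then have "fdet k (\<lambda>i j. \<integral>u. ?b' (x i) u * ?b' (x j) u \<partial>lborel) = 0"
        unfolding gram by (intro fdet_zero_row[of j]) auto
      moreover have "(\<Prod>j<k. indicator ?S (x j) :: real) = 0"
        using j by (auto intro!: prod_zero bexI[of _ j])
      ultimately show ?thesis by simp
    qed
  qed
  also have "\<dots> = ennreal (minor_integral ?K ?S k)"
    unfolding minor_integral_def by (intro nn_integral_eq_integral minor_integrable AE_I2 minor_bounds)
  finally have T: "(\<integral>\<^sup>+x. ennreal (fdet k (\<lambda>i j. \<integral>u. amplitude (x i) u * amplitude (x j) u \<partial>lborel)) \<partial>(\<Pi>\<^sub>M i\<in>{..<k}. ?M)) =
    ennreal (minor_integral ?K ?S k)" .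
  have "((\<lambda>i. fdet k (\<lambda>m n. \<integral>x. e (i m) x * (\<integral>y. (\<integral>u. amplitude x u * amplitude y u \<partial>lborel) * e (i n) y \<partial>?M) \<partial>?M))
    has_sum (minor_integral ?K ?S k / fact k)) (increasing_tuples k)"
    by (rule trace_exterior_power_gram[OF M N amp_meas amplitude_square_integrable ampM amp2 T minor_integral_nonneg])
  then show ?thesis
    unfolding fdet_def by (simp add: L2_inner_eq integral_operator_def set_lebesgue_integral_def integral_restrict_space weighted_kernel_amplitude)
qed

lemma fredholm_det_eq_series:
  "fredholm_det {t<..} (integral_operator {t<..} (weighted_kernel w)) = fredholm_series (weighted_kernel w) {t<..}"
proof -
  have "trace_exterior_power {t<..} (integral_operator {t<..} (weighted_kernel w)) k =
      minor_integral (weighted_kernel w) {t<..} k / fact k" for k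
    unfolding trace_exterior_power_def
  proof (rule the_equality)
    show "\<forall>e. L2_orthonormal_basis {t<..} e \<longrightarrow>
        ((\<lambda>i. Determinant.det (mat k k (\<lambda>(a, b). L2_inner {t<..} (e (i a)) (integral_operator {t<..} (weighted_kernel w) (e (i b))))))
          has_sum minor_integral (weighted_kernel w) {t<..} k / fact k) (increasing_tuples k)"
      using minor_integral_has_sum by blast
    obtain e where e: "L2_orthonormal_basis {t<..} e" using orthonormal_basis_Ioi_exists by blast
    fix \<tau>
    assume "\<forall>e. L2_orthonormal_basis {t<..} e \<longrightarrow>
        ((\<lambda>i. Determinant.det (mat k k (\<lambda>(a, b). L2_inner {t<..} (e (i a)) (integral_operator {t<..} (weighted_kernel w) (e (i b))))))
          has_sum \<tau>) (increasing_tuples k)"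
    with e minor_integral_has_sum[OF e, of k] show "\<tau> = minor_integral (weighted_kernel w) {t<..} k / fact k"
      using has_sum_unique by blast
  qed
  then show ?thesis by (simp add: fredholm_det_def fredholm_series_def)
qed

end

lemma airy_weight_interpolating:
  assumes "\<alpha> > 0"
  shows "airy_weight (\<lambda>u. exp (\<alpha> * u) / (exp (\<alpha> * u) + 1)) \<alpha>"
proof
  show "exp (\<alpha> * u) / (exp (\<alpha> * u) + 1) \<le> exp (\<alpha> * u)" for u
    by (simp add: divide_le_eq add_pos_pos mult_le_cancel_left1)
qed (use assms in \<open>auto simp: add_pos_pos less_imp_le\<close>)

lemma airy_weight_Airy: "airy_weight (indicator {0..}) 1"
  by standard (auto simp: indicator_def)

section \<open>Gap probabilities of determinantal processes\<close>

text \<open>Once the coefficients of the difference below \<open>n\<close> vanish, dividing by z^n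
  and letting z tend to 0 isolates the n-th one.\<close>

lemma power_series_coeffs_unique:
  fixes a b :: "nat \<Rightarrow> real"
  assumes a: "\<And>z. \<bar>z\<bar> < 1 \<Longrightarrow> (\<lambda>n. a n * z ^ n) sums f z"
    and b: "\<And>z. \<bar>z\<bar> < 1 \<Longrightarrow> (\<lambda>n. b n * z ^ n) sums f z"
  shows "a n = b n"
proof -
  define c where "c = (\<lambda>n. a n - b n)"
  have c: "(\<lambda>n. c n * z ^ n) sums 0" if "\<bar>z\<bar> < 1" for z
    using sums_diff[OF a[OF that] b[OF that]] by (simp add: c_def left_diff_distrib)
  have "c n = 0" for n
  proof (induction n rule: less_induct)
    case (less n)
    have "(\<lambda>m. c (m + n) * z ^ m) sums 0" if z: "z \<noteq> 0" "norm z < 1" for z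
    proof -
      have "(\<Sum>i<n. c i * z ^ i) = 0" using less by simp
      then have "(\<lambda>m. c (m + n) * z ^ (m + n)) sums 0"
        using c[of z] z by (subst sums_iff_shift) simp
      from sums_mult[OF this, of "1 / z ^ n"] show ?thesis using z by (simp add: power_add)
    qed
    then have "((\<lambda>_. 0) \<longlongrightarrow> c (0 + n)) (at (0::real))"
      by (intro powser_limit_0_strong[of 1 "\<lambda>m. c (m + n)" "\<lambda>_. 0"]) auto
    then show ?case by (simp add: tendsto_const_iff)
  qed
  then show ?thesis by (simp add: c_def)
qed

text \<open>The binomial theorem expands (1 + z)^N; for |z| < 1 the absolute sums are at most 2^N,
  which is integrable, so sum and expectation can be exchanged.\<close>

lemma binomial_moment_series:
  fixes N :: "'w \<Rightarrow> nat"
  assumes [measurable]: "N \<in> measurable P (count_space UNIV)"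
    and int: "integrable P (\<lambda>w. 2 ^ N w :: real)" and z: "\<bar>z\<bar> < 1"
  shows "integrable P (\<lambda>w. real (N w choose k))"
    and "(\<lambda>k. (\<integral>w. real (N w choose k) \<partial>P) * z ^ k) sums (\<integral>w. (1 + z) ^ N w \<partial>P)"
proof -
  have choose_le: "n choose k \<le> 2 ^ n" for n k
  proof -
    have "n choose k \<le> (\<Sum>k\<le>n. n choose k)"
      by (cases "k \<le> n") (auto intro: member_le_sum simp: binomial_eq_0)
    then show ?thesis by (simp only: choose_row_sum)
  qed
  show choose_int: "integrable P (\<lambda>w. real (N w choose k))" for k
  proof (rule Bochner_Integration.integrable_bound[OF int])
    show "AE w in P. norm (real (N w choose k)) \<le> norm (2 ^ N w :: real)"
      using choose_le by (intro AE_I2) simp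
  qed measurable
  have finite_sum: "(\<lambda>k. real (n choose k) * x ^ k) sums (1 + x) ^ n" for n and x :: real
  proof -
    have "(\<lambda>k. real (n choose k) * x ^ k) sums (\<Sum>k\<le>n. real (n choose k) * x ^ k)"
      by (intro sums_finite) auto
    then show ?thesis using binomial_ring[of x 1 n] by (simp add: add.commute)
  qed
  have "(\<lambda>k. \<integral>w. real (N w choose k) * z ^ k \<partial>P) sums (\<integral>w. (\<Sum>k. real (N w choose k) * z ^ k) \<partial>P)"
  proof (rule sums_integral)
    show "integrable P (\<lambda>w. real (N w choose k) * z ^ k)" for k using choose_int by simp
    show "AE w in P. summable (\<lambda>k. norm (real (N w choose k) * z ^ k))"
      using finite_sum[of _ "\<bar>z\<bar>"] by (intro AE_I2) (simp add: abs_mult power_abs sums_iff)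
    show "summable (\<lambda>k. \<integral>w. norm (real (N w choose k) * z ^ k) \<partial>P)"
    proof (rule bounded_imp_summable)
      fix n
      have "(\<Sum>k\<le>n. \<integral>w. norm (real (N w choose k) * z ^ k) \<partial>P) = (\<integral>w. (\<Sum>k\<le>n. real (N w choose k) * \<bar>z\<bar> ^ k) \<partial>P)"
        using choose_int by (simp add: abs_mult power_abs)
      also have "\<dots> \<le> (\<integral>w. 2 ^ N w \<partial>P)"
      proof (rule integral_mono)
        show "integrable P (\<lambda>w. \<Sum>k\<le>n. real (N w choose k) * \<bar>z\<bar> ^ k)" using choose_int by simp
        show "integrable P (\<lambda>w. 2 ^ N w :: real)" by (rule int)
        fix w
        have "(\<Sum>k\<le>n. real (N w choose k) * \<bar>z\<bar> ^ k) \<le> (\<Sum>k. real (N w choose k) * \<bar>z\<bar> ^ k)"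
          using finite_sum[of "N w" "\<bar>z\<bar>"] by (intro sum_le_suminf) (auto simp: sums_iff)
        also have "\<dots> = (1 + \<bar>z\<bar>) ^ N w" using finite_sum by (rule sums_unique[symmetric])
        also have "\<dots> \<le> 2 ^ N w" using z by (intro power_mono) auto
        finally show "(\<Sum>k\<le>n. real (N w choose k) * \<bar>z\<bar> ^ k) \<le> 2 ^ N w" .
      qed
      finally show "(\<Sum>k\<le>n. \<integral>w. norm (real (N w choose k) * z ^ k) \<partial>P) \<le> (\<integral>w. 2 ^ N w \<partial>P)" .
    qed simp
  qed
  then show "(\<lambda>k. (\<integral>w. real (N w choose k) \<partial>P) * z ^ k) sums (\<integral>w. (1 + z) ^ N w \<partial>P)"
    using finite_sum[THEN sums_unique] by simp
qed

text \<open>\<open>trace\<close> will exclude particles arbitrarily far to the right, and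
  \<open>trace_unbounded\<close> the empty configuration.\<close>

locale determinantal = psd_kernel +
  fixes P :: "'w measure" and X :: "'w \<Rightarrow> real \<Rightarrow> nat"
  assumes determinantal: "determinantal_process P X K"
    and trace: "integrable lborel (\<lambda>x. indicator {t<..} x * K x x)"
    and trace_unbounded: "\<exists>n::nat. B \<le> kernel_trace K {- real n<..real n}"
begin

sublocale prob_space P
  using determinantal by (simp add: determinantal_process_def point_process_def)

lemma locally_finite: "w \<in> space P \<Longrightarrow> locally_finite_config (X w)"
  using determinantal by (simp add: determinantal_process_def point_process_def)

lemma particle_count_measurable:
  "B \<in> sets borel \<Longrightarrow> bounded B \<Longrightarrow> (\<lambda>w. particle_count (X w) B) \<in> measurable P (count_space UNIV)"
  using determinantal by (simp add: determinantal_process_def point_process_def)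

lemma trace_class_Ioi:
  assumes "S \<in> sets borel" "S \<subseteq> {t<..}"
  shows "trace_class_kernel K S"
proof
  have "integrable lborel (\<lambda>x. indicator S x *\<^sub>R (indicator {t<..} x * K x x))"
    using assms(1) by (intro integrable_mult_indicator trace) auto
  also have "(\<lambda>x. indicator S x *\<^sub>R (indicator {t<..} x * K x x)) = (\<lambda>x. indicator S x * K x x)"
    using assms(2) by (auto simp: indicator_def fun_eq_iff)
  finally show "integrable lborel (\<lambda>x. indicator S x * K x x)" .
qed (rule assms(1))

lemma kernel_trace_mono:
  assumes "S \<in> sets borel" "T \<in> sets borel" "S \<subseteq> T" "T \<subseteq> {t<..}"
  shows "kernel_trace K S \<le> kernel_trace K T"
  unfolding kernel_trace_def
proof (rule integral_mono)
  show "integrable lborel (\<lambda>x. indicator S x * K x x)" "integrable lborel (\<lambda>x. indicator T x * K x x)"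
    using trace_class_Ioi[of S t] trace_class_Ioi[of T t] assms by (auto simp: trace_class_kernel_def trace_class_kernel_axioms_def)
  show "indicator S x * K x x \<le> indicator T x * K x x" for x
    using assms(3) K_diag_nonneg[of x] by (auto simp: indicator_def)
qed

lemma generating_function:
  assumes B: "B \<in> sets borel" "bounded B"
  shows "integrable P (\<lambda>w. (1 + z) ^ particle_count (X w) B)"
    and "(\<lambda>k. z ^ k / fact k * minor_integral K B k) sums (\<integral>w. (1 + z) ^ particle_count (X w) B \<partial>P)"
proof -
  define \<phi> where "\<phi> = (\<lambda>x. z * indicator B x)"
  have test: "test_function \<phi>"
    unfolding test_function_def
  proof (intro conjI)
    show "\<phi> \<in> borel_measurable borel" using B(1) unfolding \<phi>_def by measurable
    show "bounded (range \<phi>)"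
      by (rule boundedI[of _ "\<bar>z\<bar>"]) (auto simp: \<phi>_def indicator_def)
    have "bounded {x. \<phi> x \<noteq> 0}" by (rule bounded_subset[OF B(2)]) (auto simp: \<phi>_def indicator_def)
    then show "compact (closure {x. \<phi> x \<noteq> 0})" by (simp add: compact_closure)
  qed
  have prod: "particle_product \<phi> (X w) = (1 + z) ^ particle_count (X w) B" for w
  \<comment> \<open>For \<open>z = 0\<close> no point has \<open>\<phi> x \<noteq> 0\<close> and the
    product is empty; otherwise exactly the particles in \<open>B\<close> contribute.\<close>
  proof (cases "z = 0")
    case True then show ?thesis by (simp add: particle_product_def \<phi>_def)
  next
    case False
    then have "{x. 0 < X w x \<and> \<phi> x \<noteq> 0} = {x. x \<in> B \<and> 0 < X w x}" by (auto simp: \<phi>_def indicator_def)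
    then show ?thesis
      by (auto simp: particle_product_def particle_count_def power_sum \<phi>_def intro!: prod.cong)
  qed
  have corr: "(\<Prod>j<k. \<phi> (x j)) * kernel_minor K k x = z ^ k * ((\<Prod>j<k. indicator B (x j)) * kernel_minor K k x)" for k x
    by (simp add: \<phi>_def prod.distrib)
  have C: "correlation_functions P X (kernel_minor K)"
    using determinantal by (simp add: determinantal_process_def)
  from C[unfolded correlation_functions_def, rule_format, OF test]
  show "integrable P (\<lambda>w. (1 + z) ^ particle_count (X w) B)"
    and "(\<lambda>k. z ^ k / fact k * minor_integral K B k) sums (\<integral>w. (1 + z) ^ particle_count (X w) B \<partial>P)"
    unfolding prod corr minor_integral_def by (simp_all add: mult.commute)
qed

lemma particle_count_eq_0_iff:
  assumes "w \<in> space P" "bounded B"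
  shows "particle_count (X w) B = 0 \<longleftrightarrow> (\<forall>x\<in>B. X w x = 0)"
  using locally_finite[OF assms(1)] assms(2)
  by (auto simp: particle_count_def locally_finite_config_def)

text \<open>Both sides are coefficients of the generating function in z, by the binomial theorem and
  by the correlation identity respectively. Its value at z = 1 supplies integrability of
  2^N.\<close>

lemma binomial_moment:
  assumes B: "B \<in> sets borel" "bounded B"
  shows "integrable P (\<lambda>w. real (particle_count (X w) B choose k))"
    and "(\<integral>w. real (particle_count (X w) B choose k) \<partial>P) = minor_integral K B k / fact k"
proof -
  have int: "integrable P (\<lambda>w. 2 ^ particle_count (X w) B :: real)"
    using generating_function(1)[OF B, of 1] by simp
  note N = particle_count_measurable[OF B]
  show "integrable P (\<lambda>w. real (particle_count (X w) B choose k))"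
    by (rule binomial_moment_series(1)[OF N int, of 0]) simp
  show "(\<integral>w. real (particle_count (X w) B choose k) \<partial>P) = minor_integral K B k / fact k"
  proof (rule power_series_coeffs_unique)
    fix z :: real assume z: "\<bar>z\<bar> < 1"
    show "(\<lambda>k. (\<integral>w. real (particle_count (X w) B choose k) \<partial>P) * z ^ k) sums (\<integral>w. (1 + z) ^ particle_count (X w) B \<partial>P)"
      by (rule binomial_moment_series(2)[OF N int z])
    show "(\<lambda>k. minor_integral K B k / fact k * z ^ k) sums (\<integral>w. (1 + z) ^ particle_count (X w) B \<partial>P)"
      using generating_function(2)[OF B, of z] by (simp add: mult.commute)
  qed
qed

lemma minor_integral_1: "minor_integral K B 1 = kernel_trace K B" if "B \<in> sets borel"
proof -
  have [measurable]: "B \<in> sets borel" by (rule that)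
  have [simp]: "{..<Suc 0} = {0::nat}" by auto
  have minor: "kernel_minor K 1 x = K (x 0) (x 0)" for x
  proof -
    have "{p. p permutes {0::nat}} = {id}" by auto
    then show ?thesis by (simp add: kernel_minor_eq_fdet fdet_leibniz sign_id)
  qed
  have "minor_integral K B 1 = (\<integral>x. indicator B (x 0) * K (x 0) (x 0) \<partial>(\<Pi>\<^sub>M i\<in>{0::nat}. lborel))"
    unfolding minor_integral_def minor by simp
  also have "\<dots> = kernel_trace K B"
    unfolding kernel_trace_def
    by (rule lborel_product.product_integral_singleton[of "\<lambda>x. indicator B x * K x x"]) measurable
  finally show ?thesis .
qed

definition count :: "real set \<Rightarrow> 'w \<Rightarrow> real" where
  "count B w = real (particle_count (X w) B)"

text \<open>N^2 = 2 (N choose 2) + N, and the expectation of 2 (N choose 2) is a minor integral, at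
  most the squared trace by Hadamard's inequality; this is what bounds the variance by the
  mean.\<close>

lemma count_moments:
  assumes B: "B \<in> sets borel" "bounded B"
  shows "integrable P (count B)" "expectation (count B) = kernel_trace K B"
    and "integrable P (\<lambda>w. (count B w)\<^sup>2)"
    and "expectation (\<lambda>w. (count B w)\<^sup>2) \<le> (kernel_trace K B)\<^sup>2 + kernel_trace K B"
proof -
  from B(2) obtain b where b: "B \<subseteq> {b<..}"
  proof -
    obtain a where "\<forall>x\<in>B. \<bar>x\<bar> \<le> a" using B(2) by (auto simp: bounded_iff)
    then have "B \<subseteq> {- a - 1<..}" by (force simp: abs_le_iff)
    then show thesis by (rule that)
  qed
  interpret trace_class_kernel K B by (rule trace_class_Ioi[OF B(1) b])
  have c: "real (particle_count (X w) B choose 1) = count B w" for w by (simp add: count_def)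
  show int1: "integrable P (count B)"
    using binomial_moment(1)[OF B, of 1] unfolding c .
  show e1: "expectation (count B) = kernel_trace K B"
    using binomial_moment(2)[OF B, of 1] unfolding c minor_integral_1[OF B(1)] by simp
  have sq: "(count B w)\<^sup>2 = 2 * real (particle_count (X w) B choose 2) + count B w" for w
  proof -
    have "2 * real (n choose 2) = real n * (real n - 1)" for n
    proof (cases n)
      case (Suc m)
      have "even (n * (n - 1))" by auto
      then have "2 * (n choose 2) = n * (n - 1)" unfolding choose_two by (rule dvd_mult_div_cancel)
      then have "real (2 * (n choose 2)) = real (n * (n - 1))" by simp
      then show ?thesis using Suc by (simp add: algebra_simps)
    qed simp
    then show ?thesis by (simp add: count_def power2_eq_square algebra_simps)
  qed
  show "integrable P (\<lambda>w. (count B w)\<^sup>2)"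
    unfolding sq using binomial_moment(1)[OF B, of 2] int1 by simp
  have "expectation (\<lambda>w. (count B w)\<^sup>2) = minor_integral K B 2 + kernel_trace K B"
    unfolding sq using binomial_moment[OF B, of 2] int1 e1 by simp
  then show "expectation (\<lambda>w. (count B w)\<^sup>2) \<le> (kernel_trace K B)\<^sup>2 + kernel_trace K B"
    using minor_integral_le[of 2] by simp
qed

lemma gap_event:
  assumes B: "B \<in> sets borel" "bounded B"
  shows "{w \<in> space P. \<forall>x\<in>B. X w x = 0} \<in> events"
    and "prob {w \<in> space P. \<forall>x\<in>B. X w x = 0} = fredholm_series K B"
proof -
  have eq: "{w \<in> space P. \<forall>x\<in>B. X w x = 0} = {w \<in> space P. particle_count (X w) B = 0}"
    using particle_count_eq_0_iff[OF _ B(2)] by auto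
  note [measurable] = particle_count_measurable[OF B]
  show ev: "{w \<in> space P. \<forall>x\<in>B. X w x = 0} \<in> events" unfolding eq by measurable
  \<comment> \<open>Since 0^0 = 1, the power with base 0 is the indicator of there being no particle
    in \<open>B\<close>.\<close>
  have "(\<integral>w. (1 + - 1 :: real) ^ particle_count (X w) B \<partial>P) = (\<integral>w. indicator {w \<in> space P. \<forall>x\<in>B. X w x = 0} w \<partial>P)"
    unfolding eq by (intro Bochner_Integration.integral_cong) (auto simp: indicator_def zero_power)
  also have "\<dots> = prob {w \<in> space P. \<forall>x\<in>B. X w x = 0}" using ev by simp
  finally show "prob {w \<in> space P. \<forall>x\<in>B. X w x = 0} = fredholm_series K B"
    using generating_function(2)[OF B, of "- 1"] by (simp add: fredholm_series_def sums_iff)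
qed

text \<open>The upper bound is Chebyshev's inequality: the variance of the number of particles in \<open>B\<close> is at most
  its mean.\<close>

lemma gap_prob_bounds:
  assumes B: "B \<in> sets borel" "bounded B"
  shows "1 - kernel_trace K B \<le> prob {w \<in> space P. \<forall>x\<in>B. X w x = 0}"
    and "0 < kernel_trace K B \<Longrightarrow> prob {w \<in> space P. \<forall>x\<in>B. X w x = 0} \<le> 1 / kernel_trace K B"
proof -
  let ?E = "{w \<in> space P. \<forall>x\<in>B. X w x = 0}"
  let ?\<mu> = "kernel_trace K B"
  note ev = gap_event(1)[OF B] and M = count_moments[OF B]
  have cE: "count B w = 0 \<longleftrightarrow> w \<in> ?E" if "w \<in> space P" for w
    using particle_count_eq_0_iff[OF that B(2)] that by (simp add: count_def)
  have ind: "integrable P (indicator ?E :: 'w \<Rightarrow> real)"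
    by (rule integrable_const_bound[where B = 1]) (use ev in auto)
  \<comment> \<open>Off the event the count is at least 1, so the complement has probability at most
    the mean.\<close>
  have "1 - prob ?E = expectation (\<lambda>w. 1 - indicator ?E w)" using ev ind by (simp add: prob_space)
  also have "\<dots> \<le> expectation (count B)"
  proof (rule integral_mono)
    fix w assume w: "w \<in> space P"
    show "1 - indicator ?E w \<le> count B w"
      using cE[OF w] by (cases "w \<in> ?E") (auto simp: count_def indicator_def)
  qed (use M(1) ind in auto)
  finally show "1 - ?\<mu> \<le> prob ?E" using M(2) by simp
  assume pos: "0 < ?\<mu>"
  have "?\<mu>\<^sup>2 * prob ?E = expectation (\<lambda>w. ?\<mu>\<^sup>2 * indicator ?E w)" using ev by simp
  also have "\<dots> \<le> expectation (\<lambda>w. (count B w)\<^sup>2 - 2 * ?\<mu> * count B w + ?\<mu>\<^sup>2)"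
  proof (rule integral_mono)
    fix w assume w: "w \<in> space P"
    have "0 \<le> (count B w - ?\<mu>)\<^sup>2" by simp
    then have "0 \<le> (count B w)\<^sup>2 - 2 * ?\<mu> * count B w + ?\<mu>\<^sup>2" by (simp add: power2_diff algebra_simps)
    \<comment> \<open>On the event the count is 0 and the right side equals
      \<open>?\<mu>\<^sup>2\<close>; elsewhere it is a square.\<close>
    then show "?\<mu>\<^sup>2 * indicator ?E w \<le> (count B w)\<^sup>2 - 2 * ?\<mu> * count B w + ?\<mu>\<^sup>2"
      using cE[OF w] by (cases "w \<in> ?E") auto
  qed (use M(1,3) ind in auto)
  also have "\<dots> = expectation (\<lambda>w. (count B w)\<^sup>2) - 2 * ?\<mu> * expectation (count B) + ?\<mu>\<^sup>2"
    by (intro has_bochner_integral_integral_eq has_bochner_integral_add has_bochner_integral_diff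
        has_bochner_integral_mult_right has_bochner_integral_integrable M(1,3))
       (simp add: has_bochner_integral_iff prob_space)
  also have "\<dots> \<le> ?\<mu>" using M(4) unfolding M(2) by (simp add: power2_eq_square)
  finally show "prob ?E \<le> 1 / ?\<mu>" using pos by (simp add: field_simps power2_eq_square)
qed

definition gap_above :: "real \<Rightarrow> 'w set" where
  "gap_above t = {w \<in> space P. \<forall>x>t. X w x = 0}"

lemma gap_above_INT: "gap_above t = (\<Inter>n. {w \<in> space P. \<forall>x\<in>{t<..t + real n}. X w x = 0})"
proof -
  have "\<exists>n. x \<le> t + real n" for x
    using real_arch_simple[of "x - t"] by (auto simp: algebra_simps)
  then show ?thesis by (fastforce simp: gap_above_def)
qed

lemma gap_above_limit: "(\<lambda>n. prob {w \<in> space P. \<forall>x\<in>{t<..t + real n}. X w x = 0}) \<longlonglongrightarrow> prob (gap_above t)"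
  unfolding gap_above_INT
proof (rule finite_Lim_measure_decseq)
  show "range (\<lambda>n. {w \<in> space P. \<forall>x\<in>{t<..t + real n}. X w x = 0}) \<subseteq> events"
    using gap_event(1) by auto
  show "decseq (\<lambda>n. {w \<in> space P. \<forall>x\<in>{t<..t + real n}. X w x = 0})"
    by (auto simp: decseq_def)
qed

lemma gap_above_event [measurable]: "gap_above t \<in> events"
  unfolding gap_above_INT using gap_event(1) by (intro sets.countable_INT) auto

lemma prob_gap_above: "prob (gap_above t) = fredholm_series K {t<..}"
proof -
  have "(\<lambda>n. fredholm_series K {t<..t + real n}) \<longlonglongrightarrow> fredholm_series K {t<..}"
  proof (rule fredholm_series_tendsto[where H = "\<lambda>x. K x x"])
    show "trace_class_kernel K {t<..t + real n}" for n by (rule trace_class_Ioi) auto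
    show "trace_class_kernel K {t<..}" by (rule trace_class_Ioi) auto
    show "(\<lambda>n. indicator {t<..t + real n} x :: real) \<longlonglongrightarrow> indicator {t<..} x" for x
    proof (rule tendsto_eventually)
      obtain m where m: "x \<le> t + real m"
        using real_arch_simple[of "x - t"] by (auto simp: algebra_simps)
      show "\<forall>\<^sub>F n in sequentially. indicator {t<..t + real n} x = (indicator {t<..} x :: real)"
        using eventually_ge_at_top[of m] by eventually_elim (use m in \<open>auto simp: indicator_def\<close>)
    qed
  qed (auto intro: trace)
  moreover have "(\<lambda>n. fredholm_series K {t<..t + real n}) \<longlonglongrightarrow> prob (gap_above t)"
    using gap_above_limit[of t] gap_event(2)[of "{t<..t + real n}" for n] by simp
  ultimately show ?thesis by (rule LIMSEQ_unique[rotated])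
qed

section \<open>Existence and distribution function of the last particle\<close>

definition has_last :: "'w set" where
  "has_last = {w \<in> space P. \<exists>x. is_last_particle (X w) x}"

text \<open>Only countably many levels and windows occur on the right, so the event is measurable,
  and each of the two parts can be shown to have probability one. Local finiteness provides the
  maximum.\<close>

lemma has_last_eq: "has_last = (\<Union>n. gap_above (real n)) \<inter>
    (\<Union>n. space P - {w \<in> space P. \<forall>x\<in>{- real n<..real n}. X w x = 0})"
proof (intro equalityI subsetI)
  fix w assume "w \<in> has_last"
  then obtain x where w: "w \<in> space P" and x: "0 < X w x" "\<forall>y. 0 < X w y \<longrightarrow> y \<le> x"
    by (auto simp: has_last_def is_last_particle_def)
  obtain n where "\<bar>x\<bar> < real n" using reals_Archimedean2 by blast
  then have n: "- real n < x" "x \<le> real n" by auto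
  then have "w \<in> gap_above (real n)" using w x(2) by (force simp: gap_above_def)
  moreover have "w \<in> space P - {w \<in> space P. \<forall>x\<in>{- real n<..real n}. X w x = 0}" using w x(1) n by auto
  ultimately show "w \<in> (\<Union>n. gap_above (real n)) \<inter> (\<Union>n. space P - {w \<in> space P. \<forall>x\<in>{- real n<..real n}. X w x = 0})"
    by blast
next
  fix w assume "w \<in> (\<Union>n. gap_above (real n)) \<inter> (\<Union>n. space P - {w \<in> space P. \<forall>x\<in>{- real n<..real n}. X w x = 0})"
  then obtain n x where w: "w \<in> space P" and above: "\<And>y. y > real n \<Longrightarrow> X w y = 0" and x: "0 < X w x"
    by (auto simp: gap_above_def)
  define A where "A = {y \<in> {x..real n}. 0 < X w y}"
  have "bounded {x..real n} \<longrightarrow> finite {y \<in> {x..real n}. 0 < X w y}"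
    using locally_finite[OF w] unfolding locally_finite_config_def by blast
  then have fin: "finite A" unfolding A_def by simp
  have xA: "x \<in> A" unfolding A_def using x above[of x] by force
  have "Max A \<in> A" using Max_in[OF fin] xA by blast
  have max: "y \<le> Max A" if "y \<in> A" for y using Max_ge[OF fin that] .
  have "is_last_particle (X w) (Max A)"
    unfolding is_last_particle_def
  proof (intro conjI allI impI)
    show "0 < X w (Max A)" using \<open>Max A \<in> A\<close> by (simp add: A_def)
    fix y assume y: "0 < X w y"
    show "y \<le> Max A"
    proof (cases "y < x")
      case True then show ?thesis using max[OF xA] by simp
    next
      case False
      then have "y \<in> A" using y above[of y] by (force simp: A_def)
      then show ?thesis by (rule max)
    qed
  qed
  then show "w \<in> has_last" using w by (auto simp: has_last_def)
qed

lemma has_last_event [measurable]: "has_last \<in> events"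
  unfolding has_last_eq using gap_event(1) by (intro sets.Int sets.countable_UN) auto

lemma AE_has_last: "AE w in P. w \<in> has_last"
proof -
  have "prob (\<Union>n. gap_above (real n)) = 1"
  proof (rule antisym[OF prob_le_1])
    have tr: "(\<lambda>n. kernel_trace K {real n<..}) \<longlonglongrightarrow> integral\<^sup>L lborel (\<lambda>x::real. 0)"
      unfolding kernel_trace_def
    proof (rule integral_dominated_convergence[where w = "\<lambda>x. indicator {0<..} x * K x x"
          and s = "\<lambda>n x. indicator {real n<..} x * K x x" and f = "\<lambda>x. 0"])
      show "integrable lborel (\<lambda>x. indicator {0<..} x * K x x)" by (rule trace)
      show "AE x in lborel. (\<lambda>n. indicator {real n<..} x * K x x) \<longlonglongrightarrow> 0"
      proof (intro AE_I2 tendsto_eventually)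
        fix x :: real
        obtain m where m: "x \<le> real m" using real_arch_simple by blast
        show "\<forall>\<^sub>F n in sequentially. indicator {real n<..} x * K x x = 0"
          using eventually_ge_at_top[of m] by eventually_elim (use m in \<open>auto simp: indicator_def\<close>)
      qed
      show "AE x in lborel. norm (indicator {real n<..} x * K x x) \<le> indicator {0<..} x * K x x" for n
        using K_diag_nonneg by (intro AE_I2) (auto simp: indicator_def)
    qed measurable
    have "1 - kernel_trace K {real n<..} \<le> prob (gap_above (real n))" for n
    proof (rule LIMSEQ_le_const[OF gap_above_limit], intro exI allI impI)
      fix m
      have "1 - kernel_trace K {real n<..} \<le> 1 - kernel_trace K {real n<..real n + real m}"
        by (intro diff_left_mono kernel_trace_mono[where t = "real n"]) auto
      also have "\<dots> \<le> prob {w \<in> space P. \<forall>x\<in>{real n<..real n + real m}. X w x = 0}"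
        by (rule gap_prob_bounds) auto
      finally show "1 - kernel_trace K {real n<..} \<le> prob {w \<in> space P. \<forall>x\<in>{real n<..real n + real m}. X w x = 0}" .
    qed
    moreover have "prob (gap_above (real n)) \<le> prob (\<Union>n. gap_above (real n))" for n
      by (intro finite_measure_mono) auto
    ultimately have le: "1 - kernel_trace K {real n<..} \<le> prob (\<Union>n. gap_above (real n))" for n
      by (rule order_trans)
    have "(\<lambda>n. 1 - kernel_trace K {real n<..}) \<longlonglongrightarrow> 1"
      using tendsto_diff[OF tendsto_const tr, of 1] by simp
    then show "1 \<le> prob (\<Union>n. gap_above (real n))"
      by (rule LIMSEQ_le_const2) (use le in auto)
  qed
  then have "AE w in P. w \<in> (\<Union>n. gap_above (real n))" by (subst (asm) prob_eq_1) auto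
  moreover have "prob (\<Inter>n. {w \<in> space P. \<forall>x\<in>{- real n<..real n}. X w x = 0}) = 0" (is "prob ?Z = 0")
  proof -
    have le: "prob ?Z \<le> e" if "e > 0" for e
    proof -
      obtain n where n: "1 / e \<le> kernel_trace K {- real n<..real n}" using trace_unbounded by blast
      have "0 < 1 / e" using that by simp
      with n have pos: "0 < kernel_trace K {- real n<..real n}" by linarith
      have "prob ?Z \<le> prob {w \<in> space P. \<forall>x\<in>{- real n<..real n}. X w x = 0}"
        using gap_event(1) by (intro finite_measure_mono) auto
      also have "\<dots> \<le> 1 / kernel_trace K {- real n<..real n}" using pos by (intro gap_prob_bounds) auto
      also have "\<dots> \<le> e" using n pos that by (simp add: divide_le_eq mult.commute)
      finally show ?thesis .
    qed
    have "prob ?Z \<le> 0" by (rule field_le_epsilon) (simp only: add_0 le)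
    then show ?thesis using measure_nonneg[of P ?Z] by linarith
  qed
  moreover have "?Z \<in> events" using gap_event(1) by (intro sets.countable_INT) auto
  ultimately have "AE w in P. w \<notin> ?Z" by (simp add: prob_eq_0)
  with \<open>AE w in P. w \<in> (\<Union>n. gap_above (real n))\<close> show ?thesis
    using AE_space
  proof eventually_elim
    case (elim w)
    then show ?case unfolding has_last_eq by blast
  qed
qed

lemma last_particle_le_iff:
  assumes "w \<in> has_last"
  shows "last_particle (X w) \<le> t \<longleftrightarrow> w \<in> gap_above t"
proof -
  obtain x where x: "is_last_particle (X w) x" and w: "w \<in> space P" using assms by (auto simp: has_last_def)
  have "last_particle (X w) = x"
    unfolding last_particle_def
    by (rule the_equality[where P = "is_last_particle (X w)", OF x]) (use x in \<open>auto simp: is_last_particle_def intro: antisym\<close>)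
  moreover have "x \<le> t" if "\<forall>y>t. X w y = 0"
  proof (rule ccontr)
    assume "\<not> x \<le> t"
    then show False using that x by (simp add: is_last_particle_def)
  qed
  moreover have "X w y = 0" if "x \<le> t" "y > t" for y
  proof (rule ccontr)
    assume "X w y \<noteq> 0"
    then have "y \<le> x" using x by (simp add: is_last_particle_def)
    then show False using that by simp
  qed
  ultimately show ?thesis using w by (auto simp: gap_above_def)
qed

lemma last_particle_measurable: "(\<lambda>w. last_particle (X w)) \<in> borel_measurable P"
  unfolding borel_measurable_iff_le
proof
  fix t
  \<comment> \<open>The default of \<open>last_particle\<close>: without a last particle the
    predicate is constantly false, so all such configurations receive this one value.\<close>
  define r :: real where "r = (THE x. False)"
  have r: "last_particle (X w) = r" if "w \<in> space P - has_last" for w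
  proof -
    have "is_last_particle (X w) = (\<lambda>x. False)" using that by (auto simp: has_last_def fun_eq_iff)
    then show ?thesis by (simp add: last_particle_def r_def)
  qed
  have "{w \<in> space P. last_particle (X w) \<le> t} =
      (has_last \<inter> gap_above t) \<union> (if r \<le> t then space P - has_last else {})"
    using last_particle_le_iff r sets.sets_into_space[OF has_last_event] by auto
  also have "\<dots> \<in> events"
    by (cases "r \<le> t") (simp_all add: sets.Un sets.Int sets.compl_sets has_last_event gap_above_event)
  finally show "{w \<in> space P. last_particle (X w) \<le> t} \<in> events" .
qed

lemma last_particle_cdf_eq: "last_particle_cdf P X t = fredholm_series K {t<..}"
proof -
  have "last_particle_cdf P X t = prob {w \<in> space P. last_particle (X w) \<le> t}"
    unfolding last_particle_cdf_def cdf_def using last_particle_measurable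
    by (subst measure_distr) (auto intro!: arg_cong[of _ _ prob])
  also have "\<dots> = prob (gap_above t)"
  proof (rule finite_measure_eq_AE)
    show "AE w in P. w \<in> {w \<in> space P. last_particle (X w) \<le> t} \<longleftrightarrow> w \<in> gap_above t"
      using AE_has_last AE_space by eventually_elim (simp add: last_particle_le_iff)
    show "{w \<in> space P. last_particle (X w) \<le> t} \<in> events"
      using last_particle_measurable unfolding borel_measurable_iff_le by blast
  qed measurable
  finally show ?thesis by (simp add: prob_gap_above)
qed

end

section \<open>The interpolating process\<close>

text \<open>Makes \<open>exp u\<close> a common dominating weight for all \<open>s\<close> from 1
  on: for nonnegative \<open>u\<close> the quotient is below 1, and for negative \<open>u\<close>
  its bound \<open>exp (s * u)\<close> decreases in \<open>s\<close>.\<close>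

lemma logistic_le_exp:
  fixes s u :: real
  assumes "1 \<le> s"
  shows "exp (s * u) / (exp (s * u) + 1) \<le> exp u"
proof (cases "0 \<le> u")
  case True
  have "exp (s * u) / (exp (s * u) + 1) \<le> 1" by (simp add: add_pos_pos divide_le_eq)
  also have "1 \<le> exp u" using True by simp
  finally show ?thesis .
next
  case False
  have "exp (s * u) / (exp (s * u) + 1) \<le> exp (s * u)"
    by (simp add: divide_le_eq add_pos_pos mult_le_cancel_left1)
  also have "\<dots> \<le> exp u"
  proof -
    have "s * u \<le> 1 * u" using assms False by (intro mult_right_mono_neg) auto
    then show ?thesis by simp
  qed
  finally show ?thesis .
qed

lemma airy_weight_interpolating_ge_1:
  assumes "1 \<le> s"
  shows "airy_weight (\<lambda>u. exp (s * u) / (exp (s * u) + 1)) 1"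
  by standard (use logistic_le_exp[OF assms] in \<open>auto simp: add_pos_pos less_imp_le\<close>)

text \<open>If \<open>Ai\<close> vanished almost everywhere, so would the heat kernel at (0, 0),
  which is an explicit positive number.\<close>

lemma Ai_tail_pos: "\<exists>m::nat. 0 < (\<integral>v. indicator {- real m<..} v * (Ai v)\<^sup>2 \<partial>lborel)"
proof (rule ccontr)
  assume "\<not> (\<exists>m::nat. 0 < (\<integral>v. indicator {- real m<..} v * (Ai v)\<^sup>2 \<partial>lborel))"
  then have z: "(\<integral>v. indicator {- real m<..} v * (Ai v)\<^sup>2 \<partial>lborel) = 0" for m :: nat
    by (intro antisym integral_nonneg_AE) (auto simp: not_less)
  have "AE v in lborel. indicator {- real m<..} v * (Ai v)\<^sup>2 = 0" for m :: nat
    using z[of m] Ai_tail_square_integrable[of "- real m" 0] by (subst (asm) integral_nonneg_eq_0_iff_AE) auto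
  then have "AE v in lborel. \<forall>m::nat. indicator {- real m<..} v * (Ai v)\<^sup>2 = 0"
    unfolding AE_all_countable by blast
  then have "AE v in lborel. exp (1 * v) * (Ai (0 + v) * Ai (0 + v)) = 0"
  proof eventually_elim
    case (elim v)
    obtain m where "- v < real m" using reals_Archimedean2 by blast
    then show ?case using elim[rule_format, of m] by (simp add: indicator_def)
  qed
  then have "(\<integral>v. exp (1 * v) * (Ai (0 + v) * Ai (0 + v)) \<partial>lborel) = (\<integral>v. 0 \<partial>(lborel :: real measure))"
    by (intro integral_cong_AE) auto
  then have "heat_kernel 1 0 0 = 0" using exp_weighted_Ai_product(2)[of 1 0 0] by simp
  then show False using heat_kernel_diag[of 1 0] by simp
qed

text \<open>After the shift v = x + u the logistic weight is at least 1/2 for \<open>v > - m\<close>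
  as soon as \<open>x \<le> - m\<close>; hence the diagonal stays above a positive constant on a
  left half-line.\<close>

lemma interpolating_trace_unbounded:
  assumes "\<alpha> > 0"
  shows "\<exists>n::nat. B \<le> kernel_trace (interpolating_kernel \<alpha>) {- real n<..real n}"
proof -
  let ?w = "\<lambda>u. exp (\<alpha> * u) / (exp (\<alpha> * u) + 1)"
  interpret airy_weight ?w \<alpha> by (rule airy_weight_interpolating[OF assms])
  obtain m :: nat where m: "0 < (\<integral>v. indicator {- real m<..} v * (Ai v)\<^sup>2 \<partial>lborel)" using Ai_tail_pos by blast
  define c where "c = (\<integral>v. indicator {- real m<..} v * (Ai v)\<^sup>2 \<partial>lborel)"
  have c: "c > 0" using m by (simp add: c_def)
  have diag: "c / 2 \<le> weighted_kernel ?w x x" if x: "x \<le> - real m" for x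
  proof -
    have shift: "weighted_kernel ?w x x = (\<integral>v. ?w (v - x) * (Ai v * Ai v) \<partial>lborel)"
      unfolding weighted_kernel_def
      by (subst lborel_integral_real_affine[where c = 1 and t = "- x"]) auto
    have int: "integrable lborel (\<lambda>v. ?w (v - x) * (Ai v * Ai v))"
      using lborel_integrable_real_affine[OF amplitude_integrable[of x x], of 1 "- x"] by (simp add: amplitude_mult)
    have "c / 2 = (\<integral>v. 1 / 2 * (indicator {- real m<..} v * (Ai v)\<^sup>2) \<partial>lborel)" by (simp add: c_def)
    also have "\<dots> \<le> (\<integral>v. ?w (v - x) * (Ai v * Ai v) \<partial>lborel)"
    proof (rule integral_mono)
      show "integrable lborel (\<lambda>v. 1 / 2 * (indicator {- real m<..} v * (Ai v)\<^sup>2))"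
        using Ai_tail_square_integrable[of "- real m" 0] by simp
      fix v
      have "1 / 2 \<le> ?w (v - x)" if "- real m < v"
      proof -
        have "0 \<le> \<alpha> * (v - x)" using that x assms by (intro mult_nonneg_nonneg) auto
        then have "1 \<le> exp (\<alpha> * (v - x))" by simp
        then show ?thesis by (simp add: field_simps add_pos_pos)
      qed
      then have "1 / 2 * indicator {- real m<..} v \<le> ?w (v - x)"
        using w_nonneg[of "v - x"] by (cases "- real m < v") (auto simp: indicator_def)
      then have "1 / 2 * indicator {- real m<..} v * (Ai v)\<^sup>2 \<le> ?w (v - x) * (Ai v)\<^sup>2"
        by (rule mult_right_mono) simp
      then show "1 / 2 * (indicator {- real m<..} v * (Ai v)\<^sup>2) \<le> ?w (v - x) * (Ai v * Ai v)"
        by (simp add: power2_eq_square mult.assoc)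
    qed (rule int)
    finally show ?thesis by (simp add: shift)
  qed
  \<comment> \<open>The window from \<open>- n\<close> to \<open>- m\<close> has length
    \<open>j\<close> and contributes at least \<open>j * c / 2\<close>, which is \<open>B\<close> or
    more.\<close>
  obtain j :: nat where j: "2 * B / c \<le> real j" using real_arch_simple by blast
  define n where "n = m + j"
  interpret trace_class_kernel "weighted_kernel ?w" "{- real n<..real n}"
    by (rule trace_class[of _ "- real n"]) auto
  have "B \<le> (real n - real m) * (c / 2)" using j c by (simp add: n_def field_simps)
  also have "\<dots> = (\<integral>x. indicator {- real n<..- real m} x * (c / 2) \<partial>lborel)"
    by (simp add: n_def)
  also have "\<dots> \<le> kernel_trace (weighted_kernel ?w) {- real n<..real n}"
    unfolding kernel_trace_def
  proof (rule integral_mono)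
    show "integrable lborel (\<lambda>x. indicator {- real n<..- real m} x * (c / 2))"
      by (intro integrable_mult_left integrable_real_indicator) (auto simp: n_def)
    show "integrable lborel (\<lambda>x. indicator {- real n<..real n} x * weighted_kernel ?w x x)" by (rule trace)
    show "indicator {- real n<..- real m} x * (c / 2) \<le> indicator {- real n<..real n} x * weighted_kernel ?w x x" for x
      using diag[of x] K_diag_nonneg[of x] by (auto simp: indicator_def)
  qed
  finally show ?thesis unfolding interpolating_kernel_eq by blast
qed

section \<open>Hilbert-Schmidt comparison with the heat kernel\<close>

lemma integral_pair_mult:
  fixes f g :: "real \<Rightarrow> real"
  assumes f: "integrable lborel f" and g: "integrable lborel g"
  shows "(\<integral>p. f (fst p) * g (snd p) \<partial>(lborel \<Otimes>\<^sub>M lborel)) = (\<integral>x. f x \<partial>lborel) * (\<integral>x. g x \<partial>lborel)"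
proof -
  have "integrable (lborel \<Otimes>\<^sub>M lborel) (\<lambda>(x, y). f x * g y)"
    by (intro integrable_mult_pair sigma_finite_lborel f g)
  from lborel_pair.integral_fst[OF this] show ?thesis by (simp add: split_beta')
qed

text \<open>The product of two positive definite kernels is positive definite, by interchanging the
  order of integration.\<close>

lemma schur_product_integral_nonneg:
  fixes a c :: "real \<Rightarrow> real \<Rightarrow> real"
  assumes [measurable]: "case_prod a \<in> borel_measurable (borel \<Otimes>\<^sub>M borel)" "case_prod c \<in> borel_measurable (borel \<Otimes>\<^sub>M borel)"
    and a: "\<And>x. integrable lborel (\<lambda>u. (a x u)\<^sup>2)" "\<And>u. integrable lborel (\<lambda>x. (a x u)\<^sup>2)"
      "integrable lborel (\<lambda>x. \<integral>u. (a x u)\<^sup>2 \<partial>lborel)"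
    and c: "\<And>x. integrable lborel (\<lambda>u. (c x u)\<^sup>2)" "\<And>u. integrable lborel (\<lambda>x. (c x u)\<^sup>2)"
      "integrable lborel (\<lambda>x. \<integral>u. (c x u)\<^sup>2 \<partial>lborel)"
  defines "A \<equiv> \<lambda>x y. \<integral>u. a x u * a y u \<partial>lborel" and "C \<equiv> \<lambda>x y. \<integral>u. c x u * c y u \<partial>lborel"
  shows "integrable (lborel \<Otimes>\<^sub>M lborel) (\<lambda>(x, y). A x y * C x y)"
    and "0 \<le> (\<integral>(x, y). A x y * C x y \<partial>(lborel \<Otimes>\<^sub>M lborel))"
proof -
  let ?L = "lborel :: real measure"
  let ?LL = "?L \<Otimes>\<^sub>M ?L"
  have LL: "sigma_finite_measure ?LL" by (rule lborel_pair.sigma_finite_measure_axioms)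
  interpret LL: sigma_finite_measure ?LL by (rule LL)
  interpret Q: pair_sigma_finite ?LL ?LL by standard
  have [measurable]: "(\<lambda>u. a x u) \<in> borel_measurable borel" "(\<lambda>x. a x u) \<in> borel_measurable borel"
    "(\<lambda>u. c x u) \<in> borel_measurable borel" "(\<lambda>x. c x u) \<in> borel_measurable borel" for x u
    by measurable
  have aa: "integrable ?L (\<lambda>u. a x u * a y u)" and cc: "integrable ?L (\<lambda>u. c x u * c y u)"
    and ac: "integrable ?L (\<lambda>x. a x u * c x v)" for x y u v
    using a c by (auto intro!: integrable_mult_of_squares)
  \<comment> \<open>The two choices of \<open>f\<close> and \<open>g\<close> make both factors of
    \<open>F\<close> square-integrable in all four variables, so that \<open>F\<close> is integrable
    and Fubini applies.\<close>
  have sq: "integrable (?LL \<Otimes>\<^sub>M ?LL) (\<lambda>(p, q). (a (f p) (fst q))\<^sup>2 * (c (g p) (snd q))\<^sup>2)"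
    if fg: "(f = fst \<and> g = snd) \<or> (f = snd \<and> g = fst)" for f g
  proof (rule Q.Fubini_integrable)
    have [measurable]: "f \<in> measurable ?LL borel" "g \<in> measurable ?LL borel" using fg by auto
    show "(\<lambda>(p, q). (a (f p) (fst q))\<^sup>2 * (c (g p) (snd q))\<^sup>2) \<in> borel_measurable (?LL \<Otimes>\<^sub>M ?LL)"
      by measurable
    have inner: "(\<integral>q. (a x (fst q))\<^sup>2 * (c y (snd q))\<^sup>2 \<partial>?LL) = (\<integral>u. (a x u)\<^sup>2 \<partial>lborel) * (\<integral>u. (c y u)\<^sup>2 \<partial>lborel)" for x y
      by (rule integral_pair_mult[OF a(1) c(1)])
    have "integrable ?LL (\<lambda>(x, y). (\<integral>u. (a x u)\<^sup>2 \<partial>lborel) * (\<integral>u. (c y u)\<^sup>2 \<partial>lborel))"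
      and "integrable ?LL (\<lambda>(y, x). (\<integral>u. (c y u)\<^sup>2 \<partial>lborel) * (\<integral>u. (a x u)\<^sup>2 \<partial>lborel))"
      by (intro integrable_mult_pair sigma_finite_lborel a(3) c(3))+
    then show "integrable ?LL (\<lambda>p. \<integral>q. norm (case (p, q) of (p, q) \<Rightarrow> (a (f p) (fst q))\<^sup>2 * (c (g p) (snd q))\<^sup>2) \<partial>?LL)"
      using fg by (auto simp: inner split_beta' mult.commute)
    show "AE p in ?LL. integrable ?LL (\<lambda>q. case (p, q) of (p, q) \<Rightarrow> (a (f p) (fst q))\<^sup>2 * (c (g p) (snd q))\<^sup>2)"
      using integrable_mult_pair[OF sigma_finite_lborel sigma_finite_lborel a(1) c(1)] by (simp add: split_beta')
  qed
  \<comment> \<open>Integrated over \<open>q\<close> this is the product of \<open>A\<close> and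
    \<open>C\<close> at \<open>p\<close>; integrated over \<open>p\<close> it is a perfect
    square.\<close>
  define F where "F = (\<lambda>p q. (a (fst p) (fst q) * c (snd p) (snd q)) * (a (snd p) (fst q) * c (fst p) (snd q)))"
  have "integrable (?LL \<Otimes>\<^sub>M ?LL) (\<lambda>r. (\<lambda>(p, q). a (fst p) (fst q) * c (snd p) (snd q)) r * (\<lambda>(p, q). a (snd p) (fst q) * c (fst p) (snd q)) r)"
    using sq[of fst snd] sq[of snd fst]
    by (intro integrable_mult_of_squares) (auto simp: split_beta' power_mult_distrib)
  then have F: "integrable (?LL \<Otimes>\<^sub>M ?LL) (\<lambda>(p, q). F p q)" by (simp add: F_def split_beta')
  have inner1: "(\<integral>q. F p q \<partial>?LL) = A (fst p) (snd p) * C (fst p) (snd p)" for p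
  proof -
    have "(\<integral>q. F p q \<partial>?LL) = (\<integral>q. (a (fst p) (fst q) * a (snd p) (fst q)) * (c (fst p) (snd q) * c (snd p) (snd q)) \<partial>?LL)"
      by (simp add: F_def mult_ac)
    also have "\<dots> = A (fst p) (snd p) * C (fst p) (snd p)"
      unfolding A_def C_def by (rule integral_pair_mult[OF aa cc])
    finally show ?thesis .
  qed
  have inner2: "(\<integral>p. F p q \<partial>?LL) = (\<integral>x. a x (fst q) * c x (snd q) \<partial>lborel)\<^sup>2" for q
  proof -
    have "(\<integral>p. F p q \<partial>?LL) = (\<integral>p. (a (fst p) (fst q) * c (fst p) (snd q)) * (a (snd p) (fst q) * c (snd p) (snd q)) \<partial>?LL)"
      by (simp add: F_def mult_ac)
    also have "\<dots> = (\<integral>x. a x (fst q) * c x (snd q) \<partial>lborel)\<^sup>2"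
      unfolding power2_eq_square by (rule integral_pair_mult[OF ac ac])
    finally show ?thesis .
  qed
  show "integrable ?LL (\<lambda>(x, y). A x y * C x y)"
    using Q.integrable_fst[OF F] by (simp add: inner1 split_beta')
  have "(\<integral>(x, y). A x y * C x y \<partial>?LL) = (\<integral>p. \<integral>q. F p q \<partial>?LL \<partial>?LL)"
    by (simp add: inner1 split_beta')
  also have "\<dots> = (\<integral>q. \<integral>p. F p q \<partial>?LL \<partial>?LL)"
    by (rule Q.Fubini_integral[OF F, symmetric])
  also have "\<dots> \<ge> 0" by (simp add: inner2)
  finally show "0 \<le> (\<integral>(x, y). A x y * C x y \<partial>?LL)" .
qed


text \<open>Of the two Gaussian factors one is bounded by its maximum
  \<open>1 / sqrt (4 * pi * \<alpha>)\<close>, the other has integral 1 in \<open>y\<close>. Half of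
  the exponential decay in \<open>x\<close> is kept for the outer integral, the rest is evaluated at
  \<open>t\<close>.\<close>

lemma nn_integral_heat_kernel_square_le:
  assumes \<alpha>: "\<alpha> > 0"
  shows "(\<integral>\<^sup>+x. \<integral>\<^sup>+y. ennreal (indicator {t<..} x * indicator {t<..} y * (heat_kernel \<alpha> x y)\<^sup>2) \<partial>lborel \<partial>lborel)
    \<le> ennreal (exp (\<alpha> ^ 3 / 6) / sqrt (4 * pi * \<alpha>) * exp (- 2 * \<alpha> * t) * 2 / \<alpha>)"
proof -
  let ?s = "sqrt (2 * \<alpha>)"
  define C where "C = exp (\<alpha> ^ 3 / 6) / sqrt (4 * pi * \<alpha>) * exp (- 3 / 2 * \<alpha> * t)"
  have C: "C \<ge> 0" using \<alpha> by (simp add: C_def)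
  have s: "?s > 0" using \<alpha> by simp
  have pointwise: "indicator {t<..} x * indicator {t<..} y * (heat_kernel \<alpha> x y)\<^sup>2
      \<le> (indicator {t<..} x * (C * exp (- (\<alpha> / 2) * x))) * normal_density x ?s y" for x y
  proof (cases "x > t \<and> y > t")
    case True
    define n where "n = normal_density 0 ?s (x - y)"
    have n_sym: "n = normal_density x ?s y" by (simp add: n_def normal_density_def power2_commute)
    have n0: "0 \<le> n" by (simp add: n_def)
    have n_le: "n \<le> 1 / sqrt (4 * pi * \<alpha>)"
    proof -
      have "n = 1 / sqrt (4 * pi * \<alpha>) * exp (- (x - y)\<^sup>2 / (2 * ?s\<^sup>2))"
        using \<alpha> by (simp add: n_def normal_density_def mult_ac)
      also have "\<dots> \<le> 1 / sqrt (4 * pi * \<alpha>) * 1"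
        using \<alpha> by (intro mult_left_mono) auto
      finally show ?thesis by simp
    qed
    have "(heat_kernel \<alpha> x y)\<^sup>2 = exp (\<alpha> ^ 3 / 6 - \<alpha> * (x + y)) * (n * n)"
    proof -
      have "2 * (\<alpha> ^ 3 / 12 - \<alpha> * (x + y) / 2) = \<alpha> ^ 3 / 6 - \<alpha> * (x + y)" by simp
      then have "(exp (\<alpha> ^ 3 / 12 - \<alpha> * (x + y) / 2))\<^sup>2 = exp (\<alpha> ^ 3 / 6 - \<alpha> * (x + y))"
        by (simp only: exp_double[symmetric])
      then show ?thesis by (simp add: heat_kernel_def n_def[symmetric] power_mult_distrib power2_eq_square[of n])
    qed
    also have "\<dots> \<le> exp (\<alpha> ^ 3 / 6 + (- 3 / 2 * \<alpha> * t) + - (\<alpha> / 2) * x) * (1 / sqrt (4 * pi * \<alpha>) * n)"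
    proof (intro mult_mono)
      have "\<alpha> * t \<le> \<alpha> * x" "\<alpha> * t \<le> \<alpha> * y" using True \<alpha> by auto
      then have "\<alpha> ^ 3 / 6 - \<alpha> * (x + y) \<le> \<alpha> ^ 3 / 6 + (- 3 / 2 * \<alpha> * t) + - (\<alpha> / 2) * x"
        by (simp add: distrib_left)
      then show "exp (\<alpha> ^ 3 / 6 - \<alpha> * (x + y)) \<le> exp (\<alpha> ^ 3 / 6 + (- 3 / 2 * \<alpha> * t) + - (\<alpha> / 2) * x)" by simp
    qed (use n_le n0 \<alpha> in auto)
    also have "\<dots> = (C * exp (- (\<alpha> / 2) * x)) * n"
      unfolding exp_add C_def by simp
    finally show ?thesis using True by (simp add: n_sym)
  next
    case False
    then show ?thesis using C by (auto simp: indicator_def)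
  qed
  have "(\<integral>\<^sup>+x. \<integral>\<^sup>+y. ennreal (indicator {t<..} x * indicator {t<..} y * (heat_kernel \<alpha> x y)\<^sup>2) \<partial>lborel \<partial>lborel)
      \<le> (\<integral>\<^sup>+x. ennreal (C * (indicator {t<..} x * exp (- (\<alpha> / 2) * x))) \<partial>lborel)"
  proof (rule nn_integral_mono)
    fix x :: real
    let ?g = "indicator {t<..} x * (C * exp (- (\<alpha> / 2) * x))"
    have g: "?g \<ge> 0" using C by simp
    have "(\<integral>\<^sup>+y. ennreal (indicator {t<..} x * indicator {t<..} y * (heat_kernel \<alpha> x y)\<^sup>2) \<partial>lborel)
      \<le> (\<integral>\<^sup>+y. ennreal (?g * normal_density x ?s y) \<partial>lborel)"
      by (intro nn_integral_mono ennreal_leI pointwise)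
    also have "\<dots> = ennreal (\<integral>y. ?g * normal_density x ?s y \<partial>lborel)"
      using g s by (intro nn_integral_eq_integral integrable_mult_right integrable_normal_density) auto
    also have "(\<integral>y. ?g * normal_density x ?s y \<partial>lborel) = ?g" using s by simp
    finally show "(\<integral>\<^sup>+y. ennreal (indicator {t<..} x * indicator {t<..} y * (heat_kernel \<alpha> x y)\<^sup>2) \<partial>lborel)
      \<le> ennreal (C * (indicator {t<..} x * exp (- (\<alpha> / 2) * x)))" by (simp add: mult.left_commute)
  qed
  also have "\<dots> = ennreal (C * (exp (- (\<alpha> / 2) * t) / (\<alpha> / 2)))"
  proof -
    have "has_bochner_integral lborel (\<lambda>x. C * (indicator {t<..} x * exp (- (\<alpha> / 2) * x))) (C * (exp (- (\<alpha> / 2) * t) / (\<alpha> / 2)))"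
      using \<alpha> by (intro has_bochner_integral_mult_right exp_tail_integral) simp
    then show ?thesis using C by (subst nn_integral_eq_integral) (auto simp: has_bochner_integral_iff)
  qed
  also have "C * (exp (- (\<alpha> / 2) * t) / (\<alpha> / 2)) = exp (\<alpha> ^ 3 / 6) / sqrt (4 * pi * \<alpha>) * exp (- 2 * \<alpha> * t) * 2 / \<alpha>"
  proof -
    have "exp (- 3 / 2 * \<alpha> * t) * exp (- (\<alpha> / 2) * t) = exp (- 2 * \<alpha> * t)"
      unfolding exp_add[symmetric] by simp
    then have "C * exp (- (\<alpha> / 2) * t) = exp (\<alpha> ^ 3 / 6) / sqrt (4 * pi * \<alpha>) * exp (- 2 * \<alpha> * t)"
      by (simp only: C_def mult.assoc)
    then show ?thesis by (metis divide_divide_eq_right times_divide_eq_right)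
  qed
  finally show ?thesis .
qed

context airy_weight
begin

lemma truncated_amplitude:
  fixes t :: real
  defines "a \<equiv> \<lambda>x u. indicator {t<..} x * amplitude x u"
  shows "case_prod a \<in> borel_measurable (borel \<Otimes>\<^sub>M borel)"
    and "integrable lborel (\<lambda>u. (a x u)\<^sup>2)" and "integrable lborel (\<lambda>x. (a x u)\<^sup>2)"
    and "integrable lborel (\<lambda>x. \<integral>u. (a x u)\<^sup>2 \<partial>lborel)"
    and "(\<integral>u. a x u * a y u \<partial>lborel) = indicator {t<..} x * indicator {t<..} y * weighted_kernel w x y"
proof -
  have ind: "(indicator {t<..} x)\<^sup>2 = (indicator {t<..} x :: real)" for x :: real by (simp add: indicator_def)
  show "case_prod a \<in> borel_measurable (borel \<Otimes>\<^sub>M borel)" unfolding a_def by measurable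
  show "integrable lborel (\<lambda>u. (a x u)\<^sup>2)" for x
    unfolding a_def power_mult_distrib using amplitude_square_integrable by simp
  have "(a x u)\<^sup>2 = w u * (indicator {t<..} x * (Ai (x + u))\<^sup>2)" for x u
    unfolding a_def amplitude_def power_mult_distrib ind using w_nonneg by simp
  then show "integrable lborel (\<lambda>x. (a x u)\<^sup>2)"
    using Ai_tail_square_integrable by simp
  show eq: "(\<integral>u. a x u * a y u \<partial>lborel) = indicator {t<..} x * indicator {t<..} y * weighted_kernel w x y" for x y
  proof -
    have "a x u * a y u = (indicator {t<..} x * indicator {t<..} y) * (amplitude x u * amplitude y u)" for u
      by (simp add: a_def mult_ac)
    then show ?thesis by (simp add: weighted_kernel_amplitude)
  qed
  interpret trace_class_kernel "weighted_kernel w" "{t<..}" by (rule trace_class) auto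
  have "(\<integral>u. (a x u)\<^sup>2 \<partial>lborel) = indicator {t<..} x * weighted_kernel w x x" for x
    using eq[of x x] ind[of x] unfolding power2_eq_square by simp
  then show "integrable lborel (\<lambda>x. \<integral>u. (a x u)\<^sup>2 \<partial>lborel)" using trace by simp
qed

text \<open>Since \<open>0 \<le> w u \<le> exp (\<alpha> * u)\<close>, the kernel is dominated by the heat kernel in the order of
  quadratic forms, hence also in Hilbert-Schmidt norm.\<close>

lemma nn_integral_weighted_kernel_square_le:
  "(\<integral>\<^sup>+x. \<integral>\<^sup>+y. ennreal (indicator {t<..} x * indicator {t<..} y * (weighted_kernel w x y)\<^sup>2) \<partial>lborel \<partial>lborel)
    \<le> (\<integral>\<^sup>+x. \<integral>\<^sup>+y. ennreal (indicator {t<..} x * indicator {t<..} y * (heat_kernel \<alpha> x y)\<^sup>2) \<partial>lborel \<partial>lborel)"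
proof -
  let ?LL = "lborel \<Otimes>\<^sub>M lborel :: (real \<times> real) measure"
  let ?I = "\<lambda>x y. indicator {t<..} x * indicator {t<..} y :: real"
  let ?K = "weighted_kernel w" and ?E = "heat_kernel \<alpha>"
  interpret p: airy_weight "\<lambda>u. exp (\<alpha> * u) - w u" \<alpha>
    by standard (use \<alpha> w_nonneg w_le in auto)
  \<comment> \<open>E^2 - K^2 is twice the product of E - K and (E + K) / 2; the halving keeps the
    second weight below \<open>exp (\<alpha> * u)\<close>, so both factors belong to the same class
    of kernels.\<close>
  interpret q: airy_weight "\<lambda>u. (exp (\<alpha> * u) + w u) / 2" \<alpha>
  proof
    show "0 \<le> (exp (\<alpha> * u) + w u) / 2" for u
      using w_nonneg[of u] by simp
    show "(exp (\<alpha> * u) + w u) / 2 \<le> exp (\<alpha> * u)" for u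
      using w_le[of u] by simp
  qed (use \<alpha> in auto)
  note E_int = exp_weighted_Ai_product(1)[OF \<alpha>] and E_eq = exp_weighted_Ai_product(2)[OF \<alpha>, symmetric]
  have K_int: "integrable lborel (\<lambda>u. w u * (Ai (x + u) * Ai (y + u)))" for x y
    using amplitude_integrable by (simp add: amplitude_mult)
  have p_eq: "weighted_kernel (\<lambda>u. exp (\<alpha> * u) - w u) x y = ?E x y - ?K x y" for x y
    unfolding weighted_kernel_def E_eq left_diff_distrib using E_int K_int by simp
  have q_eq: "weighted_kernel (\<lambda>u. (exp (\<alpha> * u) + w u) / 2) x y = (?E x y + ?K x y) / 2" for x y
    unfolding weighted_kernel_def E_eq using E_int[of x y] K_int[of x y]
    by (simp add: distrib_right add_divide_distrib)
  have prod: "(?I x y * (?E x y - ?K x y)) * (?I x y * ((?E x y + ?K x y) / 2)) =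
      1 / 2 * (?I x y * (?E x y)\<^sup>2 - ?I x y * (?K x y)\<^sup>2)" for x y
    by (cases "t < x \<and> t < y") (auto simp: power2_eq_square field_simps)
  note schur = schur_product_integral_nonneg[OF p.truncated_amplitude(1)[of t] q.truncated_amplitude(1)[of t]
      p.truncated_amplitude(2-4)[of t] q.truncated_amplitude(2-4)[of t],
      unfolded p.truncated_amplitude(5) q.truncated_amplitude(5) p_eq q_eq prod]
  have E_meas: "(\<lambda>(x, y). ?I x y * (?E x y)\<^sup>2) \<in> borel_measurable ?LL"
    unfolding heat_kernel_def normal_density_def by measurable
  have K_meas: "(\<lambda>(x, y). ?I x y * (?K x y)\<^sup>2) \<in> borel_measurable ?LL"
    using K_measurable by measurable
  have nn: "(\<integral>\<^sup>+x. \<integral>\<^sup>+y. ennreal (f x y) \<partial>lborel \<partial>lborel) = (\<integral>\<^sup>+(x, y). ennreal (f x y) \<partial>?LL)"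
    if "(\<lambda>(x, y). f x y) \<in> borel_measurable ?LL" for f :: "real \<Rightarrow> real \<Rightarrow> real"
    using lborel.nn_integral_fst[where f = "\<lambda>p. ennreal (f (fst p) (snd p))"] that by (simp add: split_beta')
  have E2: "integrable ?LL (\<lambda>(x, y). ?I x y * (?E x y)\<^sup>2)"
  proof (rule integrableI_nonneg[OF E_meas])
    have "(\<integral>\<^sup>+p. ennreal (case p of (x, y) \<Rightarrow> ?I x y * (?E x y)\<^sup>2) \<partial>?LL) =
        (\<integral>\<^sup>+x. \<integral>\<^sup>+y. ennreal (?I x y * (?E x y)\<^sup>2) \<partial>lborel \<partial>lborel)"
      unfolding nn[OF E_meas] by (simp add: split_beta')
    also have "\<dots> < \<infinity>"
      by (rule le_less_trans[OF nn_integral_heat_kernel_square_le[OF \<alpha>]]) simp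
    finally show "(\<integral>\<^sup>+p. ennreal (case p of (x, y) \<Rightarrow> ?I x y * (?E x y)\<^sup>2) \<partial>?LL) < \<infinity>" .
  qed auto
  \<comment> \<open>Square-integrability of K comes out of the same identity: its square is that of
    E minus an integrable product.\<close>
  have K_alt: "(\<lambda>(x, y). ?I x y * (?K x y)\<^sup>2) =
      (\<lambda>r. (case r of (x, y) \<Rightarrow> ?I x y * (?E x y)\<^sup>2) - 2 * (case r of (x, y) \<Rightarrow> 1 / 2 * (?I x y * (?E x y)\<^sup>2 - ?I x y * (?K x y)\<^sup>2)))"
    by (auto simp: fun_eq_iff field_simps)
  have K2: "integrable ?LL (\<lambda>(x, y). ?I x y * (?K x y)\<^sup>2)"
    unfolding K_alt by (intro Bochner_Integration.integrable_diff integrable_mult_right E2 schur(1))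
  have le: "(\<integral>(x, y). ?I x y * (?K x y)\<^sup>2 \<partial>?LL) \<le> (\<integral>(x, y). ?I x y * (?E x y)\<^sup>2 \<partial>?LL)"
  proof -
    have "(\<integral>(x, y). ?I x y * (?K x y)\<^sup>2 \<partial>?LL) = (\<integral>(x, y). ?I x y * (?E x y)\<^sup>2 \<partial>?LL)
        - 2 * (\<integral>(x, y). 1 / 2 * (?I x y * (?E x y)\<^sup>2 - ?I x y * (?K x y)\<^sup>2) \<partial>?LL)"
      unfolding K_alt
      by (intro has_bochner_integral_integral_eq has_bochner_integral_diff has_bochner_integral_mult_right
          has_bochner_integral_integrable E2 schur(1))
    then show ?thesis using schur(2) by linarith
  qed
  have "(\<integral>\<^sup>+(x, y). ennreal (?I x y * (?K x y)\<^sup>2) \<partial>?LL) = ennreal (\<integral>(x, y). ?I x y * (?K x y)\<^sup>2 \<partial>?LL)"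
    using nn_integral_eq_integral[OF K2] by (simp add: split_beta')
  also have "\<dots> \<le> ennreal (\<integral>(x, y). ?I x y * (?E x y)\<^sup>2 \<partial>?LL)" by (intro ennreal_leI le)
  also have "\<dots> = (\<integral>\<^sup>+(x, y). ennreal (?I x y * (?E x y)\<^sup>2) \<partial>?LL)"
    using nn_integral_eq_integral[OF E2] by (simp add: split_beta')
  finally show ?thesis by (simp only: nn[OF E_meas] nn[OF K_meas])
qed

end

text \<open>The trace bounds come from \<open>z - z\<^sup>2 \<le> z / (z + 1) \<le> z\<close> with \<open>z = exp (\<alpha> * u)\<close>: the outer terms are the
  weights of heat kernels.\<close>

lemma interpolating_trace_bounds:
  fixes \<alpha> \<xi> :: real
  assumes \<alpha>: "\<alpha> > 0"
  defines "t \<equiv> \<xi> / \<alpha> - 1 / (2 * \<alpha>) * ln (4 * pi * \<alpha> ^ 3)"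
  shows "kernel_trace (interpolating_kernel \<alpha>) {t<..} \<le> exp (\<alpha> ^ 3 / 12) * exp (- \<xi>)"
    and "exp (\<alpha> ^ 3 / 12) * exp (- \<xi>) - exp ((2 * \<alpha>) ^ 3 / 12) * exp (- 2 * \<xi>) * (\<alpha> / 4 * sqrt (8 * pi * \<alpha>))
      \<le> kernel_trace (interpolating_kernel \<alpha>) {t<..}"
    and "(\<integral>\<^sup>+x. \<integral>\<^sup>+y. ennreal (indicator {t<..} x * indicator {t<..} y * (interpolating_kernel \<alpha> x y)\<^sup>2) \<partial>lborel \<partial>lborel)
      \<le> ennreal (exp (\<alpha> ^ 3 / 6) * exp (- 2 * \<xi>) * (2 * \<alpha> * sqrt (4 * pi * \<alpha>)))"
proof -
  let ?w = "\<lambda>u. exp (\<alpha> * u) / (exp (\<alpha> * u) + 1)"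
  let ?K = "weighted_kernel ?w"
  interpret airy_weight ?w \<alpha> by (rule airy_weight_interpolating[OF \<alpha>])
  interpret trace_class_kernel ?K "{t<..}" by (rule trace_class) auto
  have exp_t: "exp (- 2 * \<alpha> * t) = exp (- 2 * \<xi>) * (4 * pi * \<alpha> ^ 3)"
  proof -
    have "- 2 * \<alpha> * t = - 2 * \<xi> + ln (4 * pi * \<alpha> ^ 3)" using \<alpha> by (simp add: t_def field_simps)
    then have "exp (- 2 * \<alpha> * t) = exp (- 2 * \<xi>) * exp (ln (4 * pi * \<alpha> ^ 3))" by (simp only: exp_add)
    also have "exp (ln (4 * pi * \<alpha> ^ 3)) = 4 * pi * \<alpha> ^ 3" using \<alpha> by (intro exp_ln) simp
    finally show ?thesis .
  qed
  define r where "r = sqrt (4 * pi * \<alpha>)"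
  have r: "r > 0" "r * r = 4 * pi * \<alpha>" using \<alpha> by (auto simp: r_def)
  \<comment> \<open>The choice of \<open>t\<close> produces exactly the factor
    \<open>r * \<alpha>\<close> that cancels the denominator of the heat kernel trace.\<close>
  have exp_t': "exp (- \<alpha> * t) = exp (- \<xi>) * (r * \<alpha>)"
  proof (rule power2_eq_imp_eq)
    have "(exp (- \<alpha> * t))\<^sup>2 = exp (- 2 * \<alpha> * t)" by (simp flip: exp_double)
    moreover have "(exp (- \<xi>) * (r * \<alpha>))\<^sup>2 = (exp (- \<xi>))\<^sup>2 * (r * r * \<alpha>\<^sup>2)" by (simp add: power2_eq_square mult_ac)
    moreover have "(exp (- \<xi>))\<^sup>2 = exp (- 2 * \<xi>)" by (simp flip: exp_double)
    moreover have "4 * pi * \<alpha> ^ 3 = 4 * pi * \<alpha> * \<alpha>\<^sup>2" by (simp add: power2_eq_square power3_eq_cube)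
    ultimately show "(exp (- \<alpha> * t))\<^sup>2 = (exp (- \<xi>) * (r * \<alpha>))\<^sup>2"
      unfolding exp_t r(2) by (simp only:)
  qed (use \<alpha> r in auto)
  have tr1: "has_bochner_integral lborel (\<lambda>x. indicator {t<..} x * heat_kernel \<alpha> x x) (exp (\<alpha> ^ 3 / 12) * exp (- \<xi>))"
  proof -
    have "exp (\<alpha> ^ 3 / 12) / sqrt (4 * pi * \<alpha>) * (exp (- \<alpha> * t) / \<alpha>) = exp (\<alpha> ^ 3 / 12) * exp (- \<xi>)"
      unfolding exp_t' r_def[symmetric] using r \<alpha> by simp
    then show ?thesis using heat_kernel_trace[OF \<alpha>, of t] by simp
  qed
  \<comment> \<open>For fixed \<xi> the correction from the heat kernel at
    \<open>2 * \<alpha>\<close> is of order \<alpha>^(3/2) as \<alpha> tends to 0, hence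
    negligible.\<close>
  have tr2: "has_bochner_integral lborel (\<lambda>x. indicator {t<..} x * heat_kernel (2 * \<alpha>) x x)
      (exp ((2 * \<alpha>) ^ 3 / 12) * exp (- 2 * \<xi>) * (\<alpha> / 4 * sqrt (8 * pi * \<alpha>)))"
  proof -
    define q where "q = sqrt (8 * pi * \<alpha>)"
    have q: "q > 0" "q * q = 8 * pi * \<alpha>" using \<alpha> by (auto simp: q_def)
    have "4 * pi * \<alpha> ^ 3 / (q * (2 * \<alpha>)) = \<alpha> / 4 * q"
    proof -
      have "\<alpha> / 4 * q * (q * (2 * \<alpha>)) = \<alpha> / 4 * (q * q) * (2 * \<alpha>)" by (simp only: mult_ac)
      also have "\<dots> = 4 * pi * \<alpha> ^ 3" unfolding q(2) by (simp add: power3_eq_cube)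
      finally show ?thesis using q(1) \<alpha> by (subst divide_eq_eq) auto
    qed
    then have e1: "exp ((2 * \<alpha>) ^ 3 / 12) / q * (exp (- 2 * \<alpha> * t) / (2 * \<alpha>)) =
        exp ((2 * \<alpha>) ^ 3 / 12) * exp (- 2 * \<xi>) * (\<alpha> / 4 * q)"
      unfolding exp_t by (simp add: mult.assoc flip: times_divide_eq_right divide_divide_eq_left) (simp add: mult_ac)
    have e2: "sqrt (4 * pi * (2 * \<alpha>)) = q" by (simp add: q_def mult_ac)
    have e3: "- (2 * \<alpha>) * t = - 2 * \<alpha> * t" by simp
    have "2 * \<alpha> > 0" using \<alpha> by simp
    from heat_kernel_trace[OF this, of t] show ?thesis unfolding e2 e3 e1 q_def[symmetric] .
  qed
  show "kernel_trace (interpolating_kernel \<alpha>) {t<..} \<le> exp (\<alpha> ^ 3 / 12) * exp (- \<xi>)"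
    unfolding interpolating_kernel_eq kernel_trace_def has_bochner_integral_integral_eq[OF tr1, symmetric]
    using weighted_kernel_diag_le
    by (intro integral_mono trace integrable.intros[OF tr1] mult_left_mono) auto
  have lower: "heat_kernel \<alpha> x x - heat_kernel (2 * \<alpha>) x x \<le> ?K x x" for x
  proof -
    have \<alpha>2: "2 * \<alpha> > 0" using \<alpha> by simp
    have "heat_kernel \<alpha> x x - heat_kernel (2 * \<alpha>) x x =
        (\<integral>u. exp (\<alpha> * u) * (Ai (x + u) * Ai (x + u)) - exp (2 * \<alpha> * u) * (Ai (x + u) * Ai (x + u)) \<partial>lborel)"
      using exp_weighted_Ai_product[OF \<alpha>, of x x] exp_weighted_Ai_product[OF \<alpha>2, of x x] by simp
    also have "\<dots> \<le> ?K x x"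
      unfolding weighted_kernel_def
    proof (rule integral_mono)
      show "integrable lborel (\<lambda>u. exp (\<alpha> * u) * (Ai (x + u) * Ai (x + u)) - exp (2 * \<alpha> * u) * (Ai (x + u) * Ai (x + u)))"
        using exp_weighted_Ai_product(1)[OF \<alpha>, of x x] exp_weighted_Ai_product(1)[OF \<alpha>2, of x x] by simp
      show "integrable lborel (\<lambda>u. ?w u * (Ai (x + u) * Ai (x + u)))"
        using amplitude_integrable[of x x] by (simp add: amplitude_mult)
      fix u
      have "exp (\<alpha> * u) - exp (2 * \<alpha> * u) \<le> ?w u"
      proof -
        define z where "z = exp (\<alpha> * u)"
        have z: "z > 0" by (simp add: z_def)
        have "exp (2 * \<alpha> * u) = z * z" unfolding z_def exp_add[symmetric] by simp
        moreover have "(z - z * z) * (z + 1) \<le> z"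
        proof -
          have "(z - z * z) * (z + 1) = z - z * z * z" by (simp add: algebra_simps)
          then show ?thesis using z by simp
        qed
        then have "z - z * z \<le> z / (z + 1)" using z by (subst le_divide_eq) auto
        ultimately show ?thesis by (simp add: z_def)
      qed
      then have "(exp (\<alpha> * u) - exp (2 * \<alpha> * u)) * (Ai (x + u) * Ai (x + u)) \<le> ?w u * (Ai (x + u) * Ai (x + u))"
        by (rule mult_right_mono) simp
      then show "exp (\<alpha> * u) * (Ai (x + u) * Ai (x + u)) - exp (2 * \<alpha> * u) * (Ai (x + u) * Ai (x + u)) \<le> ?w u * (Ai (x + u) * Ai (x + u))"
        by (simp only: left_diff_distrib)
    qed
    finally show ?thesis .
  qed
  have tr12: "has_bochner_integral lborel (\<lambda>x. indicator {t<..} x * heat_kernel \<alpha> x x - indicator {t<..} x * heat_kernel (2 * \<alpha>) x x)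
      (exp (\<alpha> ^ 3 / 12) * exp (- \<xi>) - exp ((2 * \<alpha>) ^ 3 / 12) * exp (- 2 * \<xi>) * (\<alpha> / 4 * sqrt (8 * pi * \<alpha>)))"
    by (intro has_bochner_integral_diff tr1 tr2)
  show "exp (\<alpha> ^ 3 / 12) * exp (- \<xi>) - exp ((2 * \<alpha>) ^ 3 / 12) * exp (- 2 * \<xi>) * (\<alpha> / 4 * sqrt (8 * pi * \<alpha>))
      \<le> kernel_trace (interpolating_kernel \<alpha>) {t<..}"
    unfolding interpolating_kernel_eq kernel_trace_def has_bochner_integral_integral_eq[OF tr12, symmetric]
    using lower by (intro integral_mono trace integrable.intros[OF tr12]) (auto simp: indicator_def)
  have "exp (\<alpha> ^ 3 / 6) / sqrt (4 * pi * \<alpha>) * exp (- 2 * \<alpha> * t) * 2 / \<alpha> =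
      exp (\<alpha> ^ 3 / 6) * exp (- 2 * \<xi>) * (2 * \<alpha> * sqrt (4 * pi * \<alpha>))"
  proof -
    have "4 * pi * \<alpha> ^ 3 = r * r * \<alpha>\<^sup>2" unfolding r(2) by (simp add: power2_eq_square power3_eq_cube)
    then show ?thesis unfolding exp_t r_def[symmetric] using r(1) \<alpha> by (simp add: power2_eq_square)
  qed
  then show "(\<integral>\<^sup>+x. \<integral>\<^sup>+y. ennreal (indicator {t<..} x * indicator {t<..} y * (interpolating_kernel \<alpha> x y)\<^sup>2) \<partial>lborel \<partial>lborel)
      \<le> ennreal (exp (\<alpha> ^ 3 / 6) * exp (- 2 * \<xi>) * (2 * \<alpha> * sqrt (4 * pi * \<alpha>)))"
    using nn_integral_weighted_kernel_square_le[of t] nn_integral_heat_kernel_square_le[OF \<alpha>, of t]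
    unfolding interpolating_kernel_eq by simp
qed

section \<open>The Gumbel limit, \<alpha> to 0\<close>

lemma interpolating_Gumbel_limit:
  "((\<lambda>\<alpha>. fredholm_series (interpolating_kernel \<alpha>) {\<xi> / \<alpha> - 1 / (2 * \<alpha>) * ln (4 * pi * \<alpha> ^ 3)<..})
    \<longlongrightarrow> Gumbel_cdf \<xi>) (at_right 0)"
  unfolding tendsto_at_iff_sequentially comp_def Gumbel_cdf_def
proof (intro allI impI)
  fix \<alpha> :: "nat \<Rightarrow> real"
  assume "\<forall>n. \<alpha> n \<in> {0<..} - {0}" and lim: "\<alpha> \<longlonglongrightarrow> 0"
  then have pos: "\<alpha> n > 0" for n by auto
  define t where "t n = \<xi> / \<alpha> n - 1 / (2 * \<alpha> n) * ln (4 * pi * \<alpha> n ^ 3)" for n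
  \<comment> \<open>A bound on the Hilbert-Schmidt norm, of order \<alpha>^(3/4).\<close>
  define e where "e n = sqrt (exp (\<alpha> n ^ 3 / 6) * exp (- 2 * \<xi>) * (2 * \<alpha> n * sqrt (4 * pi * \<alpha> n)))" for n
  note bounds = interpolating_trace_bounds[where \<xi> = \<xi>, OF pos, folded t_def]
  have "(\<lambda>n. fredholm_series (interpolating_kernel (\<alpha> n)) {t n<..}) \<longlonglongrightarrow> exp (- exp (- \<xi>))"
  proof (rule fredholm_series_tendsto_exp)
    show "trace_class_kernel (interpolating_kernel (\<alpha> n)) {t n<..}" for n
      unfolding interpolating_kernel_eq
      by (rule airy_weight.trace_class[OF airy_weight_interpolating[OF pos]]) auto
    show "(\<lambda>n. kernel_trace (interpolating_kernel (\<alpha> n)) {t n<..}) \<longlonglongrightarrow> exp (- \<xi>)"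
    proof (rule tendsto_sandwich[OF always_eventually always_eventually])
      show "\<forall>n. exp (\<alpha> n ^ 3 / 12) * exp (- \<xi>) - exp ((2 * \<alpha> n) ^ 3 / 12) * exp (- 2 * \<xi>) * (\<alpha> n / 4 * sqrt (8 * pi * \<alpha> n))
          \<le> kernel_trace (interpolating_kernel (\<alpha> n)) {t n<..}"
        using bounds(2) by blast
      show "\<forall>n. kernel_trace (interpolating_kernel (\<alpha> n)) {t n<..} \<le> exp (\<alpha> n ^ 3 / 12) * exp (- \<xi>)"
        using bounds(1) by blast
      have "(\<lambda>n. exp (\<alpha> n ^ 3 / 12) * exp (- \<xi>)) \<longlonglongrightarrow> exp (0 ^ 3 / 12) * exp (- \<xi>)"
        by (intro tendsto_intros lim) auto
      then show "(\<lambda>n. exp (\<alpha> n ^ 3 / 12) * exp (- \<xi>)) \<longlonglongrightarrow> exp (- \<xi>)" by simp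
      have "(\<lambda>n. exp (\<alpha> n ^ 3 / 12) * exp (- \<xi>) - exp ((2 * \<alpha> n) ^ 3 / 12) * exp (- 2 * \<xi>) * (\<alpha> n / 4 * sqrt (8 * pi * \<alpha> n)))
          \<longlonglongrightarrow> exp (0 ^ 3 / 12) * exp (- \<xi>) - exp ((2 * 0) ^ 3 / 12) * exp (- 2 * \<xi>) * (0 / 4 * sqrt (8 * pi * 0))"
        by (intro tendsto_intros lim) auto
      then show "(\<lambda>n. exp (\<alpha> n ^ 3 / 12) * exp (- \<xi>) - exp ((2 * \<alpha> n) ^ 3 / 12) * exp (- 2 * \<xi>) * (\<alpha> n / 4 * sqrt (8 * pi * \<alpha> n)))
          \<longlonglongrightarrow> exp (- \<xi>)" by simp
    qed
    show "e n > 0" for n using pos[of n] by (simp add: e_def)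
    have "(e n)\<^sup>2 = exp (\<alpha> n ^ 3 / 6) * exp (- 2 * \<xi>) * (2 * \<alpha> n * sqrt (4 * pi * \<alpha> n))" for n
      unfolding e_def using pos[of n] by (intro real_sqrt_pow2) auto
    then show "(\<integral>\<^sup>+x. \<integral>\<^sup>+y. ennreal (indicator {t n<..} x * indicator {t n<..} y * (interpolating_kernel (\<alpha> n) x y)\<^sup>2) \<partial>lborel \<partial>lborel)
        \<le> ennreal ((e n)\<^sup>2)" for n
      using bounds(3) by (simp only:)
    have "e \<longlonglongrightarrow> sqrt (exp (0 ^ 3 / 6) * exp (- 2 * \<xi>) * (2 * 0 * sqrt (4 * pi * 0)))"
      unfolding e_def by (intro tendsto_intros lim) auto
    then show "e \<longlonglongrightarrow> 0" by simp
  qed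
  then show "(\<lambda>n. fredholm_series (interpolating_kernel (\<alpha> n))
      {\<xi> / \<alpha> n - 1 / (2 * \<alpha> n) * ln (4 * pi * \<alpha> n ^ 3)<..}) \<longlonglongrightarrow> exp (- exp (- \<xi>))"
    by (simp only: t_def)
qed

section \<open>The Tracy-Widom limit, \<alpha> to infinity\<close>

lemma Tracy_Widom_cdf_eq: "Tracy_Widom_cdf \<xi> = fredholm_series Airy_kernel {\<xi><..}"
  unfolding Tracy_Widom_cdf_def Airy_kernel_eq
  by (rule airy_weight.fredholm_det_eq_series[OF airy_weight_Airy])

text \<open>At \<open>u = 0\<close> the quotient is 1/2 for every \<open>s\<close> while the
  indicator is 1; this single point is a null set for the kernel integrals.\<close>

lemma logistic_tendsto:
  fixes u :: real
  assumes "u \<noteq> 0"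
  shows "((\<lambda>s. exp (s * u) / (exp (s * u) + 1)) \<longlongrightarrow> indicator {0..} u) at_top"
proof (cases "u > 0")
  case True
  then show ?thesis by (simp add: indicator_def) real_asymp
next
  case False
  with assms have "u < 0" by simp
  then show ?thesis by (simp add: indicator_def) real_asymp
qed

lemma interpolating_Tracy_Widom_limit:
  "((\<lambda>\<alpha>. fredholm_series (interpolating_kernel \<alpha>) {\<xi><..}) \<longlongrightarrow> Tracy_Widom_cdf \<xi>) at_top"
proof (rule tendsto_at_topI_sequentially)
  fix s :: "nat \<Rightarrow> real"
  assume s: "filterlim s at_top sequentially"
  then have "\<forall>\<^sub>F n in sequentially. 1 \<le> s n" by (simp add: filterlim_at_top)
  \<comment> \<open>The sequence is shifted by \<open>N\<close> so that every member is at least 1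
    and all weights share the bound \<open>exp u\<close>.\<close>
  then obtain N where N: "1 \<le> s n" if "n \<ge> N" for n by (auto simp: eventually_sequentially)
  define \<sigma> where "\<sigma> n u = exp (s (n + N) * u) / (exp (s (n + N) * u) + 1)" for n u
  have weight: "airy_weight (\<sigma> n) 1" for n
    unfolding \<sigma>_def by (rule airy_weight_interpolating_ge_1) (simp add: N)
  have K: "interpolating_kernel (s (n + N)) = weighted_kernel (\<sigma> n)" for n
    by (simp add: interpolating_kernel_eq \<sigma>_def[abs_def])
  have "(\<lambda>n. fredholm_series (interpolating_kernel (s (n + N))) {\<xi><..}) \<longlonglongrightarrow> fredholm_series Airy_kernel {\<xi><..}"
    unfolding K
  proof (rule fredholm_series_tendsto)
    show "trace_class_kernel (weighted_kernel (\<sigma> n)) {\<xi><..}" for n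
      by (rule airy_weight.trace_class[OF weight]) auto
    show "trace_class_kernel Airy_kernel {\<xi><..}"
      unfolding Airy_kernel_eq by (rule airy_weight.trace_class[OF airy_weight_Airy]) auto
    show "integrable lborel (\<lambda>x. indicator {\<xi><..} x * heat_kernel 1 x x)"
      by (rule integrable.intros[OF heat_kernel_trace]) simp
    show "weighted_kernel (\<sigma> n) x x \<le> heat_kernel 1 x x" for n x
      by (rule airy_weight.weighted_kernel_diag_le[OF weight])
    show "(\<lambda>n. weighted_kernel (\<sigma> n) x y) \<longlonglongrightarrow> Airy_kernel x y" for x y
      unfolding Airy_kernel_eq weighted_kernel_def
    proof (rule integral_dominated_convergence)
      show "integrable lborel (\<lambda>u. exp (1 * u) * \<bar>Ai (x + u) * Ai (y + u)\<bar>)"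
        using integrable_abs[OF exp_weighted_Ai_product(1)[of 1 x y]] by (simp add: abs_mult)
      have "AE u in lborel. u \<noteq> (0::real)" by (rule AE_lborel_singleton)
      then show "AE u in lborel. (\<lambda>n. \<sigma> n u * (Ai (x + u) * Ai (y + u))) \<longlonglongrightarrow> indicator {0..} u * (Ai (x + u) * Ai (y + u))"
      proof eventually_elim
        fix u :: real assume "u \<noteq> 0"
        have "(\<lambda>n. \<sigma> n u) \<longlonglongrightarrow> indicator {0..} u"
          unfolding \<sigma>_def
          by (rule filterlim_compose[OF logistic_tendsto[OF \<open>u \<noteq> 0\<close>] filterlim_compose[OF s filterlim_add_const_nat_at_top]])
        then show "(\<lambda>n. \<sigma> n u * (Ai (x + u) * Ai (y + u))) \<longlonglongrightarrow> indicator {0..} u * (Ai (x + u) * Ai (y + u))"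
          by (intro tendsto_intros)
      qed
      show "AE u in lborel. norm (\<sigma> n u * (Ai (x + u) * Ai (y + u))) \<le> exp (1 * u) * \<bar>Ai (x + u) * Ai (y + u)\<bar>" for n
        unfolding real_norm_def abs_mult[of "\<sigma> n _"]
        using airy_weight.w_nonneg[OF weight, of n] airy_weight.w_le[OF weight, of n]
        by (intro always_eventually allI mult_right_mono) auto
      show "(\<lambda>u. \<sigma> n u * (Ai (x + u) * Ai (y + u))) \<in> borel_measurable lborel" for n
        using airy_weight.w_measurable[OF weight, of n] by measurable
    qed measurable
  qed auto
  then have "(\<lambda>n. fredholm_series (interpolating_kernel (s n)) {\<xi><..}) \<longlonglongrightarrow> fredholm_series Airy_kernel {\<xi><..}"
    by (rule LIMSEQ_offset)
  then show "(\<lambda>n. fredholm_series (interpolating_kernel (s n)) {\<xi><..}) \<longlonglongrightarrow> Tracy_Widom_cdf \<xi>"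
    by (simp only: Tracy_Widom_cdf_eq)
qed

lemma set_integral_kernel_minor:
  "(LINT x:({..<n} \<rightarrow>\<^sub>E S)|(\<Pi>\<^sub>M i\<in>{..<n}. lborel). kernel_minor K n x) = minor_integral K S n"
  unfolding set_lebesgue_integral_def minor_integral_def
proof (rule Bochner_Integration.integral_cong[OF refl])
  fix x :: "nat \<Rightarrow> real"
  assume "x \<in> space (\<Pi>\<^sub>M i\<in>{..<n}. lborel)"
  then have "(x \<in> {..<n} \<rightarrow>\<^sub>E S) \<longleftrightarrow> (\<forall>j<n. x j \<in> S)" by (auto simp: space_PiM PiE_iff)
  moreover have "(\<Prod>j<n. indicator S (x j)) = (if \<forall>j<n. x j \<in> S then 1 else 0 :: real)"
    by (auto simp: indicator_def intro!: prod.neutral prod_zero)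
  ultimately show "indicator ({..<n} \<rightarrow>\<^sub>E S) x *\<^sub>R kernel_minor K n x = (\<Prod>j<n. indicator S (x j)) * kernel_minor K n x"
    by (simp add: indicator_def)
qed

theorem theorem1p3:
  fixes P :: "real \<Rightarrow> 'w measure" and X :: "real \<Rightarrow> 'w \<Rightarrow> real \<Rightarrow> nat"
  assumes "\<And>\<alpha>. \<alpha> > 0 \<Longrightarrow> determinantal_process (P \<alpha>) (X \<alpha>) (interpolating_kernel \<alpha>)"
  shows "(\<forall>\<alpha>>0. AE w in P \<alpha>. \<exists>x. is_last_particle (X \<alpha> w) x) \<and>
    (\<forall>\<alpha>>0. \<forall>t.
       (\<lambda>n. (-1) ^ n / fact n *
          (LINT x:({..<n} \<rightarrow>\<^sub>E {t<..})|(\<Pi>\<^sub>M i\<in>{..<n}. lborel).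
             kernel_minor (interpolating_kernel \<alpha>) n x))
         sums last_particle_cdf (P \<alpha>) (X \<alpha>) t \<and>
       last_particle_cdf (P \<alpha>) (X \<alpha>) t =
         fredholm_det {t<..} (integral_operator {t<..} (interpolating_kernel \<alpha>))) \<and>
    (\<forall>\<xi>. ((\<lambda>\<alpha>. last_particle_cdf (P \<alpha>) (X \<alpha>)
                    (\<xi> / \<alpha> - 1 / (2 * \<alpha>) * ln (4 * pi * \<alpha> ^ 3)))
            \<longlongrightarrow> Gumbel_cdf \<xi>) (at_right 0)) \<and>
    (\<forall>\<xi>. ((\<lambda>\<alpha>. last_particle_cdf (P \<alpha>) (X \<alpha>) \<xi>) \<longlongrightarrow> Tracy_Widom_cdf \<xi>) at_top)"
proof (intro conjI allI impI)
  have det: "determinantal (interpolating_kernel \<alpha>) (P \<alpha>) (X \<alpha>)" if "\<alpha> > 0" for \<alpha>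
  proof -
    interpret airy_weight "\<lambda>u. exp (\<alpha> * u) / (exp (\<alpha> * u) + 1)" \<alpha>
      by (rule airy_weight_interpolating[OF that])
    show ?thesis
    proof (intro determinantal.intro determinantal_axioms.intro)
      show "psd_kernel (interpolating_kernel \<alpha>)"
        unfolding interpolating_kernel_eq by (rule psd_kernel_axioms)
      show "determinantal_process (P \<alpha>) (X \<alpha>) (interpolating_kernel \<alpha>)" by (rule assms[OF that])
      show "integrable lborel (\<lambda>x. indicator {t<..} x * interpolating_kernel \<alpha> x x)" for t
        unfolding interpolating_kernel_eq
        by (rule trace_class_kernel.trace[OF trace_class]) auto
    qed (rule interpolating_trace_unbounded[OF that])
  qed
  note cdf_eq = determinantal.last_particle_cdf_eq[OF det]
  {
    fix \<alpha> :: real assume \<alpha>: "\<alpha> > 0"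
    show "AE w in P \<alpha>. \<exists>x. is_last_particle (X \<alpha> w) x"
      using determinantal.AE_has_last[OF det[OF \<alpha>]]
      by eventually_elim (simp add: determinantal.has_last_def[OF det[OF \<alpha>]])
    fix t :: real
    show "(\<lambda>n. (-1) ^ n / fact n *
        (LINT x:({..<n} \<rightarrow>\<^sub>E {t<..})|(\<Pi>\<^sub>M i\<in>{..<n}. lborel). kernel_minor (interpolating_kernel \<alpha>) n x))
      sums last_particle_cdf (P \<alpha>) (X \<alpha>) t"
      unfolding cdf_eq[OF \<alpha>] set_integral_kernel_minor interpolating_kernel_eq
      by (intro trace_class_kernel.fredholm_series_sums airy_weight.trace_class[OF airy_weight_interpolating[OF \<alpha>]]) auto
    show "last_particle_cdf (P \<alpha>) (X \<alpha>) t = fredholm_det {t<..} (integral_operator {t<..} (interpolating_kernel \<alpha>))"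
      unfolding cdf_eq[OF \<alpha>] interpolating_kernel_eq
      by (rule airy_weight.fredholm_det_eq_series[OF airy_weight_interpolating[OF \<alpha>], symmetric])
  }
  fix \<xi> :: real
  show "((\<lambda>\<alpha>. last_particle_cdf (P \<alpha>) (X \<alpha>) (\<xi> / \<alpha> - 1 / (2 * \<alpha>) * ln (4 * pi * \<alpha> ^ 3)))
      \<longlongrightarrow> Gumbel_cdf \<xi>) (at_right 0)"
    by (rule Lim_transform_eventually[OF interpolating_Gumbel_limit])
      (auto simp: eventually_at_right_field cdf_eq intro!: exI[of _ 1])
  show "((\<lambda>\<alpha>. last_particle_cdf (P \<alpha>) (X \<alpha>) \<xi>) \<longlongrightarrow> Tracy_Widom_cdf \<xi>) at_top"
    by (rule Lim_transform_eventually[OF interpolating_Tracy_Widom_limit], rule eventually_mono[OF eventually_gt_at_top[of 0]])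
      (simp add: cdf_eq)
qed

end
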